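(* Let $b>0$. Let $f\in C(\mathbb{R})$ be strictly increasing with $f(0)=0$ and $f(s)\to\pm\infty$ as $s\to\pm\infty$, and suppose $|s|^{-\beta}f(s)\to\pm C_{f\pm}$ as $s\to\pm\infty$ for some $\beta>0$ and constants $C_{f+},C_{f-}>0$. Let $g\in C(\mathbb{R})$ be positive and such that $|s|^{\alpha}g(s)\to C_{g\pm}$ as $s\to\pm\infty$ for some exponent $\alpha\le 1$ and constants $C_{g+},C_{g-}>0$. Consider the problem $$u_t-f(g(u_x)u_{xx})=0 \text{ in } (-b,b)\times(0,\infty),\qquad \lim_{x\to\pm b}u(x,t)=\infty \text{ for any } t>0,\qquad u(\cdot,0)=u_0 \text{ in } (-b,b). \quad (P)$$ (a) If $\alpha<1$, $\beta\ge\frac{1}{1-\alpha}$ and $u_0\in C((-b,b))$ satisfies $\inf_{x\in(-b,b)}u_0(x)>-\infty$, then there is no viscosity solution $u:(-b,b)\times[0,\infty)\to\mathbb{R}$ of $(P)$. (b) Suppose that either $\alpha=1$, or $\alpha<1$ and $\beta<\frac{1}{1-\alpha}$. Suppose also that either $u_0\in C([-b,b])$, or $u_0\in C((-b,b))$ satisfies $$\lim_{x\to\pm b}u_0(x)=\infty,\quad \limsup_{x\to b}u_0(x)(b-x)^{\gamma}<\infty,\quad \limsup_{x\to -b}u_0(x)(b+x)^{\gamma}<\infty$$ for some $\gamma>0$. Then there exists a viscosity solution $u:(-b,b)\times[0,\infty)\to\mathbb{R}$ of $(P)$.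
   Context: Let $Q=(-b,b)\times(0,\infty)$, $Q_0=(-b,b)\times[0,\infty)$ and $F(p,z)=-f(g(p)z)$ for $p,z\in\mathbb{R}$. For a function $u$ on $Q_0$, its upper and lower semicontinuous envelopes are $u^*(x,t)=\lim_{r\to+0}\sup\{u(y,s):(y,s)\in Q_0\cap B_r((x,t))\}$ and $u_*(x,t)=\lim_{r\to+0}\inf\{u(y,s):(y,s)\in Q_0\cap B_r((x,t))\}$, for $(x,t)\in\overline{Q}$. An upper semicontinuous function $u$ in $Q_0$ is a sub-solution (of the equation with the singular boundary condition) if whenever $(x_0,t_0)\in Q$ and $\phi\in C^2(Q)$ are such that $u-\phi$ attains a local maximum at $(x_0,t_0)$, one has $\phi_t(x_0,t_0)+F(\phi_x(x_0,t_0),\phi_{xx}(x_0,t_0))\le 0$. A lower semicontinuous function $u$ in $Q_0$ is a super-solution if (i) whenever $(x_0,t_0)\in Q$ and $\phi\in C^2(Q)$ are such that $u-\phi$ attains a local minimum at $(x_0,t_0)$, one has $\phi_t(x_0,t_0)+F(\phi_x(x_0,t_0),\phi_{xx}(x_0,t_0))\ge 0$; and (ii) $\lim_{x\to\pm b}u(x,t)=\infty$ for any $t>0$. A function $u$ defined in $Q_0$ is a viscosity solution of $(P)$ if $u^*$ is a sub-solution, $u_*$ is a super-solution, and $u^*(\cdot,0)=u_*(\cdot,0)=u_0$ in $(-b,b)$. *)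

theory Defs
  imports "HOL-Analysis.Analysis"
begin

text \<open>
  Points of the plane are pairs \<open>(x, t)\<close>.  A function on a subset of the plane is represented by
  a total function of which only the values on that subset are ever used.
\<close>

definition Q :: "real \<Rightarrow> (real \<times> real) set"
  where "Q b = {-b<..<b} \<times> {0<..}"

definition Q0 :: "real \<Rightarrow> (real \<times> real) set"
  where "Q0 b = {-b<..<b} \<times> {0..}"

definition F :: "(real \<Rightarrow> real) \<Rightarrow> (real \<Rightarrow> real) \<Rightarrow> real \<Rightarrow> real \<Rightarrow> real"
  where "F f g p z = - f (g p * z)"

text \<open>The envelopes may be infinite, at \<open>x = \<plusminus>b\<close> in particular, hence the extended reals.\<close>

definition upper_envelope :: "real \<Rightarrow> (real \<times> real \<Rightarrow> real) \<Rightarrow> real \<times> real \<Rightarrow> ereal"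
  where "upper_envelope b u z = Lim (at_right 0) (\<lambda>r. SUP w \<in> Q0 b \<inter> ball z r. ereal (u w))"

definition lower_envelope :: "real \<Rightarrow> (real \<times> real \<Rightarrow> real) \<Rightarrow> real \<times> real \<Rightarrow> ereal"
  where "lower_envelope b u z = Lim (at_right 0) (\<lambda>r. INF w \<in> Q0 b \<inter> ball z r. ereal (u w))"

definition usc_on :: "'a::topological_space set \<Rightarrow> ('a \<Rightarrow> real) \<Rightarrow> bool"
  where "usc_on S u \<longleftrightarrow> (\<forall>z\<in>S. \<forall>c>u z. \<forall>\<^sub>F w in at z within S. u w < c)"

definition lsc_on :: "'a::topological_space set \<Rightarrow> ('a \<Rightarrow> real) \<Rightarrow> bool"
  where "lsc_on S u \<longleftrightarrow> (\<forall>z\<in>S. \<forall>c<u z. \<forall>\<^sub>F w in at z within S. c < u w)"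

definition partial_x :: "(real \<times> real \<Rightarrow> real) \<Rightarrow> real \<times> real \<Rightarrow> real"
  where "partial_x \<phi> = (\<lambda>(x, t). deriv (\<lambda>y. \<phi> (y, t)) x)"

definition partial_t :: "(real \<times> real \<Rightarrow> real) \<Rightarrow> real \<times> real \<Rightarrow> real"
  where "partial_t \<phi> = (\<lambda>(x, t). deriv (\<lambda>s. \<phi> (x, s)) t)"

text \<open>
  The classes \<open>C\<^sup>1\<close> and \<open>C\<^sup>2\<close> on an open set, by existence and continuity of the partial derivatives.
\<close>

definition C1_on :: "(real \<times> real) set \<Rightarrow> (real \<times> real \<Rightarrow> real) \<Rightarrow> bool"
  where "C1_on S \<phi> \<longleftrightarrow>
    (\<forall>(x, t)\<in>S. (\<lambda>y. \<phi> (y, t)) differentiable (at x) \<and> (\<lambda>s. \<phi> (x, s)) differentiable (at t)) \<and>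
    continuous_on S (partial_x \<phi>) \<and> continuous_on S (partial_t \<phi>)"

definition C2_on :: "(real \<times> real) set \<Rightarrow> (real \<times> real \<Rightarrow> real) \<Rightarrow> bool"
  where "C2_on S \<phi> \<longleftrightarrow> C1_on S \<phi> \<and> C1_on S (partial_x \<phi>) \<and> C1_on S (partial_t \<phi>)"

text \<open>
  Below, local extrema are only considered at points of the open set \<open>Q b\<close>, so neighbourhoods
  in the plane and neighbourhoods relative to \<open>Q b\<close> or \<open>Q0 b\<close> give the same notion.
\<close>

definition sub_solution ::
    "real \<Rightarrow> (real \<Rightarrow> real) \<Rightarrow> (real \<Rightarrow> real) \<Rightarrow> (real \<times> real \<Rightarrow> real) \<Rightarrow> bool"
  where "sub_solution b f g u \<longleftrightarrow>
    usc_on (Q0 b) u \<and>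
    (\<forall>z0\<in>Q b. \<forall>\<phi>. C2_on (Q b) \<phi> \<longrightarrow>
      (\<forall>\<^sub>F z in nhds z0. u z - \<phi> z \<le> u z0 - \<phi> z0) \<longrightarrow>
      partial_t \<phi> z0 + F f g (partial_x \<phi> z0) (partial_x (partial_x \<phi>) z0) \<le> 0)"

definition super_solution ::
    "real \<Rightarrow> (real \<Rightarrow> real) \<Rightarrow> (real \<Rightarrow> real) \<Rightarrow> (real \<times> real \<Rightarrow> real) \<Rightarrow> bool"
  where "super_solution b f g u \<longleftrightarrow>
    lsc_on (Q0 b) u \<and>
    (\<forall>z0\<in>Q b. \<forall>\<phi>. C2_on (Q b) \<phi> \<longrightarrow>
      (\<forall>\<^sub>F z in nhds z0. u z - \<phi> z \<ge> u z0 - \<phi> z0) \<longrightarrow>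
      partial_t \<phi> z0 + F f g (partial_x \<phi> z0) (partial_x (partial_x \<phi>) z0) \<ge> 0) \<and>
    (\<forall>t>0. filterlim (\<lambda>x. u (x, t)) at_top (at_left b) \<and>
           filterlim (\<lambda>x. u (x, t)) at_top (at_right (-b)))"

text \<open>
  Sub- and super-solutions are real-valued functions on \<open>Q0 b\<close>, so being one entails that the
  envelope in question is finite there: \<open>v\<close> and \<open>w\<close> are the restrictions of the upper and the
  lower envelope of \<open>u\<close> to \<open>Q0 b\<close>.
\<close>

definition viscosity_solution ::
    "real \<Rightarrow> (real \<Rightarrow> real) \<Rightarrow> (real \<Rightarrow> real) \<Rightarrow> (real \<Rightarrow> real) \<Rightarrow> (real \<times> real \<Rightarrow> real) \<Rightarrow> bool"
  where "viscosity_solution b f g u0 u \<longleftrightarrow>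
    (\<exists>v w. (\<forall>z\<in>Q0 b. upper_envelope b u z = ereal (v z) \<and> lower_envelope b u z = ereal (w z)) \<and>
      sub_solution b f g v \<and> super_solution b f g w \<and>
      (\<forall>x\<in>{-b<..<b}. v (x, 0) = u0 x \<and> w (x, 0) = u0 x))"

end

theory Submission
  imports Defs
begin

text \<open>
  Part (b) is Perron's method. The test functions on the upper side are strict classical
  super-solutions \<open>m + K (x - y)\<^sup>2 (b\<^sup>2 - x\<^sup>2) powr - \<gamma> + K (exp (\<Lambda> t) - 1) (b\<^sup>2 - x\<^sup>2) powr - \<gamma> + H t\<close>, which
  exist because \<open>\<beta> (1 - \<alpha>) < 1\<close> makes the diffusion sublinear near the boundary; on the lower side
  they are paraboloids and the waves \<open>c t + A (exp (\<plusminus>\<mu> x) - exp (\<mu> b))\<close>. No comparison principle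
  between sub- and super-solutions is needed, only comparison with classical strict ones.

  For part (a), if \<open>\<beta> (1 - \<alpha>) \<ge> 1\<close> the functions \<open>A (exp (\<lambda> t - \<mu> (b - x)) - 1)\<close> are strict
  sub-solutions for all large \<open>A\<close> with \<open>\<lambda>\<close>, \<open>\<mu>\<close> fixed, so infinite boundary values that are attained
  locally uniformly in time force a super-solution to be infinite inside. The difficulty is that the
  definition requires \<open>u(x, t) \<rightarrow> \<infinity>\<close> only for each \<open>t\<close> separately; local uniformity has to be derived,
  by two applications of Baire's theorem.
\<close>

subsection \<open>Partial derivatives\<close>

text \<open>Let \<open>d\<close> be the distance to the boundary and \<theta> =
  \<open>\<beta> * (1 - \<alpha>)\<close>. A profile of size \<open>K * d powr - \<gamma>\<close>
  has slope and curvature smaller by one and two powers of \<open>d\<close>, so its diffusion term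
  has the size \<open>K powr \<theta> * d powr (- \<theta> * (\<gamma> + 1) - \<beta>)\<close>. If
  \<theta> < 1, a large \<gamma> makes this no more singular than the time derivative, of order
  \<open>d powr - \<gamma>\<close>; hence the singular barriers, and initial data of any polynomial
  growth. If \<theta> \<ge> 1, the same exponent says that the diffusion grows at least linearly
  with the amplitude.

  For (a), the obstacle is that the times of locally uniform blow-up form open intervals that may be
  arbitrarily short, and that uniformity may be lost at the corner where such an interval begins.
  Two boundary layers with the same scaling show that the corner does no harm. Affine functions, on
  which the diffusion vanishes, then give a lower bound whose slope does not depend on the length of
  the interval. This independence is what allows infinitely many intervals to be treated at
  once.\<close>

definition residual :: "(real \<Rightarrow> real) \<Rightarrow> (real \<Rightarrow> real) \<Rightarrow> (real \<times> real \<Rightarrow> real) \<Rightarrow> real \<times> real \<Rightarrow> real"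
  where "residual f g \<phi> z = partial_t \<phi> z + F f g (partial_x \<phi> z) (partial_x (partial_x \<phi>) z)"

lemma open_Q: "open (Q b)"
  unfolding Q_def by (intro open_Times) auto

lemma Q_subset_Q0: "Q b \<subseteq> Q0 b"
  unfolding Q_def Q0_def by auto

lemma eventually_slice_x:
  fixes S :: "(real \<times> real) set"
  assumes "open S" "(x, t) \<in> S"
  shows "\<forall>\<^sub>F y in nhds x. (y, t) \<in> S"
proof -
  have "((\<lambda>y. (y, t)) \<longlongrightarrow> (x, t)) (nhds x)"
    by (intro tendsto_Pair tendsto_const) (simp add: filterlim_ident)
  from topological_tendstoD[OF this assms] show ?thesis .
qed

lemma eventually_slice_t:
  fixes S :: "(real \<times> real) set"
  assumes "open S" "(x, t) \<in> S"
  shows "\<forall>\<^sub>F s in nhds t. (x, s) \<in> S"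
proof -
  have "((\<lambda>s. (x, s)) \<longlongrightarrow> (x, t)) (nhds t)"
    by (intro tendsto_Pair tendsto_const) (simp add: filterlim_ident)
  from topological_tendstoD[OF this assms] show ?thesis .
qed

lemma has_derivative_slice_cong:
  fixes \<phi> \<psi> :: "real \<times> real \<Rightarrow> real"
  assumes "open S" "(x, t) \<in> S" "\<And>z. z \<in> S \<Longrightarrow> \<phi> z = \<psi> z"
  shows "((\<lambda>y. \<phi> (y, t)) has_field_derivative d) (at x) \<longleftrightarrow> ((\<lambda>y. \<psi> (y, t)) has_field_derivative d) (at x)"
    and "((\<lambda>s. \<phi> (x, s)) has_field_derivative d) (at t) \<longleftrightarrow> ((\<lambda>s. \<psi> (x, s)) has_field_derivative d) (at t)"
proof -
  show "((\<lambda>y. \<phi> (y, t)) has_field_derivative d) (at x) \<longleftrightarrow> ((\<lambda>y. \<psi> (y, t)) has_field_derivative d) (at x)"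
    by (intro DERIV_cong_ev refl eventually_mono[OF eventually_slice_x[OF assms(1,2)]] assms(3)) auto
  show "((\<lambda>s. \<phi> (x, s)) has_field_derivative d) (at t) \<longleftrightarrow> ((\<lambda>s. \<psi> (x, s)) has_field_derivative d) (at t)"
    by (intro DERIV_cong_ev refl eventually_mono[OF eventually_slice_t[OF assms(1,2)]] assms(3)) auto
qed

lemma C1_onI:
  assumes "\<And>x t. (x, t) \<in> S \<Longrightarrow> ((\<lambda>y. \<phi> (y, t)) has_field_derivative \<phi>x (x, t)) (at x)"
    and "\<And>x t. (x, t) \<in> S \<Longrightarrow> ((\<lambda>s. \<phi> (x, s)) has_field_derivative \<phi>t (x, t)) (at t)"
    and "continuous_on S \<phi>x" "continuous_on S \<phi>t"
  shows "C1_on S \<phi>" "\<And>z. z \<in> S \<Longrightarrow> partial_x \<phi> z = \<phi>x z" "\<And>z. z \<in> S \<Longrightarrow> partial_t \<phi> z = \<phi>t z"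
proof -
  show x: "partial_x \<phi> z = \<phi>x z" if "z \<in> S" for z
    using assms(1)[of "fst z" "snd z"] that by (auto simp: partial_x_def case_prod_beta intro!: DERIV_imp_deriv)
  show t: "partial_t \<phi> z = \<phi>t z" if "z \<in> S" for z
    using assms(2)[of "fst z" "snd z"] that by (auto simp: partial_t_def case_prod_beta intro!: DERIV_imp_deriv)
  have "continuous_on S (partial_x \<phi>)" "continuous_on S (partial_t \<phi>)"
    using assms(3,4) x t by (simp_all cong: continuous_on_cong)
  then show "C1_on S \<phi>"
    using assms(1,2) unfolding C1_on_def real_differentiable_def by blast
qed

lemma C1_onD:
  assumes "C1_on S \<phi>"
  shows "(x, t) \<in> S \<Longrightarrow> ((\<lambda>y. \<phi> (y, t)) has_field_derivative partial_x \<phi> (x, t)) (at x)"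
    and "(x, t) \<in> S \<Longrightarrow> ((\<lambda>s. \<phi> (x, s)) has_field_derivative partial_t \<phi> (x, t)) (at t)"
    and "continuous_on S (partial_x \<phi>)" "continuous_on S (partial_t \<phi>)"
  using assms unfolding C1_on_def partial_x_def partial_t_def
  by (auto simp: DERIV_deriv_iff_real_differentiable)

lemma C1_on_cong:
  assumes "open S" "\<And>z. z \<in> S \<Longrightarrow> \<phi> z = \<psi> z" "C1_on S \<psi>"
  shows "C1_on S \<phi>"
    and "\<And>z. z \<in> S \<Longrightarrow> partial_x \<phi> z = partial_x \<psi> z"
    and "\<And>z. z \<in> S \<Longrightarrow> partial_t \<phi> z = partial_t \<psi> z"
proof -
  have x: "((\<lambda>y. \<phi> (y, t)) has_field_derivative partial_x \<psi> (x, t)) (at x)"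
    and t: "((\<lambda>s. \<phi> (x, s)) has_field_derivative partial_t \<psi> (x, t)) (at t)" if "(x, t) \<in> S" for x t
    using C1_onD(1,2)[OF assms(3) that] has_derivative_slice_cong[of S x t \<phi> \<psi>, OF assms(1) that assms(2)]
    by simp_all
  show "C1_on S \<phi>" "\<And>z. z \<in> S \<Longrightarrow> partial_x \<phi> z = partial_x \<psi> z"
    "\<And>z. z \<in> S \<Longrightarrow> partial_t \<phi> z = partial_t \<psi> z"
    using C1_onI[of S \<phi> "partial_x \<psi>" "partial_t \<psi>", OF x t C1_onD(3,4)[OF assms(3)]] by simp_all
qed

text \<open>\<open>partial_x\<close> is a \<open>deriv\<close>, hence agrees with the explicit
  \<phi>x only on \<open>S\<close>. Openness of \<open>S\<close> lets the second derivatives be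
  taken of \<phi>x instead, since differentiation sees only a neighbourhood.\<close>

lemma C2_onI:
  assumes S: "open S"
    and x: "\<And>x t. (x, t) \<in> S \<Longrightarrow> ((\<lambda>y. \<phi> (y, t)) has_field_derivative \<phi>x (x, t)) (at x)"
    and t: "\<And>x t. (x, t) \<in> S \<Longrightarrow> ((\<lambda>s. \<phi> (x, s)) has_field_derivative \<phi>t (x, t)) (at t)"
    and cont: "continuous_on S \<phi>x" "continuous_on S \<phi>t"
    and C1: "C1_on S \<phi>x" "C1_on S \<phi>t"
  shows "C2_on S \<phi>" "\<And>z. z \<in> S \<Longrightarrow> partial_x \<phi> z = \<phi>x z" "\<And>z. z \<in> S \<Longrightarrow> partial_t \<phi> z = \<phi>t z"
    "\<And>z. z \<in> S \<Longrightarrow> partial_x (partial_x \<phi>) z = partial_x \<phi>x z"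
proof -
  note * = C1_onI[OF x t cont]
  show "\<And>z. z \<in> S \<Longrightarrow> partial_x \<phi> z = \<phi>x z" "\<And>z. z \<in> S \<Longrightarrow> partial_t \<phi> z = \<phi>t z"
    using * by auto
  note ** = C1_on_cong[OF S *(2) C1(1)] C1_on_cong[OF S *(3) C1(2)]
  show "\<And>z. z \<in> S \<Longrightarrow> partial_x (partial_x \<phi>) z = partial_x \<phi>x z"
    using ** by auto
  show "C2_on S \<phi>"
    unfolding C2_on_def using * ** by blast
qed

lemma C2_on_add:
  assumes S: "open S" and "C2_on S \<phi>" "C2_on S \<psi>"
  shows "C2_on S (\<lambda>z. \<phi> z + \<psi> z)"
    and "\<And>z. z \<in> S \<Longrightarrow> partial_x (\<lambda>z. \<phi> z + \<psi> z) z = partial_x \<phi> z + partial_x \<psi> z"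
    and "\<And>z. z \<in> S \<Longrightarrow> partial_t (\<lambda>z. \<phi> z + \<psi> z) z = partial_t \<phi> z + partial_t \<psi> z"
    and "\<And>z. z \<in> S \<Longrightarrow> partial_x (partial_x (\<lambda>z. \<phi> z + \<psi> z)) z =
           partial_x (partial_x \<phi>) z + partial_x (partial_x \<psi>) z"
proof -
  have add: "C1_on S (\<lambda>z. f z + g z)"
       "\<And>z. z \<in> S \<Longrightarrow> partial_x (\<lambda>z. f z + g z) z = partial_x f z + partial_x g z"
       "\<And>z. z \<in> S \<Longrightarrow> partial_t (\<lambda>z. f z + g z) z = partial_t f z + partial_t g z"
    if "C1_on S f" "C1_on S g" for f g
  proof -
    note D = C1_onD[OF that(1)] C1_onD[OF that(2)]
    have 1: "((\<lambda>y. f (y, t) + g (y, t)) has_field_derivative partial_x f (x, t) + partial_x g (x, t)) (at x)"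
      and 2: "((\<lambda>s. f (x, s) + g (x, s)) has_field_derivative partial_t f (x, t) + partial_t g (x, t)) (at t)"
      if "(x, t) \<in> S" for x t
      using D that by (auto intro!: DERIV_add)
    have 3: "continuous_on S (\<lambda>z. partial_x f z + partial_x g z)"
      "continuous_on S (\<lambda>z. partial_t f z + partial_t g z)"
      using D by (auto intro!: continuous_on_add)
    note * = C1_onI[of S "\<lambda>z. f z + g z", OF 1 2 3]
    show "C1_on S (\<lambda>z. f z + g z)"
       "\<And>z. z \<in> S \<Longrightarrow> partial_x (\<lambda>z. f z + g z) z = partial_x f z + partial_x g z"
       "\<And>z. z \<in> S \<Longrightarrow> partial_t (\<lambda>z. f z + g z) z = partial_t f z + partial_t g z"
      using * by simp_all
  qed
  have C1: "C1_on S \<phi>" "C1_on S \<psi>" "C1_on S (partial_x \<phi>)" "C1_on S (partial_x \<psi>)"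
    "C1_on S (partial_t \<phi>)" "C1_on S (partial_t \<psi>)"
    using assms(2,3) unfolding C2_on_def by auto
  note D = C1_onD[OF C1(1)] C1_onD[OF C1(2)]
  have X: "((\<lambda>y. \<phi> (y, t) + \<psi> (y, t)) has_field_derivative partial_x \<phi> (x, t) + partial_x \<psi> (x, t)) (at x)"
    and T: "((\<lambda>s. \<phi> (x, s) + \<psi> (x, s)) has_field_derivative partial_t \<phi> (x, t) + partial_t \<psi> (x, t)) (at t)"
    if "(x, t) \<in> S" for x t
    using D that by (auto intro!: DERIV_add)
  have c: "continuous_on S (\<lambda>z. partial_x \<phi> z + partial_x \<psi> z)"
    "continuous_on S (\<lambda>z. partial_t \<phi> z + partial_t \<psi> z)"
    using D by (auto intro!: continuous_on_add)
  note * = C2_onI[OF S, of "\<lambda>z. \<phi> z + \<psi> z" "\<lambda>z. partial_x \<phi> z + partial_x \<psi> z"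
      "\<lambda>z. partial_t \<phi> z + partial_t \<psi> z", OF X T c add(1)[OF C1(3,4)] add(1)[OF C1(5,6)]]
  show "C2_on S (\<lambda>z. \<phi> z + \<psi> z)"
    "\<And>z. z \<in> S \<Longrightarrow> partial_x (\<lambda>z. \<phi> z + \<psi> z) z = partial_x \<phi> z + partial_x \<psi> z"
    "\<And>z. z \<in> S \<Longrightarrow> partial_t (\<lambda>z. \<phi> z + \<psi> z) z = partial_t \<phi> z + partial_t \<psi> z"
    "\<And>z. z \<in> S \<Longrightarrow> partial_x (partial_x (\<lambda>z. \<phi> z + \<psi> z)) z =
           partial_x (partial_x \<phi>) z + partial_x (partial_x \<psi>) z"
    using * add(2)[OF C1(3,4)] by auto
qed

lemma continuous_on_slice:
  assumes "continuous_on {-b<..<b} p" "continuous_on {0<..} q"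
  shows "continuous_on (Q b) (\<lambda>z. p (fst z))" "continuous_on (Q b) (\<lambda>z. q (snd z))"
  by (rule continuous_on_compose2[OF assms(1)] continuous_on_compose2[OF assms(2)];
      auto simp: Q_def intro: continuous_intros)+

text \<open>All test functions below are of this shape, so their regularity and their derivatives
  reduce to one-variable calculus. The product term serves the barriers whose spatial profile grows
  in time.\<close>

lemma C2_on_separable:
  fixes a a1 a2 c c1 c2 d d1 d2 e e1 e2 :: "real \<Rightarrow> real"
  assumes a: "\<And>x. x \<in> {-b<..<b} \<Longrightarrow> (a has_field_derivative a1 x) (at x)"
      "\<And>x. x \<in> {-b<..<b} \<Longrightarrow> (a1 has_field_derivative a2 x) (at x)" "continuous_on {-b<..<b} a2"
    and d: "\<And>x. x \<in> {-b<..<b} \<Longrightarrow> (d has_field_derivative d1 x) (at x)"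
      "\<And>x. x \<in> {-b<..<b} \<Longrightarrow> (d1 has_field_derivative d2 x) (at x)" "continuous_on {-b<..<b} d2"
    and c: "\<And>t. t > 0 \<Longrightarrow> (c has_field_derivative c1 t) (at t)"
      "\<And>t. t > 0 \<Longrightarrow> (c1 has_field_derivative c2 t) (at t)" "continuous_on {0<..} c2"
    and e: "\<And>t. t > 0 \<Longrightarrow> (e has_field_derivative e1 t) (at t)"
      "\<And>t. t > 0 \<Longrightarrow> (e1 has_field_derivative e2 t) (at t)" "continuous_on {0<..} e2"
  defines "\<phi> \<equiv> (\<lambda>z. a (fst z) * c (snd z) + d (fst z) + e (snd z))"
  shows "C2_on (Q b) \<phi>"
    and "\<And>x t. (x, t) \<in> Q b \<Longrightarrow> partial_x \<phi> (x, t) = a1 x * c t + d1 x"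
    and "\<And>x t. (x, t) \<in> Q b \<Longrightarrow> partial_t \<phi> (x, t) = a x * c1 t + e1 t"
    and "\<And>x t. (x, t) \<in> Q b \<Longrightarrow> partial_x (partial_x \<phi>) (x, t) = a2 x * c t + d2 x"
proof -
  have cx: "continuous_on {-b<..<b} a" "continuous_on {-b<..<b} a1" "continuous_on {-b<..<b} d1"
    using a d by (meson DERIV_atLeastAtMost_imp_continuous_on DERIV_isCont continuous_at_imp_continuous_on)+
  have ct: "continuous_on {0<..} c" "continuous_on {0<..} c1" "continuous_on {0<..} e1"
    using c e by (meson DERIV_isCont continuous_at_imp_continuous_on greaterThan_iff)+
  note cont = continuous_on_slice(1)[OF cx(1) ct(1)] continuous_on_slice(1)[OF cx(2) ct(1)]
    continuous_on_slice(1)[OF cx(3) ct(1)] continuous_on_slice(2)[OF cx(1) ct(1)]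
    continuous_on_slice(2)[OF cx(1) ct(2)] continuous_on_slice(2)[OF cx(1) ct(3)]
    continuous_on_slice[OF a(3) c(3)] continuous_on_slice[OF d(3) e(3)]
  let ?x = "\<lambda>z. a1 (fst z) * c (snd z) + d1 (fst z)"
  let ?t = "\<lambda>z. a (fst z) * c1 (snd z) + e1 (snd z)"
  let ?xx = "\<lambda>z. a2 (fst z) * c (snd z) + d2 (fst z)"
  have mem: "x \<in> {-b<..<b}" "t > 0" if "(x, t) \<in> Q b" for x t
    using that by (auto simp: Q_def)
  have X: "((\<lambda>y. \<phi> (y, t)) has_field_derivative ?x (x, t)) (at x)"
    and T: "((\<lambda>s. \<phi> (x, s)) has_field_derivative ?t (x, t)) (at t)"
    and XX: "((\<lambda>y. ?x (y, t)) has_field_derivative ?xx (x, t)) (at x)"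
    and XT: "((\<lambda>s. ?x (x, s)) has_field_derivative a1 (fst (x, t)) * c1 (snd (x, t))) (at t)"
    and TX: "((\<lambda>y. ?t (y, t)) has_field_derivative a1 (fst (x, t)) * c1 (snd (x, t))) (at x)"
    and TT: "((\<lambda>s. ?t (x, s)) has_field_derivative a (fst (x, t)) * c2 (snd (x, t)) + e2 (snd (x, t))) (at t)"
    if "(x, t) \<in> Q b" for x t
    unfolding \<phi>_def using mem[OF that]
    by (auto intro!: derivative_eq_intros a d c e)
  have cc: "continuous_on (Q b) ?x" "continuous_on (Q b) ?t" "continuous_on (Q b) ?xx"
    "continuous_on (Q b) (\<lambda>z. a1 (fst z) * c1 (snd z))"
    "continuous_on (Q b) (\<lambda>z. a (fst z) * c2 (snd z) + e2 (snd z))"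
    by (intro continuous_intros cont)+
  note 1 = C1_onI[of "Q b" ?x, OF XX XT cc(3,4)]
  note 2 = C1_onI[of "Q b" ?t, OF TX TT cc(4,5)]
  note 3 = C2_onI[of "Q b" \<phi> ?x ?t, OF open_Q X T cc(1,2) 1(1) 2(1)]
  show "C2_on (Q b) \<phi>"
    "\<And>x t. (x, t) \<in> Q b \<Longrightarrow> partial_x \<phi> (x, t) = a1 x * c t + d1 x"
    "\<And>x t. (x, t) \<in> Q b \<Longrightarrow> partial_t \<phi> (x, t) = a x * c1 t + e1 t"
    "\<And>x t. (x, t) \<in> Q b \<Longrightarrow> partial_x (partial_x \<phi>) (x, t) = a2 x * c t + d2 x"
    using 3 1(2) by auto
qed

text \<open>Continuity is not part of \<open>C1_on\<close>. On a compact box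
  \<open>partial_t \<phi>\<close> is bounded, so the mean value theorem makes \<phi> Lipschitz in
  time uniformly in space; continuity along the single horizontal line through the point does the
  rest.\<close>

lemma C1_on_imp_continuous_on:
  assumes S: "open S" and C1: "C1_on S \<phi>"
  shows "continuous_on S \<phi>"
proof -
  have "isCont \<phi> z" if z: "z \<in> S" for z
  proof -
    obtain x t where [simp]: "z = (x, t)" by (cases z)
    obtain A B where AB: "open A" "open B" "x \<in> A" "t \<in> B" "A \<times> B \<subseteq> S"
      using open_prod_elim[OF S z] by (metis \<open>z = (x, t)\<close> mem_Sigma_iff)
    obtain r1 where r1: "r1 > 0" "cball x r1 \<subseteq> A" using AB open_contains_cball by blast
    obtain r2 where r2: "r2 > 0" "cball t r2 \<subseteq> B" using AB open_contains_cball by blast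
    have sub: "cball x r1 \<times> cball t r2 \<subseteq> S" using r1 r2 AB by blast
    have "compact (partial_t \<phi> ` (cball x r1 \<times> cball t r2))"
      by (intro compact_continuous_image compact_Times compact_cball
          continuous_on_subset[OF C1_onD(4)[OF C1] sub])
    then obtain M where M: "\<And>w. w \<in> cball x r1 \<times> cball t r2 \<Longrightarrow> \<bar>partial_t \<phi> w\<bar> \<le> M"
      by (meson bounded_real compact_imp_bounded imageI)
    have bd: "\<bar>\<phi> (y, s) - \<phi> (y, t)\<bar> \<le> M * \<bar>s - t\<bar>" if "y \<in> cball x r1" "s \<in> cball t r2" for y s
    proof -
      have "norm (\<phi> (y, s) - \<phi> (y, t)) \<le> M * norm (s - t)"
      proof (rule field_differentiable_bound[of "cball t r2" "\<lambda>s. \<phi> (y, s)" "\<lambda>s. partial_t \<phi> (y, s)"])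
        fix r assume "r \<in> cball t r2"
        then show "((\<lambda>s. \<phi> (y, s)) has_field_derivative partial_t \<phi> (y, r)) (at r within cball t r2)"
          using C1_onD(2)[OF C1, of y r] sub that has_field_derivative_at_within by blast
        show "norm (partial_t \<phi> (y, r)) \<le> M" using M[of "(y, r)"] that \<open>r \<in> _\<close> by auto
      qed (use that r2 in auto)
      then show ?thesis by simp
    qed
    have "((\<lambda>w. \<phi> (fst w, t)) \<longlongrightarrow> \<phi> (x, t)) (at (x, t))"
    proof -
      have "isCont (\<lambda>y. \<phi> (y, t)) x"
        using C1_onD(1)[OF C1] z by (auto intro: DERIV_isCont)
      then have "isCont (\<lambda>w. (\<lambda>y. \<phi> (y, t)) (fst w)) (x, t)"
        by (intro isCont_o2[of _ fst "\<lambda>y. \<phi> (y, t)"]) (auto intro: continuous_intros)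
      then show ?thesis by (simp add: isCont_def)
    qed
    moreover have "((\<lambda>w. \<phi> w - \<phi> (fst w, t)) \<longlongrightarrow> 0) (at (x, t))"
    proof (rule Lim_null_comparison)
      have "\<forall>\<^sub>F w in at (x, t). w \<in> ball x r1 \<times> ball t r2"
        using eventually_at_in_open'[of "ball x r1 \<times> ball t r2" "(x, t)"] r1 r2 by (auto intro: open_Times)
      then show "\<forall>\<^sub>F w in at (x, t). norm (\<phi> w - \<phi> (fst w, t)) \<le> M * \<bar>snd w - t\<bar>"
        by eventually_elim (use bd in auto)
      have "((\<lambda>w. M * \<bar>snd w - t\<bar>) \<longlongrightarrow> M * \<bar>snd (x, t) - t\<bar>) (at (x, t))"
        by (intro tendsto_intros)
      then show "((\<lambda>w. M * \<bar>snd w - t\<bar>) \<longlongrightarrow> 0) (at (x, t))" by simp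
    qed
    ultimately have "((\<lambda>w. (\<phi> w - \<phi> (fst w, t)) + \<phi> (fst w, t)) \<longlongrightarrow> 0 + \<phi> (x, t)) (at (x, t))"
      by (rule tendsto_add[rotated])
    then show ?thesis by (simp add: isCont_def)
  qed
  then show ?thesis using continuous_at_imp_continuous_on by blast
qed

lemma residual_continuous_on:
  assumes "C2_on S \<phi>" "continuous_on UNIV f" "continuous_on UNIV g"
  shows "continuous_on S (residual f g \<phi>)"
proof -
  have C1: "C1_on S \<phi>" "C1_on S (partial_x \<phi>)"
    using assms unfolding C2_on_def by auto
  note c = C1_onD(3,4)[OF C1(1)] C1_onD(3)[OF C1(2)]
  show ?thesis
    unfolding residual_def[abs_def] F_def
    by (intro continuous_intros c continuous_on_compose2[OF assms(2)] continuous_on_compose2[OF assms(3)]) auto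
qed

section \<open>Touching test functions and ellipticity\<close>

lemma local_max_derivatives:
  fixes h :: "real \<Rightarrow> real"
  assumes max: "\<forall>\<^sub>F y in nhds x. h y \<le> h x"
    and h: "\<forall>\<^sub>F y in nhds x. (h has_field_derivative h1 y) (at y)"
    and h1: "(h1 has_field_derivative h2) (at x)"
  shows "h1 x = 0" "h2 \<le> 0"
proof -
  obtain e where e: "e > 0" "\<And>y. dist y x < e \<Longrightarrow> h y \<le> h x \<and> (h has_field_derivative h1 y) (at y)"
    using eventually_conj[OF max h] by (auto simp: eventually_nhds_metric)
  show 0: "h1 x = 0"
    using e DERIV_local_max[of h "h1 x" x e] by (auto simp: dist_real_def abs_minus_commute)
  show "h2 \<le> 0"
  proof (rule ccontr)
    \<comment> \<open>A positive derivative of \<open>h1\<close> at its zero makes \<open>h1\<close>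
      positive just to the right, and by the mean value theorem \<open>h\<close> would increase
      there.\<close>
    assume "\<not> h2 \<le> 0"
    then obtain d where d: "d > 0" "\<And>k. 0 < k \<Longrightarrow> k < d \<Longrightarrow> h1 x < h1 (x + k)"
      using DERIV_pos_inc_right[OF h1] by auto
    define r where "r = min d e / 2"
    have r: "0 < r" "r < d" "r < e" using d e by (auto simp: r_def)
    obtain \<xi> where \<xi>: "x < \<xi>" "\<xi> < x + r" "h (x + r) - h x = (x + r - x) * h1 \<xi>"
      using MVT2[of x "x + r" h h1] r e by (auto simp: dist_real_def)
    have "h1 \<xi> > 0" using d(2)[of "\<xi> - x"] \<xi> r 0 by auto
    moreover have "h (x + r) \<le> h x" using e(2)[of "x + r"] r by (auto simp: dist_real_def)
    moreover have "r * h1 \<xi> > 0" using \<open>h1 \<xi> > 0\<close> r by simp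
    ultimately show False using \<xi>(3) by simp
  qed
qed

text \<open>Ellipticity: at a maximum of \<phi> - \<psi> the first derivatives agree and the second
  derivative of \<phi> is the smaller one, while \<open>F\<close> is nonincreasing in its last
  argument because \<open>g\<close> is positive and \<open>f\<close> monotone.\<close>

lemma residual_touching:
  assumes S: "open S" and C2: "C2_on S \<phi>" "C2_on S \<psi>" and z: "z \<in> S"
    and max: "\<forall>\<^sub>F w in nhds z. \<phi> w - \<psi> w \<le> \<phi> z - \<psi> z"
    and fg: "mono f" "\<And>p. g p > 0"
  shows "residual f g \<psi> z \<le> residual f g \<phi> z"
proof -
  obtain x t where [simp]: "z = (x, t)" by (cases z)
  have C1: "C1_on S \<phi>" "C1_on S \<psi>" "C1_on S (partial_x \<phi>)" "C1_on S (partial_x \<psi>)"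
    using C2 unfolding C2_on_def by auto
  have slice: "\<forall>\<^sub>F y in nhds x. (y, t) \<in> S" "\<forall>\<^sub>F s in nhds t. (x, s) \<in> S"
    using eventually_slice_x[OF S] eventually_slice_t[OF S] z by auto
  have ex: "\<forall>\<^sub>F y in nhds x. \<phi> (y, t) - \<psi> (y, t) \<le> \<phi> (x, t) - \<psi> (x, t)"
    and et: "\<forall>\<^sub>F s in nhds t. \<phi> (x, s) - \<psi> (x, s) \<le> \<phi> (x, t) - \<psi> (x, t)"
  proof -
    obtain U where U: "open U" "z \<in> U" "\<And>w. w \<in> U \<Longrightarrow> \<phi> w - \<psi> w \<le> \<phi> z - \<psi> z"
      using max by (auto simp: eventually_nhds)
    show "\<forall>\<^sub>F y in nhds x. \<phi> (y, t) - \<psi> (y, t) \<le> \<phi> (x, t) - \<psi> (x, t)"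
      using eventually_slice_x[OF U(1), of x t] U(2,3) by (auto elim: eventually_mono)
    show "\<forall>\<^sub>F s in nhds t. \<phi> (x, s) - \<psi> (x, s) \<le> \<phi> (x, t) - \<psi> (x, t)"
      using eventually_slice_t[OF U(1), of x t] U(2,3) by (auto elim: eventually_mono)
  qed
  have X: "partial_x \<phi> (x, t) - partial_x \<psi> (x, t) = 0"
    and XX: "partial_x (partial_x \<phi>) (x, t) - partial_x (partial_x \<psi>) (x, t) \<le> 0"
  proof -
    have 1: "\<forall>\<^sub>F y in nhds x. ((\<lambda>y. \<phi> (y, t) - \<psi> (y, t)) has_field_derivative
        partial_x \<phi> (y, t) - partial_x \<psi> (y, t)) (at y)"
      using slice(1) by eventually_elim (auto intro!: DERIV_diff C1_onD[OF C1(1)] C1_onD[OF C1(2)])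
    have 2: "((\<lambda>y. partial_x \<phi> (y, t) - partial_x \<psi> (y, t)) has_field_derivative
        partial_x (partial_x \<phi>) (x, t) - partial_x (partial_x \<psi>) (x, t)) (at x)"
      using z by (auto intro!: DERIV_diff C1_onD[OF C1(3)] C1_onD[OF C1(4)])
    show "partial_x \<phi> (x, t) - partial_x \<psi> (x, t) = 0"
      "partial_x (partial_x \<phi>) (x, t) - partial_x (partial_x \<psi>) (x, t) \<le> 0"
      using local_max_derivatives[OF ex 1 2] by auto
  qed
  have T: "partial_t \<phi> (x, t) - partial_t \<psi> (x, t) = 0"
  proof -
    have 1: "((\<lambda>s. \<phi> (x, s) - \<psi> (x, s)) has_field_derivative partial_t \<phi> (x, t) - partial_t \<psi> (x, t)) (at t)"
      using z by (auto intro!: DERIV_diff C1_onD[OF C1(1)] C1_onD[OF C1(2)])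
    obtain e where "e > 0" "\<And>s. dist s t < e \<Longrightarrow> \<phi> (x, s) - \<psi> (x, s) \<le> \<phi> (x, t) - \<psi> (x, t)"
      using et by (auto simp: eventually_nhds_metric)
    then show ?thesis
      by (intro DERIV_local_max[OF 1, of e]) (auto simp: dist_real_def abs_minus_commute)
  qed
  have "g (partial_x \<phi> z) * partial_x (partial_x \<phi>) z \<le> g (partial_x \<psi> z) * partial_x (partial_x \<psi>) z"
    using X XX fg(2) by (auto intro!: mult_left_mono less_imp_le)
  then show ?thesis
    unfolding residual_def F_def using T monoD[OF fg(1)] by auto
qed

subsection \<open>Comparison with strict classical sub- and super-solutions on boxes\<close>

lemma usc_onD:
  assumes "usc_on S v" "z \<in> S" "v z < c"
  shows "\<exists>U. open U \<and> z \<in> U \<and> (\<forall>w\<in>U \<inter> S. v w < c)"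
proof -
  have "eventually (\<lambda>w. v w < c) (at z within S)"
    using assms unfolding usc_on_def by simp
  then obtain U where U: "open U" "z \<in> U" "\<forall>w\<in>U. w \<noteq> z \<longrightarrow> w \<in> S \<longrightarrow> v w < c"
    unfolding eventually_at_topological by (elim exE conjE)
  show ?thesis
  proof (intro exI[of _ U] conjI ballI U(1,2))
    fix w assume "w \<in> U \<inter> S"
    then show "v w < c" using U(3) assms(3) by (cases "w = z") auto
  qed
qed

lemma usc_on_attains_max:
  assumes "compact K" "K \<noteq> {}" "usc_on K h"
  obtains z where "z \<in> K" "\<And>y. y \<in> K \<Longrightarrow> h y \<le> h z"
proof -
  have "\<exists>z\<in>K. \<forall>y\<in>K. h y \<le> h z"
  proof (rule ccontr)
    assume "\<not> ?thesis"
    \<comment> \<open>\<open>Y z\<close> is a point with a larger value. Finitely many of the values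
      \<open>h (Y z)\<close> bound \<open>h\<close> strictly from above on neighbourhoods covering
      \<open>K\<close>; the point carrying the largest of them lies in one of these neighbourhoods,
      which is absurd.\<close>
    then obtain Y where Y: "\<And>z. z \<in> K \<Longrightarrow> Y z \<in> K \<and> h z < h (Y z)"
      by (metis not_le)
    have "\<exists>U. open U \<and> z \<in> U \<and> (\<forall>w\<in>U \<inter> K. h w < h (Y z))" if zK: "z \<in> K" for z
    proof -
      have "h z < h (Y z)" using Y[OF zK] by simp
      from usc_onD[OF assms(3) zK this] show ?thesis .
    qed
    then have "\<forall>z\<in>K. \<exists>U. open U \<and> z \<in> U \<and> (\<forall>w\<in>U \<inter> K. h w < h (Y z))" by simp
    from bchoice[OF this] obtain U
      where U: "\<forall>z\<in>K. open (U z) \<and> z \<in> U z \<and> (\<forall>w\<in>U z \<inter> K. h w < h (Y z))" ..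
    have cover: "\<And>z. z \<in> K \<Longrightarrow> open (U z)" "K \<subseteq> (\<Union>z\<in>K. U z)" using U by auto
    obtain D where D: "D \<subseteq> K" "finite D" "K \<subseteq> (\<Union>z\<in>D. U z)"
      by (rule compactE_image[OF assms(1) cover])
    then have "D \<noteq> {}" using assms(2) by auto
    define m where "m = Max ((\<lambda>z. h (Y z)) ` D)"
    have "m \<in> (\<lambda>z. h (Y z)) ` D" unfolding m_def using D \<open>D \<noteq> {}\<close> by (intro Max_in) auto
    then obtain z where z: "z \<in> D" "h (Y z) = m" by auto
    then obtain z' where "z' \<in> D" "Y z \<in> U z'" using D Y by blast
    then have "h (Y z) < h (Y z')" using U D Y z by blast
    also have "\<dots> \<le> m" unfolding m_def using D \<open>z' \<in> D\<close> by (intro Max_ge) auto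
    finally show False using z by simp
  qed
  then show ?thesis using that by blast
qed

lemma usc_on_subset: "usc_on S v \<Longrightarrow> T \<subseteq> S \<Longrightarrow> usc_on T v"
  unfolding usc_on_def by (meson at_le filter_leD subsetD)

lemma lsc_on_subset: "lsc_on S v \<Longrightarrow> T \<subseteq> S \<Longrightarrow> lsc_on T v"
  unfolding lsc_on_def by (meson at_le filter_leD subsetD)

lemma lsc_on_uminus: "lsc_on S v \<longleftrightarrow> usc_on S (\<lambda>z. - v z)"
proof
  assume lsc: "lsc_on S v"
  show "usc_on S (\<lambda>z. - v z)"
    unfolding usc_on_def
  proof (intro ballI allI impI)
    fix z c assume "z \<in> S" "- v z < c"
    then have "\<forall>\<^sub>F w in at z within S. - c < v w" using lsc unfolding lsc_on_def by simp
    then show "\<forall>\<^sub>F w in at z within S. - v w < c" by eventually_elim simp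
  qed
next
  assume usc: "usc_on S (\<lambda>z. - v z)"
  show "lsc_on S v"
    unfolding lsc_on_def
  proof (intro ballI allI impI)
    fix z c assume "z \<in> S" "c < v z"
    then have "\<forall>\<^sub>F w in at z within S. - v w < - c"
      using usc[unfolded usc_on_def, rule_format, of z "- c"] by simp
    then show "\<forall>\<^sub>F w in at z within S. c < v w" by eventually_elim simp
  qed
qed

lemma usc_on_diff_continuous:
  assumes "usc_on S v" "continuous_on S \<phi>"
  shows "usc_on S (\<lambda>z. v z - \<phi> z)"
  unfolding usc_on_def
proof (intro ballI allI impI)
  fix z c assume z: "z \<in> S" and c: "v z - \<phi> z < c"
  define e where "e = (c - (v z - \<phi> z)) / 2"
  have e: "e > 0" using c by (simp add: e_def)
  have "\<forall>\<^sub>F w in at z within S. v w < v z + e"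
    using assms(1) z e unfolding usc_on_def by simp
  moreover have "\<forall>\<^sub>F w in at z within S. \<phi> z - e < \<phi> w"
    using assms(2) z e unfolding continuous_on_def by (auto intro: order_tendstoD)
  ultimately show "\<forall>\<^sub>F w in at z within S. v w - \<phi> w < c"
    by eventually_elim (simp add: e_def field_simps)
qed

lemma continuous_imp_usc_on: "continuous_on S \<phi> \<Longrightarrow> usc_on S \<phi>"
  unfolding usc_on_def continuous_on_def by (auto intro: order_tendstoD)

lemma lsc_on_bounded_below:
  assumes "compact K" "lsc_on K v"
  obtains m where "\<And>z. z \<in> K \<Longrightarrow> m \<le> v z"
proof (cases "K = {}")
  case False
  obtain z where "\<And>y. y \<in> K \<Longrightarrow> - v y \<le> - v z"
    using usc_on_attains_max[OF assms(1) False] assms(2) unfolding lsc_on_uminus by metis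
  then show ?thesis using that[of "v z"] by auto
qed (use that in auto)

section \<open>The comparison argument\<close>

lemma box_subset_Q0:
  assumes "- b < x1" "x2 < b" "0 \<le> t1"
  shows "{x1..x2} \<times> {t1..t2} \<subseteq> Q0 b"
  using assms by (auto simp: Q0_def)

lemma time_penalty:
  fixes P s :: real and n :: nat
  defines "\<psi> \<equiv> (\<lambda>z. P * (snd z - s) ^ n)"
  shows "C2_on (Q b) \<psi>" "\<And>x t. (x, t) \<in> Q b \<Longrightarrow> partial_x \<psi> (x, t) = 0"
    "\<And>x t. (x, t) \<in> Q b \<Longrightarrow> partial_t \<psi> (x, t) = P * (of_nat n * (t - s) ^ (n - 1))"
    "\<And>x t. (x, t) \<in> Q b \<Longrightarrow> partial_x (partial_x \<psi>) (x, t) = 0"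
proof -
  have 1: "((\<lambda>t. P * (t - s) ^ n) has_field_derivative P * (of_nat n * (t - s) ^ (n - 1))) (at t)" for t
    by (auto intro!: derivative_eq_intros simp: mult_ac)
  have 2: "((\<lambda>t. P * (of_nat n * (t - s) ^ (n - 1))) has_field_derivative
     P * (of_nat n * (of_nat (n - 1) * (t - s) ^ (n - 1 - 1)))) (at t)" for t
    by (auto intro!: derivative_eq_intros simp: mult_ac)
  have eq: "\<psi> = (\<lambda>z. 0 * 0 + 0 + P * (snd z - s) ^ n)" unfolding \<psi>_def by simp
  have 0: "((\<lambda>_. 0) has_field_derivative 0) (at x)" "continuous_on A (\<lambda>_. 0 :: real)" for x :: real and A
    by (auto intro: continuous_intros)
  have 3: "continuous_on {0<..} (\<lambda>t. P * (of_nat n * (of_nat (n - 1) * (t - s) ^ (n - 1 - 1))))"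
    by (intro continuous_intros)
  note * = C2_on_separable[of b "\<lambda>_. 0" "\<lambda>_. 0" "\<lambda>_. 0" "\<lambda>_. 0" "\<lambda>_. 0" "\<lambda>_. 0" "\<lambda>_. 0" "\<lambda>_. 0" "\<lambda>_. 0"
      "\<lambda>t. P * (t - s) ^ n", OF 0(1) 0(1) 0(2) 0(1) 0(1) 0(2) 0(1) 0(1) 0(2) 1 2 3, folded eq]
  show "C2_on (Q b) \<psi>" "\<And>x t. (x, t) \<in> Q b \<Longrightarrow> partial_x \<psi> (x, t) = 0"
    "\<And>x t. (x, t) \<in> Q b \<Longrightarrow> partial_t \<psi> (x, t) = P * (of_nat n * (t - s) ^ (n - 1))"
    "\<And>x t. (x, t) \<in> Q b \<Longrightarrow> partial_x (partial_x \<psi>) (x, t) = 0"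
    using * by simp_all
qed

text \<open>
  The power of \<open>t - t1\<close> is small before the time \<open>t0\<close> of interest and large later, which keeps
  the maximum away from the top of the box without a test function that is singular in \<open>Q b\<close>.
\<close>

lemma penalized_interior_max:
  assumes usc: "usc_on (Q0 b) v" and cont: "continuous_on (Q0 b) \<Phi>"
    and box: "- b < x1" "x2 < b" "0 \<le> t1"
    and init: "\<And>x. x1 \<le> x \<Longrightarrow> x \<le> x2 \<Longrightarrow> v (x, t1) \<le> \<Phi> (x, t1)"
    and lat: "\<And>t. t1 \<le> t \<Longrightarrow> t < t2 \<Longrightarrow> v (x1, t) \<le> \<Phi> (x1, t)" "\<And>t. t1 \<le> t \<Longrightarrow> t < t2 \<Longrightarrow> v (x2, t) \<le> \<Phi> (x2, t)"
    and x0: "x1 \<le> x0" "x0 \<le> x2" "t1 \<le> t0" "t0 < t2" "v (x0, t0) > \<Phi> (x0, t0)"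
  obtains P n x t where "P \<ge> 0" "x1 < x" "x < x2" "t1 < t" "t < t2"
    "\<forall>\<^sub>F w in nhds (x, t). v w - (\<Phi> w + P * (snd w - t1) ^ n) \<le> v (x, t) - (\<Phi> (x, t) + P * (t - t1) ^ n)"
proof -
  \<comment> \<open>The boundary inequalities hold only before \<open>t2\<close>, so the maximum is
    taken on a compact box that ends at an earlier time.\<close>
  define T where "T = (t0 + t2) / 2"
  have T: "t0 < T" "T < t2" "t1 < T" using x0 by (auto simp: T_def)
  define K where "K = {x1..x2} \<times> {t1..T}"
  have K: "compact K" "K \<noteq> {}" "K \<subseteq> Q0 b"
    unfolding K_def using box_subset_Q0[OF box] x0 T by (auto intro: compact_Times)
  have uK: "usc_on K (\<lambda>z. v z - \<Phi> z)"
    using usc_on_diff_continuous[OF usc cont] K usc_on_subset by blast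
  obtain M where M: "M > 0" "\<And>z. z \<in> K \<Longrightarrow> v z - \<Phi> z \<le> M"
  proof -
    obtain z where "\<And>y. y \<in> K \<Longrightarrow> v y - \<Phi> y \<le> v z - \<Phi> z" using usc_on_attains_max[OF K(1,2) uK] by blast
    then show ?thesis using that[of "max 1 (v z - \<Phi> z)"] by fastforce
  qed
  define q where "q = (t0 - t1) / (T - t1)"
  have q: "0 \<le> q" "q < 1" using x0 T by (auto simp: q_def divide_simps)
  have "(\<lambda>n. M * q ^ n) \<longlonglongrightarrow> M * 0"
    by (intro tendsto_intros LIMSEQ_realpow_zero q)
  then have "\<forall>\<^sub>F n in sequentially. M * q ^ n < v (x0, t0) - \<Phi> (x0, t0)"
    using x0 by (intro order_tendstoD) auto
  then obtain n where n: "M * q ^ n < v (x0, t0) - \<Phi> (x0, t0)"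
    using eventually_happens' sequentially_bot by blast
  \<comment> \<open>With this normalisation the penalty equals \<open>M\<close> at the top time
    \<open>T\<close>, where it outweighs \<open>v - \<Phi>\<close>, and \<open>M * q ^ n\<close> at
    \<open>t0\<close>, which the choice of \<open>n\<close> puts below the assumed excess of
    \<open>v\<close> over \<Phi>.\<close>
  define P where "P = M / (T - t1) ^ n"
  have P: "P \<ge> 0" using M T by (simp add: P_def)
  let ?h = "\<lambda>w. v w - (\<Phi> w + P * (snd w - t1) ^ n)"
  have "usc_on K ?h"
    using K by (intro usc_on_diff_continuous usc_on_subset[OF usc] continuous_intros
        continuous_on_subset[OF cont]) auto
  then obtain z where z: "z \<in> K" "\<And>y. y \<in> K \<Longrightarrow> ?h y \<le> ?h z"
    using usc_on_attains_max[OF K(1,2)] by blast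
  obtain x t where [simp]: "z = (x, t)" by (cases z)
  have "P * (t0 - t1) ^ n = M * q ^ n" by (simp add: P_def q_def power_divide)
  then have "?h (x0, t0) > 0" using n by simp
  moreover have "(x0, t0) \<in> K" using x0 T by (auto simp: K_def)
  ultimately have pos: "?h (x, t) > 0" using z(2)[of "(x0, t0)"] by simp
  have xt: "x1 \<le> x" "x \<le> x2" "t1 \<le> t" "t \<le> T" using z(1) by (auto simp: K_def)
  have pen: "P * (t - t1) ^ n \<ge> 0" using P xt by simp
  have "x \<noteq> x1" "x \<noteq> x2" "t \<noteq> t1" using pos pen lat[of t] init[of x] xt T by auto
  moreover have "t \<noteq> T"
  proof
    assume "t = T"
    then have "P * (t - t1) ^ n = M" using T by (simp add: P_def)
    then show False using pos M(2)[OF z(1)] by simp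
  qed
  ultimately have int: "x1 < x" "x < x2" "t1 < t" "t < T" using xt by auto
  have "\<forall>\<^sub>F w in nhds (x, t). w \<in> {x1<..<x2} \<times> {t1<..<T}"
    using int by (intro eventually_nhds_in_open open_Times) auto
  then have "\<forall>\<^sub>F w in nhds (x, t). ?h w \<le> ?h (x, t)"
    by eventually_elim (use z(2) in \<open>auto simp: K_def\<close>)
  then show ?thesis using that[OF P int(1-3)] int T by auto
qed

lemma sub_solutionD:
  assumes "sub_solution b f g v" "z \<in> Q b" "C2_on (Q b) \<phi>" "\<forall>\<^sub>F w in nhds z. v w - \<phi> w \<le> v z - \<phi> z"
  shows "residual f g \<phi> z \<le> 0"
  using assms(1)[unfolded sub_solution_def, THEN conjunct2, rule_format, OF assms(2-4)]
  by (simp add: residual_def)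

lemma super_solutionD:
  assumes "super_solution b f g v" "z \<in> Q b" "C2_on (Q b) \<phi>" "\<forall>\<^sub>F w in nhds z. v w - \<phi> w \<ge> v z - \<phi> z"
  shows "residual f g \<phi> z \<ge> 0"
  using assms(1)[unfolded super_solution_def, THEN conjunct2, THEN conjunct1, rule_format, OF assms(2-4)]
  by (simp add: residual_def)

text \<open>The penalty depends on time alone and is nondecreasing, so it adds a nonnegative term to
  the positive residual of \<Phi>. An interior maximum would then contradict the sub-solution
  test.\<close>

lemma sub_solution_le_box:
  assumes sub: "sub_solution b f g v" and \<Phi>: "C2_on (Q b) \<Phi>" "continuous_on (Q0 b) \<Phi>"
    and box: "- b < x1" "x2 < b" "0 \<le> t1"
    and strict: "\<And>x t. x1 < x \<Longrightarrow> x < x2 \<Longrightarrow> t1 < t \<Longrightarrow> t < t2 \<Longrightarrow> residual f g \<Phi> (x, t) > 0"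
    and init: "\<And>x. x1 \<le> x \<Longrightarrow> x \<le> x2 \<Longrightarrow> v (x, t1) \<le> \<Phi> (x, t1)"
    and lat: "\<And>t. t1 \<le> t \<Longrightarrow> t < t2 \<Longrightarrow> v (x1, t) \<le> \<Phi> (x1, t)" "\<And>t. t1 \<le> t \<Longrightarrow> t < t2 \<Longrightarrow> v (x2, t) \<le> \<Phi> (x2, t)"
    and x0: "x1 \<le> x0" "x0 \<le> x2" "t1 \<le> t0" "t0 < t2"
  shows "v (x0, t0) \<le> \<Phi> (x0, t0)"
proof (rule ccontr)
  assume "\<not> ?thesis"
  then have "v (x0, t0) > \<Phi> (x0, t0)" by simp
  have usc: "usc_on (Q0 b) v" using sub unfolding sub_solution_def by simp
  obtain P n x t where P: "P \<ge> 0" and int: "x1 < x" "x < x2" "t1 < t" "t < t2" and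
    max: "\<forall>\<^sub>F w in nhds (x, t). v w - (\<Phi> w + P * (snd w - t1) ^ n) \<le> v (x, t) - (\<Phi> (x, t) + P * (t - t1) ^ n)"
    by (rule penalized_interior_max[OF usc \<Phi>(2) box init lat x0 \<open>v (x0, t0) > \<Phi> (x0, t0)\<close>])
  have Q: "(x, t) \<in> Q b" using int box by (auto simp: Q_def)
  note pen = time_penalty[where P=P and s=t1 and n=n and b=b]
  note add = C2_on_add[OF open_Q \<Phi>(1) pen(1)]
  have "residual f g (\<lambda>w. \<Phi> w + P * (snd w - t1) ^ n) (x, t) \<le> 0"
    by (rule sub_solutionD[OF sub Q add(1)]) (use max in simp)
  moreover have "residual f g (\<lambda>w. \<Phi> w + P * (snd w - t1) ^ n) (x, t) =
      residual f g \<Phi> (x, t) + P * (of_nat n * (t - t1) ^ (n - 1))"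
    unfolding residual_def using add(2-4)[OF Q] pen(2-4)[OF Q] by simp
  moreover have "P * (of_nat n * (t - t1) ^ (n - 1)) \<ge> 0"
    using P int by simp
  ultimately show False using strict[OF int] by simp
qed

text \<open>The equation need not be odd, so the comparison from above cannot simply be reflected;
  only the maximum argument is reused, for \<open>- w\<close> and \<open>- \<Phi>\<close>, and the
  penalty enters the test function with a negative sign.\<close>

lemma super_solution_ge_box:
  assumes super: "super_solution b f g w" and \<Phi>: "C2_on (Q b) \<Phi>" "continuous_on (Q0 b) \<Phi>"
    and box: "- b < x1" "x2 < b" "0 \<le> t1"
    and strict: "\<And>x t. x1 < x \<Longrightarrow> x < x2 \<Longrightarrow> t1 < t \<Longrightarrow> t < t2 \<Longrightarrow> residual f g \<Phi> (x, t) < 0"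
    and init: "\<And>x. x1 \<le> x \<Longrightarrow> x \<le> x2 \<Longrightarrow> \<Phi> (x, t1) \<le> w (x, t1)"
    and lat: "\<And>t. t1 \<le> t \<Longrightarrow> t < t2 \<Longrightarrow> \<Phi> (x1, t) \<le> w (x1, t)" "\<And>t. t1 \<le> t \<Longrightarrow> t < t2 \<Longrightarrow> \<Phi> (x2, t) \<le> w (x2, t)"
    and x0: "x1 \<le> x0" "x0 \<le> x2" "t1 \<le> t0" "t0 < t2"
  shows "\<Phi> (x0, t0) \<le> w (x0, t0)"
proof (rule ccontr)
  assume "\<not> ?thesis"
  then have less: "- w (x0, t0) > - \<Phi> (x0, t0)" by simp
  have semi: "usc_on (Q0 b) (\<lambda>z. - w z)" "continuous_on (Q0 b) (\<lambda>z. - \<Phi> z)"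
    using super \<Phi>(2) unfolding super_solution_def lsc_on_uminus by (auto intro: continuous_intros)
  have bdry: "\<And>x. x1 \<le> x \<Longrightarrow> x \<le> x2 \<Longrightarrow> - w (x, t1) \<le> - \<Phi> (x, t1)"
    "\<And>t. t1 \<le> t \<Longrightarrow> t < t2 \<Longrightarrow> - w (x1, t) \<le> - \<Phi> (x1, t)"
    "\<And>t. t1 \<le> t \<Longrightarrow> t < t2 \<Longrightarrow> - w (x2, t) \<le> - \<Phi> (x2, t)"
    using init lat by simp_all
  obtain P n x t where P: "P \<ge> 0" and int: "x1 < x" "x < x2" "t1 < t" "t < t2" and
    max: "\<forall>\<^sub>F z in nhds (x, t). - w z - (- \<Phi> z + P * (snd z - t1) ^ n) \<le> - w (x, t) - (- \<Phi> (x, t) + P * (t - t1) ^ n)"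
    by (rule penalized_interior_max[OF semi box bdry x0 less])
  have Q: "(x, t) \<in> Q b" using int box by (auto simp: Q_def)
  note pen = time_penalty[where P="-P" and s=t1 and n=n and b=b]
  note add = C2_on_add[OF open_Q \<Phi>(1) pen(1)]
  have "\<forall>\<^sub>F z in nhds (x, t). w z - (\<Phi> z + - P * (snd z - t1) ^ n) \<ge> w (x, t) - (\<Phi> (x, t) + - P * (snd (x, t) - t1) ^ n)"
    using max by eventually_elim simp
  then have "residual f g (\<lambda>w. \<Phi> w + - P * (snd w - t1) ^ n) (x, t) \<ge> 0"
    by (rule super_solutionD[OF super Q add(1)])
  moreover have "residual f g (\<lambda>w. \<Phi> w + - P * (snd w - t1) ^ n) (x, t) =
      residual f g \<Phi> (x, t) + - P * (of_nat n * (t - t1) ^ (n - 1))"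
    unfolding residual_def using add(2-4)[OF Q] pen(2-4)[OF Q] by simp
  moreover have "P * (of_nat n * (t - t1) ^ (n - 1)) \<ge> 0"
    using P int by simp
  ultimately show False using strict[OF int] by simp
qed

subsection \<open>Semicontinuous envelopes\<close>

lemma upper_envelope_usc:
  assumes usc: "usc_on (Q0 b) u" and z: "z \<in> Q0 b"
  shows "upper_envelope b u z = ereal (u z)"
proof -
  have "((\<lambda>r. SUP w \<in> Q0 b \<inter> ball z r. ereal (u w)) \<longlongrightarrow> ereal (u z)) (at_right 0)"
  proof (rule order_tendstoI)
    fix c assume c: "c < ereal (u z)"
    show "\<forall>\<^sub>F r in at_right 0. c < (SUP w \<in> Q0 b \<inter> ball z r. ereal (u w))"
    proof (rule eventually_mono[OF eventually_at_right_less])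
      fix r :: real assume "0 < r"
      then have "ereal (u z) \<le> (SUP w \<in> Q0 b \<inter> ball z r. ereal (u w))"
        using z by (intro SUP_upper) auto
      with c show "c < (SUP w \<in> Q0 b \<inter> ball z r. ereal (u w))" by (rule less_le_trans)
    qed
  next
    fix c assume c: "c > ereal (u z)"
    obtain d where d: "ereal (u z) < ereal d" "ereal d < c" using ereal_dense2[OF c] by blast
    then obtain U where U: "open U" "z \<in> U" "\<forall>w\<in>U \<inter> Q0 b. u w < d"
      using usc_onD[OF usc z, of d] by auto
    then obtain e where e: "e > 0" "ball z e \<subseteq> U" using open_contains_ball by blast
    have "\<forall>\<^sub>F r in at_right 0. r < e" using e(1) by (auto simp: eventually_at_right_field)
    then show "\<forall>\<^sub>F r in at_right 0. (SUP w \<in> Q0 b \<inter> ball z r. ereal (u w)) < c"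
    proof eventually_elim
      case (elim r)
      have "(SUP w \<in> Q0 b \<inter> ball z r. ereal (u w)) \<le> ereal d"
      proof (rule SUP_least)
        fix w assume "w \<in> Q0 b \<inter> ball z r"
        then have "w \<in> U \<inter> Q0 b" using e elim by auto
        then show "ereal (u w) \<le> ereal d" using U(3) by (simp add: less_imp_le)
      qed
      with d(2) show ?case by simp
    qed
  qed
  then show ?thesis
    unfolding upper_envelope_def by (intro tendsto_Lim) simp_all
qed

text \<open>The lower envelope kept within the reals. The supremum is meaningful only where the set
  is nonempty and bounded; a continuous minorant of \<open>u\<close>, as fixed in the context below,
  provides the former, the value of \<open>u\<close> at the point the latter.\<close>

definition lsc_hull :: "real \<Rightarrow> (real \<times> real \<Rightarrow> real) \<Rightarrow> real \<times> real \<Rightarrow> real"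
  where "lsc_hull b u z = Sup {c. \<exists>r>0. \<forall>y\<in>Q0 b \<inter> ball z r. c \<le> u y}"

lemma lsc_hull_bdd_above:
  assumes "z \<in> Q0 b"
  shows "bdd_above {c. \<exists>r>0. \<forall>y\<in>Q0 b \<inter> ball z r. c \<le> u y}"
  using assms by (intro bdd_aboveI[of _ "u z"]) auto

lemma lsc_hull_upper:
  assumes "z \<in> Q0 b" "r > 0" "\<And>y. y \<in> Q0 b \<Longrightarrow> y \<in> ball z r \<Longrightarrow> c \<le> u y"
  shows "c \<le> lsc_hull b u z"
  unfolding lsc_hull_def by (rule cSup_upper[OF _ lsc_hull_bdd_above[OF assms(1)]]) (use assms in auto)

lemma lsc_hull_ge_continuous:
  assumes "z \<in> Q0 b" "continuous_on (Q0 b) \<psi>" "\<And>y. y \<in> Q0 b \<Longrightarrow> \<psi> y \<le> u y"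
  shows "\<psi> z \<le> lsc_hull b u z"
proof (rule field_le_epsilon)
  fix e :: real assume "e > 0"
  then obtain r where r: "r > 0" "\<And>y. y \<in> Q0 b \<Longrightarrow> dist y z < r \<Longrightarrow> dist (\<psi> y) (\<psi> z) < e"
    using assms(2)[unfolded continuous_on_iff, rule_format, OF assms(1)] by blast
  have "\<psi> z - e \<le> lsc_hull b u z"
  proof (rule lsc_hull_upper[OF assms(1) r(1)])
    fix y assume y: "y \<in> Q0 b" "y \<in> ball z r"
    then show "\<psi> z - e \<le> u y" using r(2)[of y] assms(3)[of y] by (auto simp: dist_real_def dist_commute)
  qed
  then show "\<psi> z \<le> lsc_hull b u z + e" by simp
qed

context
  fixes b :: real and u \<psi> :: "real \<times> real \<Rightarrow> real"
  assumes \<psi>: "continuous_on (Q0 b) \<psi>" "\<And>y. y \<in> Q0 b \<Longrightarrow> \<psi> y \<le> u y"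
begin

lemma lsc_hull_nonempty:
  assumes z: "z \<in> Q0 b"
  shows "{c. \<exists>r>0. \<forall>y\<in>Q0 b \<inter> ball z r. c \<le> u y} \<noteq> {}"
proof -
  obtain r where r: "r > 0" "\<And>y. y \<in> Q0 b \<Longrightarrow> dist y z < r \<Longrightarrow> dist (\<psi> y) (\<psi> z) < 1"
    using \<psi>(1)[unfolded continuous_on_iff, rule_format, OF z, of 1] by auto
  have "\<psi> z - 1 \<le> u y" if y: "y \<in> Q0 b \<inter> ball z r" for y
    using r(2)[of y] \<psi>(2)[of y] y by (auto simp: dist_real_def dist_commute)
  then show ?thesis using r(1) by blast
qed

lemma lsc_hull_le: "z \<in> Q0 b \<Longrightarrow> lsc_hull b u z \<le> u z"
  unfolding lsc_hull_def by (rule cSup_least[OF lsc_hull_nonempty]) auto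

lemma lsc_hullD:
  assumes "z \<in> Q0 b" "c < lsc_hull b u z"
  obtains r where "r > 0" "\<forall>y\<in>Q0 b \<inter> ball z r. c \<le> u y"
proof -
  obtain d where "d \<in> {c. \<exists>r>0. \<forall>y\<in>Q0 b \<inter> ball z r. c \<le> u y}" "c < d"
    using assms(2) unfolding lsc_hull_def
    using less_cSup_iff[OF lsc_hull_nonempty[OF assms(1)] lsc_hull_bdd_above[OF assms(1)]] by blast
  then obtain r where r: "r > 0" "\<forall>y\<in>Q0 b \<inter> ball z r. d \<le> u y" by blast
  show ?thesis by (rule that[OF r(1)]) (use r(2) \<open>c < d\<close> in force)
qed

lemma lsc_on_lsc_hull: "lsc_on (Q0 b) (lsc_hull b u)"
  unfolding lsc_on_def
proof (intro ballI allI impI)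
  fix z c assume z: "z \<in> Q0 b" and c: "c < lsc_hull b u z"
  obtain d where d: "c < d" "d < lsc_hull b u z" using dense[OF c] by blast
  obtain r where r: "r > 0" "\<forall>y\<in>Q0 b \<inter> ball z r. d \<le> u y" by (rule lsc_hullD[OF z d(2)])
  have "c < lsc_hull b u w" if w: "w \<in> Q0 b" "dist w z < r" for w
  proof -
    have "d \<le> lsc_hull b u w"
    proof (rule lsc_hull_upper[OF w(1), of "r - dist w z"])
      fix y assume y: "y \<in> Q0 b" "y \<in> ball w (r - dist w z)"
      have "dist z y \<le> dist w z + dist w y" by (metis dist_commute dist_triangle)
      then show "d \<le> u y" using r(2) y by auto
    qed (use w in simp)
    then show ?thesis using d by simp
  qed
  then show "\<forall>\<^sub>F w in at z within Q0 b. c < lsc_hull b u w"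
    using r(1) by (auto simp: eventually_at)
qed

lemma lower_envelope_eq:
  assumes z: "z \<in> Q0 b"
  shows "lower_envelope b u z = ereal (lsc_hull b u z)"
proof -
  have "((\<lambda>r. INF w \<in> Q0 b \<inter> ball z r. ereal (u w)) \<longlongrightarrow> ereal (lsc_hull b u z)) (at_right 0)"
  proof (rule order_tendstoI)
    fix c assume c: "c < ereal (lsc_hull b u z)"
    obtain d where d: "c < ereal d" "ereal d < ereal (lsc_hull b u z)" using ereal_dense2[OF c] by blast
    then obtain e where e: "e > 0" "\<forall>y\<in>Q0 b \<inter> ball z e. d \<le> u y"
      using lsc_hullD[OF z, of d] by auto
    have "\<forall>\<^sub>F r in at_right 0. r < e" using e(1) by (auto simp: eventually_at_right_field)
    then show "\<forall>\<^sub>F r in at_right 0. c < (INF w \<in> Q0 b \<inter> ball z r. ereal (u w))"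
    proof eventually_elim
      case (elim r)
      have "ereal d \<le> (INF w \<in> Q0 b \<inter> ball z r. ereal (u w))"
        using e(2) elim by (intro INF_greatest) auto
      with d(1) show ?case by simp
    qed
  next
    fix c assume c: "c > ereal (lsc_hull b u z)"
    obtain d where d: "ereal (lsc_hull b u z) < ereal d" "ereal d < c" using ereal_dense2[OF c] by blast
    show "\<forall>\<^sub>F r in at_right 0. (INF w \<in> Q0 b \<inter> ball z r. ereal (u w)) < c"
    proof (rule eventually_mono[OF eventually_at_right_less])
      fix r :: real assume "0 < r"
      have "\<exists>y. y \<in> Q0 b \<and> y \<in> ball z r \<and> u y < d"
        using lsc_hull_upper[OF z \<open>0 < r\<close>, of d u] d(1) by (auto simp: not_le[symmetric])
      then obtain y where y: "y \<in> Q0 b \<inter> ball z r" "u y < d" by auto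
      have "(INF w \<in> Q0 b \<inter> ball z r. ereal (u w)) \<le> ereal (u y)"
        using y(1) by (rule INF_lower)
      also have "\<dots> < ereal d" using y by simp
      finally show "(INF w \<in> Q0 b \<inter> ball z r. ereal (u w)) < c" using d(2) by (rule less_trans)
    qed
  qed
  then show ?thesis
    unfolding lower_envelope_def by (intro tendsto_Lim) simp_all
qed

end

subsection \<open>Perron's method\<close>

definition usc_hull :: "real \<Rightarrow> (real \<times> real \<Rightarrow> real) \<Rightarrow> real \<times> real \<Rightarrow> real"
  where "usc_hull b u z = - lsc_hull b (\<lambda>y. - u y) z"

text \<open>Adding \<open>q\<close> makes an extremum strict without changing the residual at the
  point: the fourth power has vanishing second derivative there, and in time only the first
  derivative enters the equation.\<close>

lemma quartic:
  fixes s x0 t0 :: real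
  defines "q \<equiv> (\<lambda>z. s * (fst z - x0) ^ 4 + s * (snd z - t0)\<^sup>2)"
  shows "C2_on (Q b) q" "(x0, t0) \<in> Q b \<Longrightarrow> partial_x q (x0, t0) = 0"
    "(x0, t0) \<in> Q b \<Longrightarrow> partial_t q (x0, t0) = 0"
    "(x0, t0) \<in> Q b \<Longrightarrow> partial_x (partial_x q) (x0, t0) = 0"
proof -
  have 0: "((\<lambda>_. 0) has_field_derivative 0) (at x)" "continuous_on A (\<lambda>_. 0 :: real)" for x :: real and A
    by (auto intro: continuous_intros)
  have x: "((\<lambda>x. s * (x - x0) ^ 4) has_field_derivative s * (4 * (x - x0) ^ 3)) (at x)"
     "((\<lambda>x. s * (4 * (x - x0) ^ 3)) has_field_derivative s * (12 * (x - x0)\<^sup>2)) (at x)" for x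
    by (auto intro!: derivative_eq_intros simp: eval_nat_numeral)
  have t: "((\<lambda>t. s * (t - t0)\<^sup>2) has_field_derivative s * (2 * (t - t0))) (at t)"
     "((\<lambda>t. s * (2 * (t - t0))) has_field_derivative s * 2) (at t)" for t
    by (auto intro!: derivative_eq_intros)
  have eq: "q = (\<lambda>z. 0 * 0 + s * (fst z - x0) ^ 4 + s * (snd z - t0)\<^sup>2)" unfolding q_def by simp
  have cont: "continuous_on {-b<..<b} (\<lambda>x. s * (12 * (x - x0)\<^sup>2))" "continuous_on {0<..} (\<lambda>_::real. s * 2)"
    by (intro continuous_intros)+
  note * = C2_on_separable[of b "\<lambda>_. 0" "\<lambda>_. 0" "\<lambda>_. 0" "\<lambda>x. s * (x - x0) ^ 4" _ _ "\<lambda>_. 0" "\<lambda>_. 0" "\<lambda>_. 0"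
      "\<lambda>t. s * (t - t0)\<^sup>2", OF 0(1) 0(1) 0(2) x cont(1) 0(1) 0(1) 0(2) t cont(2), folded eq]
  show "C2_on (Q b) q" "(x0, t0) \<in> Q b \<Longrightarrow> partial_x q (x0, t0) = 0"
    "(x0, t0) \<in> Q b \<Longrightarrow> partial_t q (x0, t0) = 0"
    "(x0, t0) \<in> Q b \<Longrightarrow> partial_x (partial_x q) (x0, t0) = 0"
    using * by simp_all
qed

lemma small_box_in_open:
  fixes U :: "(real \<times> real) set"
  assumes "open U" "(x0, t0) \<in> U"
  obtains r where "r > 0" "{x0 - r..x0 + r} \<times> {t0 - r..t0 + r} \<subseteq> U"
proof -
  obtain e where e: "e > 0" "ball (x0, t0) e \<subseteq> U" using assms open_contains_ball by blast
  show ?thesis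
  proof (rule that[of "e / 3"])
    show "{x0 - e / 3..x0 + e / 3} \<times> {t0 - e / 3..t0 + e / 3} \<subseteq> U"
    proof
      fix z assume z: "z \<in> {x0 - e / 3..x0 + e / 3} \<times> {t0 - e / 3..t0 + e / 3}"
      obtain x t where [simp]: "z = (x, t)" by (cases z)
      have "dist (x, t) (x0, t0) \<le> \<bar>x - x0\<bar> + \<bar>t - t0\<bar>"
        unfolding dist_prod_def using sqrt_sum_squares_le_sum_abs[of "x - x0" "t - t0"] by (simp add: dist_real_def)
      also have "\<dots> < e" using z e by auto
      finally show "z \<in> U" using e(2) by (auto simp: dist_commute)
    qed
  qed (use e in simp)
qed

lemma quartic_lower_bound:
  fixes r x0 t0 x t :: real
  assumes "r > 0" "(x, t) \<notin> {x0 - r<..<x0 + r} \<times> {t0 - r<..<t0 + r}"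
  shows "min (r ^ 4) (r\<^sup>2) \<le> (x - x0) ^ 4 + (t - t0)\<^sup>2"
proof -
  have "r \<le> \<bar>x - x0\<bar> \<or> r \<le> \<bar>t - t0\<bar>" using assms(2) by auto
  then show ?thesis
  proof
    assume "r \<le> \<bar>x - x0\<bar>"
    then have "r ^ 4 \<le> \<bar>x - x0\<bar> ^ 4" using assms(1) by (intro power_mono) auto
    then show ?thesis by (simp add: min_le_iff_disj add_increasing2)
  next
    assume "r \<le> \<bar>t - t0\<bar>"
    then have "r\<^sup>2 \<le> \<bar>t - t0\<bar>\<^sup>2" using assms(1) by (intro power_mono) auto
    moreover have "(x - x0) ^ 4 \<ge> 0" by simp
    ultimately have "r\<^sup>2 \<le> (x - x0) ^ 4 + (t - t0)\<^sup>2" unfolding power2_abs by linarith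
    then show ?thesis by (simp add: min_le_iff_disj)
  qed
qed

text \<open>If the hull failed the test at \<open>z0\<close>, the test function made strict by a
  quartic would have positive residual on a whole box. Some member \<open>v\<close> of
  \<open>S\<close> nearly attains the hull near \<open>z0\<close>, so \<open>v - \<theta>\<close>
  has its maximum over the box in the interior, where the test for \<open>v\<close> is violated. No
  sequence of maximum points is needed. The common majorant \<Phi> keeps the suprema finite.\<close>

lemma sub_solution_usc_hull_Sup:
  assumes fg: "continuous_on UNIV f" "continuous_on UNIV g"
    and S: "S \<noteq> {}" "\<And>v. v \<in> S \<Longrightarrow> sub_solution b f g v"
    and \<Phi>: "continuous_on (Q0 b) \<Phi>" "\<And>v z. v \<in> S \<Longrightarrow> z \<in> Q0 b \<Longrightarrow> v z \<le> \<Phi> z"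
  shows "sub_solution b f g (usc_hull b (\<lambda>z. SUP v\<in>S. v z))"
proof -
  define u where "u = (\<lambda>z. SUP v\<in>S. v z)"
  let ?U = "usc_hull b u"
  have u_le: "u z \<le> \<Phi> z" if "z \<in> Q0 b" for z
    unfolding u_def using S \<Phi>(2) that by (intro cSUP_least) auto
  have v_le: "v z \<le> u z" if "v \<in> S" "z \<in> Q0 b" for v z
    unfolding u_def using that(1) by (intro cSUP_upper bdd_aboveI[of _ "\<Phi> z"]) (use \<Phi>(2) that(2) in blast)+
  have neg: "continuous_on (Q0 b) (\<lambda>z. - \<Phi> z)" "\<And>y. y \<in> Q0 b \<Longrightarrow> - \<Phi> y \<le> - u y"
    using u_le by (auto intro: continuous_intros \<Phi>(1))
  have usc: "usc_on (Q0 b) ?U"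
    using lsc_on_lsc_hull[OF neg] unfolding usc_hull_def[abs_def] lsc_on_uminus .
  have u_le_U: "u z \<le> ?U z" if "z \<in> Q0 b" for z
    using lsc_hull_le[OF neg that] by (simp add: usc_hull_def)
  have "residual f g \<phi> z0 \<le> 0"
    if z0: "z0 \<in> Q b" and \<phi>: "C2_on (Q b) \<phi>" and max: "\<forall>\<^sub>F z in nhds z0. ?U z - \<phi> z \<le> ?U z0 - \<phi> z0" for z0 \<phi>
  proof (rule ccontr)
    assume "\<not> residual f g \<phi> z0 \<le> 0"
    then have pos: "residual f g \<phi> z0 > 0" by simp
    obtain x0 t0 where [simp]: "z0 = (x0, t0)" by (cases z0)
    define q where "q = (\<lambda>z. 1 * (fst z - x0) ^ 4 + 1 * (snd z - t0)\<^sup>2)"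
    note q = quartic[where s=1 and ?x0.0=x0 and ?t0.0=t0 and b=b, folded q_def]
    note add = C2_on_add[OF open_Q \<phi> q(1)]
    define \<theta> where "\<theta> = (\<lambda>z. \<phi> z + q z)"
    have \<theta>: "C2_on (Q b) \<theta>" unfolding \<theta>_def by (rule add)
    have "residual f g \<theta> z0 = residual f g \<phi> z0"
      unfolding residual_def \<theta>_def using add(2-4)[OF z0] q(2-4) z0 by simp
    then have "residual f g \<theta> z0 > 0" using pos by simp
    have \<theta>cont: "continuous_on (Q b) \<theta>"
      using \<theta> C1_on_imp_continuous_on[OF open_Q] unfolding C2_on_def by blast
    have op: "open {z \<in> Q b. residual f g \<theta> z \<in> {0<..}}"
      by (rule continuous_open_preimage[OF residual_continuous_on[OF \<theta> fg] open_Q, unfolded vimage_def Int_def mem_Collect_eq]) simp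
    obtain V where V: "open V" "z0 \<in> V" "\<And>z. z \<in> V \<Longrightarrow> ?U z - \<phi> z \<le> ?U z0 - \<phi> z0"
      using max unfolding eventually_nhds by blast
    have "open ({z \<in> Q b. residual f g \<theta> z \<in> {0<..}} \<inter> V)" using op V(1) by blast
    moreover have "(x0, t0) \<in> {z \<in> Q b. residual f g \<theta> z \<in> {0<..}} \<inter> V"
      using V(2) z0 \<open>residual f g \<theta> z0 > 0\<close> by simp
    ultimately obtain r where r: "r > 0" "{x0 - r..x0 + r} \<times> {t0 - r..t0 + r} \<subseteq> {z \<in> Q b. residual f g \<theta> z \<in> {0<..}} \<inter> V"
      by (rule small_box_in_open)
    define K where "K = {x0 - r..x0 + r} \<times> {t0 - r..t0 + r}"
    define I where "I = {x0 - r<..<x0 + r} \<times> {t0 - r<..<t0 + r}"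
    have K: "K \<subseteq> Q b" "K \<subseteq> V" "\<And>z. z \<in> K \<Longrightarrow> residual f g \<theta> z > 0" "compact K" "I \<subseteq> K" "open I" "z0 \<in> I"
      using r unfolding K_def I_def by (auto intro: compact_Times open_Times)
    have KQ0: "K \<subseteq> Q0 b" using K(1) Q_subset_Q0 by blast
    \<comment> \<open>\<eta> is the least value of \<open>q\<close> off the open box, hence the drop
      of \<open>?U - \<theta>\<close> there. Half of it is spent on the oscillation of \<theta> near
      \<open>z0\<close> and half on the distance of \<open>v y\<close> from the hull.\<close>
    define \<eta> where "\<eta> = min (r ^ 4) (r\<^sup>2)"
    have \<eta>: "\<eta> > 0" using r by (simp add: \<eta>_def)
    have "continuous_on I \<theta>" using \<theta>cont K by (meson continuous_on_subset)
    then have "isCont \<theta> z0" using K(6,7) continuous_on_eq_continuous_at by blast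
    then have "\<forall>\<^sub>F z in nhds z0. \<theta> z < \<theta> z0 + \<eta> / 2"
      using \<eta> by (intro order_tendstoD) (auto simp: continuous_within tendsto_at_iff_tendsto_nhds)
    moreover have "\<forall>\<^sub>F z in nhds z0. z \<in> I" using K by (intro eventually_nhds_in_open) auto
    ultimately have "\<forall>\<^sub>F z in nhds z0. \<theta> z < \<theta> z0 + \<eta> / 2 \<and> z \<in> I" by (rule eventually_conj)
    then obtain \<rho> where \<rho>: "\<rho> > 0" "\<And>z. dist z z0 < \<rho> \<Longrightarrow> \<theta> z < \<theta> z0 + \<eta> / 2 \<and> z \<in> I"
      unfolding eventually_nhds_metric by blast
    have z0Q0: "z0 \<in> Q0 b" using z0 Q_subset_Q0 by blast
    have "\<exists>y. y \<in> Q0 b \<and> y \<in> ball z0 \<rho> \<and> ?U z0 - \<eta> / 2 < u y"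
    proof (rule ccontr)
      assume "\<not> ?thesis"
      then have "- ?U z0 + \<eta> / 2 \<le> lsc_hull b (\<lambda>y. - u y) z0"
        by (intro lsc_hull_upper[OF z0Q0 \<rho>(1)]) force
      then show False using \<eta> by (simp add: usc_hull_def)
    qed
    then obtain y where y: "y \<in> Q0 b" "y \<in> ball z0 \<rho>" "?U z0 - \<eta> / 2 < u y" by blast
    obtain v where v: "v \<in> S" "?U z0 - \<eta> / 2 < v y"
    proof -
      have "bdd_above ((\<lambda>v. v y) ` S)" using \<Phi>(2) y(1) by (intro bdd_aboveI[of _ "\<Phi> y"]) blast
      from less_cSUP_iff[OF S(1) this, of "?U z0 - \<eta> / 2"] y(3)
      have "\<exists>v\<in>S. ?U z0 - \<eta> / 2 < v y" unfolding u_def by simp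
      then show ?thesis using that by (elim bexE)
    qed
    have yI: "y \<in> I" "\<theta> y < \<theta> z0 + \<eta> / 2" using \<rho>(2)[of y] y(2) by (auto simp: dist_commute)
    have "\<theta> z0 = \<phi> z0" by (simp add: \<theta>_def q_def)
    have big: "v y - \<theta> y > ?U z0 - \<phi> z0 - \<eta>" using v yI \<open>\<theta> z0 = \<phi> z0\<close> by simp
    have vsub: "sub_solution b f g v" using S v by blast
    then have "usc_on (Q0 b) v" by (simp add: sub_solution_def)
    then have "usc_on K (\<lambda>z. v z - \<theta> z)"
      using usc_on_subset KQ0 continuous_on_subset[OF \<theta>cont K(1)] usc_on_diff_continuous by blast
    moreover have "K \<noteq> {}" using K by blast
    ultimately obtain z where z: "z \<in> K" "\<And>y. y \<in> K \<Longrightarrow> v y - \<theta> y \<le> v z - \<theta> z"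
      using usc_on_attains_max[OF K(4), of "\<lambda>z. v z - \<theta> z"] by blast
    have "z \<in> I"
    proof (rule ccontr)
      assume "z \<notin> I"
      then have "\<eta> \<le> q z"
        using quartic_lower_bound[OF r(1), of "fst z" "snd z" x0 t0] unfolding \<eta>_def I_def q_def by simp
      moreover have "v z \<le> ?U z" using v_le[OF v(1)] u_le_U z(1) KQ0 by (meson order_trans subsetD)
      moreover have "?U z - \<phi> z \<le> ?U z0 - \<phi> z0" using V(3) z(1) K(2) by blast
      ultimately have "v z - \<theta> z \<le> ?U z0 - \<phi> z0 - \<eta>" unfolding \<theta>_def by simp
      moreover have "v y - \<theta> y \<le> v z - \<theta> z" using z(2) yI K(5) by blast
      ultimately show False using big by simp
    qed
    have "\<forall>\<^sub>F w in nhds z. w \<in> I" using \<open>z \<in> I\<close> K(6) by (rule eventually_nhds_in_open[rotated])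
    then have "\<forall>\<^sub>F w in nhds z. v w - \<theta> w \<le> v z - \<theta> z"
      by eventually_elim (use z(2) K(5) in blast)
    then have "residual f g \<theta> z \<le> 0" using sub_solutionD[OF vsub _ \<theta>] z(1) K(1) by blast
    then show False using K(3)[OF z(1)] by simp
  qed
  then show ?thesis
    unfolding sub_solution_def using usc by (auto simp: residual_def u_def)
qed

text \<open>Off \<open>L\<close> the maximum is \<open>u\<close> itself, so the gluing happens in
  the interior of \<open>K\<close>. Where the bump is active, a function touching from above also
  touches \<theta> + \<delta> from above, and ellipticity transfers the sign of the residual of
  \<theta>.\<close>

lemma sub_solution_bump:
  fixes x0 t0 r :: real
  defines "K \<equiv> {x0 - r..x0 + r} \<times> {t0 - r..t0 + r}" and "L \<equiv> {x0 - r / 2..x0 + r / 2} \<times> {t0 - r / 2..t0 + r / 2}"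
  assumes u: "sub_solution b f g u" and fg: "mono f" "\<And>p. g p > 0"
    and \<theta>: "C2_on (Q b) \<theta>" and r: "r > 0"
    and K: "K \<subseteq> Q b" and neg: "\<And>z. z \<in> K \<Longrightarrow> residual f g \<theta> z < 0"
    and less: "\<And>z. z \<in> K - L \<Longrightarrow> \<theta> z + \<delta> \<le> u z"
  shows "sub_solution b f g (\<lambda>z. if z \<in> K then max (u z) (\<theta> z + \<delta>) else u z)" (is "sub_solution b f g ?v")
proof -
  define I where "I = {x0 - r<..<x0 + r} \<times> {t0 - r<..<t0 + r}"
  have I: "open I" "I \<subseteq> K" "L \<subseteq> I" "closed L" "L \<subseteq> K"
    using r unfolding I_def K_def L_def by (auto intro: open_Times closed_Times)
  have usc_u: "usc_on (Q0 b) u" using u by (simp add: sub_solution_def)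
  have \<theta>cont: "continuous_on (Q b) \<theta>"
    using \<theta> C1_on_imp_continuous_on[OF open_Q] unfolding C2_on_def by blast
  have off: "?v z = u z" if "z \<notin> L" for z
    using that less[of z] by auto
  have ge: "?v z \<ge> u z" for z by simp
  have "usc_on (Q0 b) ?v"
    unfolding usc_on_def
  proof (intro ballI allI impI)
    fix z c assume z: "z \<in> Q0 b" and c: "?v z < c"
    have uc: "\<forall>\<^sub>F w in at z within Q0 b. u w < c"
      using usc_u[unfolded usc_on_def, rule_format, OF z, of c] c ge[of z] by linarith
    show "\<forall>\<^sub>F w in at z within Q0 b. ?v w < c"
    proof (cases "z \<in> L")
      case True
      have "isCont \<theta> z"
        using \<theta>cont True I(5) K open_Q continuous_on_eq_continuous_at by blast
      then have "\<forall>\<^sub>F w in at z within Q0 b. \<theta> w < c - \<delta>"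
        using c True I(5) by (intro order_tendstoD[of _ "\<theta> z"])
          (auto simp: continuous_within intro: tendsto_within_subset split: if_splits)
      with uc show ?thesis
        by eventually_elim (auto split: if_splits)
    next
      case False
      have "\<forall>\<^sub>F w in at z within Q0 b. w \<in> - L"
        using I(4) False by (intro eventually_at_in_open' open_Compl[THEN eventually_at_in_open'] filter_leD[OF at_le[OF subset_UNIV]]) auto
      with uc show ?thesis
        by eventually_elim (use off in auto)
    qed
  qed
  moreover have "residual f g \<phi> z \<le> 0"
    if z: "z \<in> Q b" and \<phi>: "C2_on (Q b) \<phi>" and max: "\<forall>\<^sub>F w in nhds z. ?v w - \<phi> w \<le> ?v z - \<phi> z" for z \<phi>
  proof (cases "?v z = u z")
    case True
    have "\<forall>\<^sub>F w in nhds z. u w - \<phi> w \<le> u z - \<phi> z"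
      using max by eventually_elim (use True ge in \<open>smt (verit)\<close>)
    then show ?thesis using sub_solutionD[OF u z \<phi>] by blast
  next
    case False
    then have zL: "z \<in> L" and vz: "?v z = \<theta> z + \<delta>" using off[of z] by (auto split: if_splits)
    have "\<forall>\<^sub>F w in nhds z. w \<in> I" using zL I by (intro eventually_nhds_in_open) auto
    with max have "\<forall>\<^sub>F w in nhds z. \<theta> w - \<phi> w \<le> \<theta> z - \<phi> z"
    proof eventually_elim
      case (elim w)
      then have "?v w \<ge> \<theta> w + \<delta>" using I(2) by auto
      with elim(1) vz show ?case by linarith
    qed
    from residual_touching[OF open_Q \<theta> \<phi> z this fg(1), of g] fg(2)
    have "residual f g \<phi> z \<le> residual f g \<theta> z" by blast
    moreover have "z \<in> K" using zL I(5) by blast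
    ultimately show ?thesis using neg[of z] by linarith
  qed
  ultimately show ?thesis unfolding sub_solution_def by (auto simp: residual_def)
qed

text \<open>Competitors are tested only against the strict classical functions in
  \<open>\<Phi>s\<close>, and a bumped competitor passes this test by the comparison on a box. The
  families serve to squeeze: \<open>\<Phi>s\<close> and \<open>\<Psi>s\<close> pin down the initial
  values, \<open>\<Psi>s\<close> forces the boundary values.\<close>

theorem perron:
  assumes fg: "continuous_on UNIV f" "mono f" "continuous_on UNIV g" "\<And>p. g p > 0"
    and supers: "\<Phi>s \<noteq> {}" "\<And>\<Phi>. \<Phi> \<in> \<Phi>s \<Longrightarrow> continuous_on (Q0 b) \<Phi>" "\<And>\<Phi>. \<Phi> \<in> \<Phi>s \<Longrightarrow> C2_on (Q b) \<Phi>"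
      "\<And>\<Phi> z. \<Phi> \<in> \<Phi>s \<Longrightarrow> z \<in> Q b \<Longrightarrow> residual f g \<Phi> z > 0"
    and subs: "\<And>\<Psi>. \<Psi> \<in> \<Psi>s \<Longrightarrow> continuous_on (Q0 b) \<Psi>" "\<And>\<Psi>. \<Psi> \<in> \<Psi>s \<Longrightarrow> sub_solution b f g \<Psi>"
    and le: "\<And>\<Psi> \<Phi> z. \<Psi> \<in> \<Psi>s \<Longrightarrow> \<Phi> \<in> \<Phi>s \<Longrightarrow> z \<in> Q0 b \<Longrightarrow> \<Psi> z \<le> \<Phi> z"
    and initial: "\<And>x e. x \<in> {-b<..<b} \<Longrightarrow> e > 0 \<Longrightarrow> \<exists>\<Phi>\<in>\<Phi>s. \<Phi> (x, 0) \<le> u0 x + e"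
      "\<And>x e. x \<in> {-b<..<b} \<Longrightarrow> e > 0 \<Longrightarrow> \<exists>\<Psi>\<in>\<Psi>s. u0 x - e \<le> \<Psi> (x, 0)"
    and boundary: "\<And>t N. t > 0 \<Longrightarrow> \<exists>\<Psi>\<in>\<Psi>s. \<forall>\<^sub>F x in at_left b. N \<le> \<Psi> (x, t)"
      "\<And>t N. t > 0 \<Longrightarrow> \<exists>\<Psi>\<in>\<Psi>s. \<forall>\<^sub>F x in at_right (- b). N \<le> \<Psi> (x, t)"
    and b: "b > 0"
  shows "\<exists>u. viscosity_solution b f g u0 u"
proof -
  define S where "S = {v. sub_solution b f g v \<and> (\<forall>\<Phi>\<in>\<Phi>s. \<forall>z\<in>Q0 b. v z \<le> \<Phi> z)}"
  define U where "U = usc_hull b (\<lambda>z. SUP v\<in>S. v z)"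
  obtain \<Phi>0 where \<Phi>0: "\<Phi>0 \<in> \<Phi>s" using supers(1) by blast
  have sub_S: "\<Psi>s \<subseteq> S" using subs(2) le unfolding S_def by blast
  obtain \<Psi>0 where \<Psi>0: "\<Psi>0 \<in> \<Psi>s" using boundary(1)[of 1] by (meson zero_less_one)
  have Sne: "S \<noteq> {}" using sub_S \<Psi>0 by blast
  have v_le: "v z \<le> (SUP v\<in>S. v z)" if "v \<in> S" "z \<in> Q0 b" for v z
    using that \<Phi>0 by (intro cSUP_upper bdd_aboveI[of _ "\<Phi>0 z"]) (auto simp: S_def)
  have hull_neg: "- \<Phi> z \<le> - (SUP v\<in>S. v z)" if "\<Phi> \<in> \<Phi>s" "z \<in> Q0 b" for \<Phi> z
    using Sne that by (auto intro!: cSUP_least simp: S_def)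
  have neg_cont: "continuous_on (Q0 b) (\<lambda>z. - \<Phi> z)" if "\<Phi> \<in> \<Phi>s" for \<Phi>
    using supers(2)[OF that] by (rule continuous_on_minus)
  have U_ge: "v z \<le> U z" if "v \<in> S" "z \<in> Q0 b" for v z
    using lsc_hull_le[OF neg_cont[OF \<Phi>0] hull_neg[OF \<Phi>0] that(2)] v_le[OF that]
    unfolding U_def usc_hull_def by simp
  have U_le: "U z \<le> \<Phi> z" if "\<Phi> \<in> \<Phi>s" "z \<in> Q0 b" for \<Phi> z
    using lsc_hull_ge_continuous[OF that(2) neg_cont[OF that(1)] hull_neg[OF that(1)]]
    unfolding U_def usc_hull_def by simp
  have U_sub: "sub_solution b f g U"
    unfolding U_def
    by (rule sub_solution_usc_hull_Sup[OF fg(1,3) Sne _ supers(2)[OF \<Phi>0]]) (use \<Phi>0 in \<open>auto simp: S_def\<close>)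
  have U_usc: "usc_on (Q0 b) U" using U_sub by (simp add: sub_solution_def)
  have \<Psi>_le: "\<Psi> z \<le> U z" if "\<Psi> \<in> \<Psi>s" "z \<in> Q0 b" for \<Psi> z
    using U_ge that sub_S by blast
  define w where "w = lsc_hull b U"
  note hull = subs(1)[OF \<Psi>0] \<Psi>_le[OF \<Psi>0]
  have w_ge: "\<Psi> z \<le> w z" if "\<Psi> \<in> \<Psi>s" "z \<in> Q0 b" for \<Psi> z
    unfolding w_def using lsc_hull_ge_continuous[OF that(2) subs(1)[OF that(1)] \<Psi>_le[OF that(1)]] .
  have w_le: "w z \<le> U z" if "z \<in> Q0 b" for z
    unfolding w_def using lsc_hull_le[OF hull that] .
  have w_lsc: "lsc_on (Q0 b) w" unfolding w_def by (rule lsc_on_lsc_hull[OF hull])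
  have w_super: "residual f g \<phi> z0 \<ge> 0"
    if z0: "z0 \<in> Q b" and \<phi>: "C2_on (Q b) \<phi>" and min: "\<forall>\<^sub>F z in nhds z0. w z - \<phi> z \<ge> w z0 - \<phi> z0" for z0 \<phi>
  proof (rule ccontr)
    assume "\<not> residual f g \<phi> z0 \<ge> 0"
    then have neg: "residual f g \<phi> z0 < 0" by simp
    obtain x0 t0 where [simp]: "z0 = (x0, t0)" by (cases z0)
    define q where "q = (\<lambda>z. - 1 * (fst z - x0) ^ 4 + - 1 * (snd z - t0)\<^sup>2)"
    note q = quartic[where s="-1" and ?x0.0=x0 and ?t0.0=t0 and b=b, folded q_def]
    note add = C2_on_add[OF open_Q \<phi> q(1)]
    define \<theta> where "\<theta> = (\<lambda>z. \<phi> z + q z)"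
    have \<theta>: "C2_on (Q b) \<theta>" unfolding \<theta>_def by (rule add)
    have "residual f g \<theta> z0 = residual f g \<phi> z0"
      unfolding residual_def \<theta>_def using add(2-4)[OF z0] q(2-4) z0 by simp
    then have "residual f g \<theta> z0 < 0" using neg by simp
    have \<theta>cont: "continuous_on (Q b) \<theta>"
      using \<theta> C1_on_imp_continuous_on[OF open_Q] unfolding C2_on_def by blast
    have op: "open {z \<in> Q b. residual f g \<theta> z \<in> {..<0}}"
      by (rule continuous_open_preimage[OF residual_continuous_on[OF \<theta> fg(1,3)] open_Q, unfolded vimage_def Int_def mem_Collect_eq]) simp
    obtain V where V: "open V" "z0 \<in> V" "\<And>z. z \<in> V \<Longrightarrow> w z - \<phi> z \<ge> w z0 - \<phi> z0"
      using min unfolding eventually_nhds by blast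
    have "open ({z \<in> Q b. residual f g \<theta> z \<in> {..<0}} \<inter> V)" using op V(1) by blast
    moreover have "(x0, t0) \<in> {z \<in> Q b. residual f g \<theta> z \<in> {..<0}} \<inter> V"
      using V(2) z0 \<open>residual f g \<theta> z0 < 0\<close> by simp
    ultimately obtain r where r: "r > 0" "{x0 - r..x0 + r} \<times> {t0 - r..t0 + r} \<subseteq> {z \<in> Q b. residual f g \<theta> z \<in> {..<0}} \<inter> V"
      by (rule small_box_in_open)
    define K where "K = {x0 - r..x0 + r} \<times> {t0 - r..t0 + r}"
    define L where "L = {x0 - r / 2..x0 + r / 2} \<times> {t0 - r / 2..t0 + r / 2}"
    have K: "K \<subseteq> Q b" "K \<subseteq> V" "\<And>z. z \<in> K \<Longrightarrow> residual f g \<theta> z < 0"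
      using r unfolding K_def by auto
    have KQ0: "K \<subseteq> Q0 b" using K(1) Q_subset_Q0 by blast
    define \<eta> where "\<eta> = min ((r / 2) ^ 4) ((r / 2)\<^sup>2)"
    have \<eta>: "\<eta> > 0" using r by (simp add: \<eta>_def)
    \<comment> \<open>Half of the drop \<eta>: the raised \<theta> + \<delta> stays below
      \<open>w\<close>, hence below \<open>U\<close>, on \<open>K - L\<close>, but exceeds
      \<open>w\<close> at \<open>z0\<close> by \<open>\<eta> / 2\<close>.\<close>
    define \<delta> where "\<delta> = w z0 - \<phi> z0 + \<eta> / 2"
    define v where "v = (\<lambda>z. if z \<in> K then max (U z) (\<theta> z + \<delta>) else U z)"
    have less: "\<theta> z + \<delta> \<le> U z" if "z \<in> K - L" for z
    proof -
      have "(fst z, snd z) \<notin> {x0 - r / 2<..<x0 + r / 2} \<times> {t0 - r / 2<..<t0 + r / 2}"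
        using that by (auto simp: L_def)
      then have "q z \<le> - \<eta>"
        using quartic_lower_bound[of "r / 2" "fst z" "snd z" x0 t0] r unfolding \<eta>_def q_def by simp
      moreover have "w z - \<phi> z \<ge> w z0 - \<phi> z0" using V(3) that K(2) by blast
      moreover have "w z \<le> U z" using w_le that KQ0 by blast
      ultimately show ?thesis using \<eta> unfolding \<theta>_def \<delta>_def by linarith
    qed
    have v_sub: "sub_solution b f g v"
      unfolding v_def K_def
      by (rule sub_solution_bump[OF U_sub fg(2,4) \<theta> r(1)]) (use K(1,3) less in \<open>auto simp: K_def L_def\<close>)
    have v_off: "v z = U z" if "z \<notin> L" for z
      using less[of z] that by (auto simp: v_def)
    \<comment> \<open>On the bottom and lateral edges of \<open>K\<close> the bump is inactive, so
      the order with \<Phi> is inherited from \<open>U\<close>. Comparison on all of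
      \<open>K\<close> carries it to \<open>L\<close>, which ends before the top edge.\<close>
    have "v z \<le> \<Phi> z" if \<Phi>: "\<Phi> \<in> \<Phi>s" and z: "z \<in> Q0 b" for \<Phi> z
    proof (cases "z \<in> L")
      case True
      have box: "- b < x0 - r" "x0 + r < b" "0 \<le> t0 - r"
        using subsetD[OF K(1), of "(x0 - r, t0 - r)"] subsetD[OF K(1), of "(x0 + r, t0 - r)"] r(1)
        by (auto simp: K_def Q_def)
      have edge: "v (x, t) \<le> \<Phi> (x, t)" if "(x, t) \<in> K - L" for x t
        using v_off[of "(x, t)"] U_le[OF \<Phi>, of "(x, t)"] that KQ0 by auto
      have "v (fst z, snd z) \<le> \<Phi> (fst z, snd z)"
      proof (rule sub_solution_le_box[OF v_sub supers(3,2)[OF \<Phi>] box, where ?t2.0="t0 + r"])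
        fix x t assume "x0 - r < x" "x < x0 + r" "t0 - r < t" "t < t0 + r"
        then have "(x, t) \<in> K" by (auto simp: K_def)
        then show "residual f g \<Phi> (x, t) > 0" using supers(4)[OF \<Phi>] K(1) by blast
      qed (use True r in \<open>auto intro!: edge simp: K_def L_def\<close>)
      then show ?thesis by simp
    next
      case False
      then show ?thesis using v_off U_le[OF \<Phi> z] by simp
    qed
    then have "v \<in> S" using v_sub by (simp add: S_def)
    then have "\<theta> z + \<delta> \<le> U z" if "z \<in> K" for z
      using U_ge[of v z] that KQ0 by (auto simp: v_def)
    note bump = this
    have "z0 \<in> K" using r by (simp add: K_def)
    have "isCont \<theta> z0" using \<theta>cont z0 open_Q continuous_on_eq_continuous_at by blast
    then have "\<forall>\<^sub>F z in nhds z0. \<theta> z0 - \<eta> / 4 < \<theta> z"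
      using \<eta> by (intro order_tendstoD) (auto simp: continuous_within tendsto_at_iff_tendsto_nhds)
    moreover have "\<forall>\<^sub>F z in nhds z0. z \<in> {x0 - r<..<x0 + r} \<times> {t0 - r<..<t0 + r}"
      using r by (intro eventually_nhds_in_open open_Times) auto
    ultimately have "\<forall>\<^sub>F z in nhds z0. w z0 + \<eta> / 4 \<le> U z"
    proof eventually_elim
      case (elim z)
      then have "\<theta> z + \<delta> \<le> U z" by (intro bump) (auto simp: K_def)
      moreover have "\<theta> z0 = \<phi> z0" by (simp add: \<theta>_def q_def)
      ultimately show ?case using elim(1) by (simp add: \<delta>_def)
    qed
    then obtain \<rho> where \<rho>: "\<rho> > 0" "\<And>z. dist z z0 < \<rho> \<Longrightarrow> w z0 + \<eta> / 4 \<le> U z"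
      unfolding eventually_nhds_metric by blast
    \<comment> \<open>Maximality of \<open>U\<close> puts it above the bump, so \<open>U\<close>
      exceeds \<open>w z0\<close> by \<open>\<eta> / 4\<close> on a full neighbourhood, and its own
      lower hull at \<open>z0\<close> would have to do so as well.\<close>
    have "w z0 + \<eta> / 4 \<le> w z0"
      unfolding w_def
      by (rule lsc_hull_upper[OF _ \<rho>(1)]) (use \<rho>(2) z0 Q_subset_Q0 in \<open>auto simp: w_def dist_commute\<close>)
    then show False using \<eta> by simp
  qed
  have blowup: "filterlim (\<lambda>x. w (x, t)) at_top (at_left b)" "filterlim (\<lambda>x. w (x, t)) at_top (at_right (- b))"
    if t: "t > 0" for t
  proof -
    show "filterlim (\<lambda>x. w (x, t)) at_top (at_left b)"
      unfolding filterlim_at_top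
    proof
      fix N
      obtain \<Psi> where \<Psi>: "\<Psi> \<in> \<Psi>s" "\<forall>\<^sub>F x in at_left b. N \<le> \<Psi> (x, t)" using boundary(1)[OF t] by blast
      have "\<forall>\<^sub>F x in at_left b. x \<in> {-b<..<b}" using b by (intro eventually_at_left_real) simp
      with \<Psi>(2) show "\<forall>\<^sub>F x in at_left b. N \<le> w (x, t)"
      proof eventually_elim
        case (elim x)
        then show ?case using w_ge[OF \<Psi>(1), of "(x, t)"] t by (auto simp: Q0_def)
      qed
    qed
    show "filterlim (\<lambda>x. w (x, t)) at_top (at_right (- b))"
      unfolding filterlim_at_top
    proof
      fix N
      obtain \<Psi> where \<Psi>: "\<Psi> \<in> \<Psi>s" "\<forall>\<^sub>F x in at_right (- b). N \<le> \<Psi> (x, t)" using boundary(2)[OF t] by blast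
      have "\<forall>\<^sub>F x in at_right (- b). x \<in> {-b<..<b}" using b by (intro eventually_at_right_real) simp
      with \<Psi>(2) show "\<forall>\<^sub>F x in at_right (- b). N \<le> w (x, t)"
      proof eventually_elim
        case (elim x)
        then show ?case using w_ge[OF \<Psi>(1), of "(x, t)"] t by (auto simp: Q0_def)
      qed
    qed
  qed
  have init: "U (x, 0) = u0 x \<and> w (x, 0) = u0 x" if x: "x \<in> {-b<..<b}" for x
  proof -
    have x0: "(x, 0) \<in> Q0 b" using x by (simp add: Q0_def)
    have "U (x, 0) \<le> u0 x"
    proof (rule field_le_epsilon)
      fix e :: real assume "e > 0"
      then obtain \<Phi> where "\<Phi> \<in> \<Phi>s" "\<Phi> (x, 0) \<le> u0 x + e" using initial(1)[OF x] by blast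
      then show "U (x, 0) \<le> u0 x + e" using U_le[of \<Phi>] x0 by fastforce
    qed
    moreover have "u0 x \<le> w (x, 0)"
    proof (rule field_le_epsilon)
      fix e :: real assume "e > 0"
      then obtain \<Psi> where "\<Psi> \<in> \<Psi>s" "u0 x - e \<le> \<Psi> (x, 0)" using initial(2)[OF x] by blast
      then show "u0 x \<le> w (x, 0) + e" using w_ge[of \<Psi>] x0 by fastforce
    qed
    ultimately show ?thesis using w_le[OF x0] by simp
  qed
  have "super_solution b f g w"
    unfolding super_solution_def using w_lsc blowup w_super by (auto simp: residual_def)
  moreover have "upper_envelope b U z = ereal (U z) \<and> lower_envelope b U z = ereal (w z)" if "z \<in> Q0 b" for z
    using upper_envelope_usc[OF U_usc that] lower_envelope_eq[OF hull that] by (simp add: w_def)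
  ultimately have "viscosity_solution b f g u0 U"
    unfolding viscosity_solution_def using U_sub init by blast
  then show ?thesis by blast
qed

subsection \<open>Nonlinearities of power growth\<close>

text \<open>The limits at infinity enter only through these two-sided power bounds from modulus 1
  on. Barriers are therefore designed so that slopes and arguments of \<open>f\<close> have modulus
  at least 1 wherever a power law is invoked.\<close>

locale power_growth =
  fixes f g :: "real \<Rightarrow> real" and \<alpha> \<beta> a0 a1 c0 c1 :: real
  assumes f_cont: "continuous_on UNIV f" and f_strict_mono: "strict_mono f" and f_0: "f 0 = 0"
    and g_cont: "continuous_on UNIV g" and g_pos: "\<And>p. g p > 0"
    and \<beta>_pos: "\<beta> > 0" and \<alpha>_le: "\<alpha> \<le> 1"
    and pos: "a0 > 0" "a1 > 0" "c0 > 0" "c1 > 0"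
    and f_lower: "\<And>s. 1 \<le> s \<Longrightarrow> a0 * s powr \<beta> \<le> f s"
    and f_upper: "\<And>s. 1 \<le> s \<Longrightarrow> f s \<le> a1 * s powr \<beta>"
    and f_lower_neg: "\<And>s. 1 \<le> s \<Longrightarrow> - a1 * s powr \<beta> \<le> f (- s)"
    and g_lower: "\<And>p. 1 \<le> \<bar>p\<bar> \<Longrightarrow> c0 * \<bar>p\<bar> powr - \<alpha> \<le> g p"
    and g_upper: "\<And>p. 1 \<le> \<bar>p\<bar> \<Longrightarrow> g p \<le> c1 * \<bar>p\<bar> powr - \<alpha>"
    and g_upper_small: "\<And>p. \<bar>p\<bar> \<le> 1 \<Longrightarrow> g p \<le> c1"
begin

lemma f_mono: "mono f"
  using f_strict_mono by (rule strict_mono_mono)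

lemma f_le: "x \<le> y \<Longrightarrow> f x \<le> f y"
  using f_mono by (rule monoD)

end

section \<open>From limits at infinity to power bounds\<close>

lemma bounds_of_limit:
  fixes h :: "real \<Rightarrow> real"
  assumes "continuous_on {1..} h" "\<And>s. s \<ge> 1 \<Longrightarrow> h s > 0" "(h \<longlongrightarrow> C) at_top" "C > 0"
  obtains c0 c1 where "0 < c0" "0 < c1" "\<And>s. s \<ge> 1 \<Longrightarrow> c0 \<le> h s" "\<And>s. s \<ge> 1 \<Longrightarrow> h s \<le> c1"
proof -
  have "\<forall>\<^sub>F s in at_top. C / 2 < h s \<and> h s < 2 * C"
    using assms(4) by (intro eventually_conj order_tendstoD[OF assms(3)]) simp_all
  then obtain s0 where s0: "\<And>s. s \<ge> s0 \<Longrightarrow> C / 2 < h s \<and> h s < 2 * C"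
    unfolding eventually_at_top_linorder by blast
  \<comment> \<open>Beyond \<open>s1\<close> the limit controls \<open>h\<close>; on the compact
    rest a continuous positive function attains positive bounds.\<close>
  define s1 where "s1 = max 1 s0"
  have c: "continuous_on {1..s1} h" using assms(1) by (rule continuous_on_subset) auto
  have ne: "{1..s1} \<noteq> {}" by (simp add: s1_def)
  obtain x where x: "x \<in> {1..s1}" "\<forall>y\<in>{1..s1}. h x \<le> h y"
    using continuous_attains_inf[OF _ ne c] by auto
  obtain y where y: "y \<in> {1..s1}" "\<forall>x\<in>{1..s1}. h x \<le> h y"
    using continuous_attains_sup[OF _ ne c] by auto
  show ?thesis
  proof (rule that[of "min (h x) (C / 2)" "max (h y) (2 * C)"])
    show "min (h x) (C / 2) > 0" using assms(2)[of x] x assms(4) by auto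
    show "max (h y) (2 * C) > 0" using assms(4) by auto
    show "min (h x) (C / 2) \<le> h s" if "s \<ge> 1" for s
    proof (cases "s \<le> s1")
      case False
      then have "s0 \<le> s" by (simp add: s1_def)
      then show ?thesis using s0[of s] by (simp add: min_le_iff_disj)
    qed (use x(2) that in \<open>simp add: min_le_iff_disj\<close>)
    show "h s \<le> max (h y) (2 * C)" if "s \<ge> 1" for s
    proof (cases "s \<le> s1")
      case False
      then have "s0 \<le> s" by (simp add: s1_def)
      then show ?thesis using s0[of s] by (simp add: le_max_iff_disj)
    qed (use y(2) that in \<open>simp add: le_max_iff_disj\<close>)
  qed
qed

lemma power_growth_of_limits:
  fixes \<alpha> \<beta> Cfp Cfm Cgp Cgm :: real and f g :: "real \<Rightarrow> real"
  assumes f: "continuous_on UNIV f" "strict_mono f" "f 0 = 0"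
    and \<beta>: "\<beta> > 0" and C: "Cfp > 0" "Cfm > 0"
    and f_lim: "((\<lambda>s. \<bar>s\<bar> powr (-\<beta>) * f s) \<longlongrightarrow> Cfp) at_top"
      "((\<lambda>s. \<bar>s\<bar> powr (-\<beta>) * f s) \<longlongrightarrow> - Cfm) at_bot"
    and g: "continuous_on UNIV g" "\<And>p. g p > 0"
    and \<alpha>: "\<alpha> \<le> 1" and C': "Cgp > 0" "Cgm > 0"
    and g_lim: "((\<lambda>s. \<bar>s\<bar> powr \<alpha> * g s) \<longlongrightarrow> Cgp) at_top"
      "((\<lambda>s. \<bar>s\<bar> powr \<alpha> * g s) \<longlongrightarrow> Cgm) at_bot"
  shows "\<exists>a0 a1 c0 c1. power_growth f g \<alpha> \<beta> a0 a1 c0 c1"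
proof -
  have cf: "continuous_on A f" "continuous_on A (\<lambda>s. f (- s))" for A
    using f(1) by (auto intro!: continuous_on_subset[OF f(1)] continuous_on_compose2[OF f(1)] continuous_intros)
  have cg: "continuous_on A g" "continuous_on A (\<lambda>s. g (- s))" for A
    using g(1) by (auto intro!: continuous_on_subset[OF g(1)] continuous_on_compose2[OF g(1)] continuous_intros)
  have fpos: "f s > 0" if "s \<ge> 1" for s using strict_monoD[OF f(2), of 0 s] f(3) that by simp
  have fneg: "f (- s) < 0" if "s \<ge> 1" for s using strict_monoD[OF f(2), of "- s" 0] f(3) that by simp
  have fm: "((\<lambda>s. \<bar>s\<bar> powr (-\<beta>) * (- f (- s))) \<longlongrightarrow> Cfm) at_top"
    using tendsto_minus[OF f_lim(2)[unfolded filterlim_at_bot_mirror]] by simp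
  have gm: "((\<lambda>s. \<bar>s\<bar> powr \<alpha> * g (- s)) \<longlongrightarrow> Cgm) at_top"
    using g_lim(2)[unfolded filterlim_at_bot_mirror] by simp
  obtain p0 p1 where p: "0 < p0" "0 < p1" "\<And>s. s \<ge> 1 \<Longrightarrow> p0 \<le> \<bar>s\<bar> powr (-\<beta>) * f s" "\<And>s. s \<ge> 1 \<Longrightarrow> \<bar>s\<bar> powr (-\<beta>) * f s \<le> p1"
    by (rule bounds_of_limit[OF _ _ f_lim(1) C(1)]) (auto intro!: continuous_intros cf fpos mult_pos_pos)
  obtain n0 n1 where n: "0 < n0" "0 < n1" "\<And>s. s \<ge> 1 \<Longrightarrow> n0 \<le> \<bar>s\<bar> powr (-\<beta>) * (- f (- s))" "\<And>s. s \<ge> 1 \<Longrightarrow> \<bar>s\<bar> powr (-\<beta>) * (- f (- s)) \<le> n1"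
    by (rule bounds_of_limit[OF _ _ fm C(2)]) (auto intro!: continuous_intros cf fneg mult_pos_neg)
  obtain q0 q1 where q: "0 < q0" "0 < q1" "\<And>s. s \<ge> 1 \<Longrightarrow> q0 \<le> \<bar>s\<bar> powr \<alpha> * g s" "\<And>s. s \<ge> 1 \<Longrightarrow> \<bar>s\<bar> powr \<alpha> * g s \<le> q1"
    by (rule bounds_of_limit[OF _ _ g_lim(1) C'(1)]) (auto intro!: continuous_intros cg g(2) mult_pos_pos)
  obtain r0 r1 where r: "0 < r0" "0 < r1" "\<And>s. s \<ge> 1 \<Longrightarrow> r0 \<le> \<bar>s\<bar> powr \<alpha> * g (- s)" "\<And>s. s \<ge> 1 \<Longrightarrow> \<bar>s\<bar> powr \<alpha> * g (- s) \<le> r1"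
    by (rule bounds_of_limit[OF _ _ gm C'(2)]) (auto intro!: continuous_intros cg g(2) mult_pos_pos)
  obtain x where x: "x \<in> {-1..1::real}" "\<forall>y\<in>{-1..1}. g y \<le> g x"
    using continuous_attains_sup[OF _ _ cg(1)[of "{-1..1}"]] by auto
  have up: "c * s powr - e \<le> v \<longleftrightarrow> c \<le> s powr e * v" "v \<le> c * s powr - e \<longleftrightarrow> s powr e * v \<le> c"
    if "s \<ge> 1" for c s e v :: real
    using that by (auto simp: powr_minus field_simps)
  have "power_growth f g \<alpha> \<beta> p0 (max p1 n1) (min q0 r0) (max (g x) (max q1 r1))"
  proof
    fix s :: real assume s: "1 \<le> s"
    show "p0 * s powr \<beta> \<le> f s" using p(3)[OF s] s up(1)[OF s, of p0 "-\<beta>"] by simp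
    have "f s \<le> p1 * s powr \<beta>" using p(4)[OF s] s up(2)[OF s, of _ p1 "-\<beta>"] by simp
    also have "\<dots> \<le> max p1 n1 * s powr \<beta>" by (intro mult_right_mono) auto
    finally show "f s \<le> max p1 n1 * s powr \<beta>" .
    have "- f (- s) \<le> n1 * s powr \<beta>" using n(4)[OF s] s up(2)[OF s, of "- f (- s)" n1 "-\<beta>"] by simp
    also have "\<dots> \<le> max p1 n1 * s powr \<beta>" by (intro mult_right_mono) auto
    finally show "- max p1 n1 * s powr \<beta> \<le> f (- s)" by simp
  next
    fix s :: real assume s: "1 \<le> \<bar>s\<bar>"
    have "q0 \<le> \<bar>s\<bar> powr \<alpha> * g s \<or> r0 \<le> \<bar>s\<bar> powr \<alpha> * g s"
      using s q(3)[of s] r(3)[of "- s"] by (cases "s \<ge> 0") auto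
    then show "min q0 r0 * \<bar>s\<bar> powr - \<alpha> \<le> g s" unfolding up(1)[OF s] by auto
    have "\<bar>s\<bar> powr \<alpha> * g s \<le> q1 \<or> \<bar>s\<bar> powr \<alpha> * g s \<le> r1"
      using s q(4)[of s] r(4)[of "- s"] by (cases "s \<ge> 0") auto
    then show "g s \<le> max (g x) (max q1 r1) * \<bar>s\<bar> powr - \<alpha>" unfolding up(2)[OF s] by auto
  next
    fix s :: real assume "\<bar>s\<bar> \<le> 1"
    then show "g s \<le> max (g x) (max q1 r1)" using x(2) by (auto simp: abs_le_iff le_max_iff_disj)
  qed (use f g \<alpha> \<beta> p q r n in auto)
  then show ?thesis by blast
qed

lemma classical_sub_solution:
  assumes "mono f" "\<And>p. g p > 0" "C2_on (Q b) \<Psi>" "continuous_on (Q0 b) \<Psi>"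
    and "\<And>z. z \<in> Q b \<Longrightarrow> residual f g \<Psi> z \<le> 0"
  shows "sub_solution b f g \<Psi>"
proof -
  have "residual f g \<phi> z \<le> 0"
    if "z \<in> Q b" "C2_on (Q b) \<phi>" "\<forall>\<^sub>F w in nhds z. \<Psi> w - \<phi> w \<le> \<Psi> z - \<phi> z" for z \<phi>
  proof -
    have "residual f g \<phi> z \<le> residual f g \<Psi> z"
      by (rule residual_touching[OF open_Q assms(3) that(2,1,3) assms(1,2)])
    also have "\<dots> \<le> 0" using assms(5) that(1) .
    finally show ?thesis .
  qed
  then show ?thesis
    using continuous_imp_usc_on[OF assms(4)] unfolding sub_solution_def by (auto simp: residual_def)
qed

subsection \<open>Test functions of the form \<open>d x + e t\<close>\<close>

lemma C2_on_sum:
  fixes d d1 d2 e e1 e2 :: "real \<Rightarrow> real"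
  assumes d: "\<And>x. x \<in> {-b<..<b} \<Longrightarrow> (d has_field_derivative d1 x) (at x)"
      "\<And>x. x \<in> {-b<..<b} \<Longrightarrow> (d1 has_field_derivative d2 x) (at x)" "continuous_on {-b<..<b} d2"
    and e: "\<And>t. t > 0 \<Longrightarrow> (e has_field_derivative e1 t) (at t)"
      "\<And>t. t > 0 \<Longrightarrow> (e1 has_field_derivative e2 t) (at t)" "continuous_on {0<..} e2"
  shows "C2_on (Q b) (\<lambda>z. d (fst z) + e (snd z))"
    and "\<And>x t. (x, t) \<in> Q b \<Longrightarrow> residual f g (\<lambda>z. d (fst z) + e (snd z)) (x, t) = e1 t - f (g (d1 x) * d2 x)"
proof -
  have 0: "((\<lambda>_. 0) has_field_derivative 0) (at x)" "continuous_on A (\<lambda>_. 0 :: real)" for x :: real and A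
    by (auto intro: continuous_intros)
  have eq: "(\<lambda>z. d (fst z) + e (snd z)) = (\<lambda>z. 0 * 0 + d (fst z) + e (snd z))" by simp
  note * = C2_on_separable[of b "\<lambda>_. 0" "\<lambda>_. 0" "\<lambda>_. 0" d d1 d2 "\<lambda>_. 0" "\<lambda>_. 0" "\<lambda>_. 0" e e1 e2,
      OF 0(1) 0(1) 0(2) d 0(1) 0(1) 0(2) e, folded eq]
  show "C2_on (Q b) (\<lambda>z. d (fst z) + e (snd z))"
    "\<And>x t. (x, t) \<in> Q b \<Longrightarrow> residual f g (\<lambda>z. d (fst z) + e (snd z)) (x, t) = e1 t - f (g (d1 x) * d2 x)"
    using * by (simp_all add: residual_def F_def)
qed

lemma paraboloid:
  fixes m K y \<Lambda> s :: real
  defines "\<Psi> \<equiv> (\<lambda>z. (m - K * (fst z - y)\<^sup>2) + - \<Lambda> * (snd z - s))"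
  shows "C2_on (Q b) \<Psi>" "continuous_on A \<Psi>"
    "\<And>x t. (x, t) \<in> Q b \<Longrightarrow> residual f g \<Psi> (x, t) = - \<Lambda> - f (g (- 2 * K * (x - y)) * (- 2 * K))"
proof -
  have d: "((\<lambda>x. m - K * (x - y)\<^sup>2) has_field_derivative - 2 * K * (x - y)) (at x)"
    "((\<lambda>x. - 2 * K * (x - y)) has_field_derivative - 2 * K) (at x)" for x
    by (auto intro!: derivative_eq_intros)
  have e: "((\<lambda>t. - \<Lambda> * (t - s)) has_field_derivative - \<Lambda>) (at t)"
    "((\<lambda>_. - \<Lambda>) has_field_derivative 0) (at t)" for t
    by (auto intro!: derivative_eq_intros)
  note * = C2_on_sum[of b, OF d _ e]
  show "C2_on (Q b) \<Psi>" "\<And>x t. (x, t) \<in> Q b \<Longrightarrow> residual f g \<Psi> (x, t) = - \<Lambda> - f (g (- 2 * K * (x - y)) * (- 2 * K))"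
    unfolding \<Psi>_def using * by simp_all
  show "continuous_on A \<Psi>" unfolding \<Psi>_def by (intro continuous_intros)
qed

section \<open>Strict sub-solutions and growth of the diffusion term\<close>

context power_growth
begin

text \<open>The diffusion term depends on \<open>K\<close>, \<open>y\<close> and \<open>x\<close>
  only and is bounded on \<open>{-b..b}\<close>. One speed \<Lambda> thus serves all heights
  \<open>m\<close> and all starting times \<open>s\<close>; this allows \<open>s\<close> to approach
  the time of interest while \<Lambda> is kept.\<close>

lemma paraboloid_strict_sub:
  "\<exists>\<Lambda>>0. \<forall>z\<in>Q b. \<forall>m s. residual f g (\<lambda>z. (m - K * (fst z - y)\<^sup>2) + - \<Lambda> * (snd z - s)) z < 0"
proof -
  have "continuous_on {-b..b} (\<lambda>x. f (g (- 2 * K * (x - y)) * (- 2 * K)))"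
    by (intro continuous_on_compose2[OF f_cont] continuous_on_compose2[OF g_cont] continuous_intros) auto
  then have "bounded ((\<lambda>x. f (g (- 2 * K * (x - y)) * (- 2 * K))) ` {-b..b})"
    using compact_continuous_image compact_imp_bounded by blast
  then obtain B where B: "\<And>x. x \<in> {-b..b} \<Longrightarrow> \<bar>f (g (- 2 * K * (x - y)) * (- 2 * K))\<bar> \<le> B"
    unfolding bounded_real by blast
  show ?thesis
  proof (intro exI[of _ "\<bar>B\<bar> + 1"] conjI ballI allI)
    fix z m s assume z: "z \<in> Q b"
    obtain x t where [simp]: "z = (x, t)" by (cases z)
    have "\<bar>f (g (- 2 * K * (x - y)) * (- 2 * K))\<bar> \<le> B" using B[of x] z by (auto simp: Q_def)
    then show "residual f g (\<lambda>z. (m - K * (fst z - y)\<^sup>2) + - (\<bar>B\<bar> + 1) * (snd z - s)) z < 0"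
      using paraboloid(3)[of x t b f g m K y "\<bar>B\<bar> + 1" s] z by simp
  qed simp
qed

text \<open>These waves force the boundary values: at time 0 they lie below the constant
  \<open>m\<close>, while at the end \<sigma> \<open>b\<close> they equal \<open>m + c * t\<close>,
  with \<open>c\<close> as large as desired. A steep convex profile drives any speed
  \<open>c\<close>.\<close>

lemma exponential_strict_sub:
  fixes m c \<sigma> :: real
  assumes b: "b > 0" and \<sigma>: "\<bar>\<sigma>\<bar> = 1"
  obtains A \<mu> where "A > 0" "\<mu> > 0"
    "C2_on (Q b) (\<lambda>z. A * (exp (\<mu> * \<sigma> * fst z) - exp (\<mu> * b)) + (m + c * snd z))"
    "\<And>z. z \<in> Q b \<Longrightarrow> residual f g (\<lambda>z. A * (exp (\<mu> * \<sigma> * fst z) - exp (\<mu> * b)) + (m + c * snd z)) z < 0"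
proof -
  \<comment> \<open>\<mu> makes \<open>f (c0 * \<mu>)\<close> at least
    \<open>\<bar>c\<bar> + 1\<close>, and \<open>A\<close> makes the modulus of the slope equal to 1
    at the far end and larger elsewhere, so that the power law for \<open>g\<close> applies. Since
    \<alpha> \<le> 1, larger slopes only help.\<close>
  define \<mu> where "\<mu> = (1 + ((\<bar>c\<bar> + 1) / a0) powr (1 / \<beta>)) / c0"
  define A where "A = exp (\<mu> * b) / \<mu>"
  have \<mu>: "\<mu> > 0" using pos by (simp add: \<mu>_def add_pos_nonneg)
  have A: "A > 0" using \<mu> by (simp add: A_def)
  have \<sigma>2: "\<sigma> * \<sigma> = 1" using \<sigma> by (metis abs_mult_self_eq mult_1)
  have d: "((\<lambda>x. A * (exp (\<mu> * \<sigma> * x) - exp (\<mu> * b))) has_field_derivative A * \<mu> * \<sigma> * exp (\<mu> * \<sigma> * x)) (at x)" for x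
    by (auto intro!: derivative_eq_intros)
  have d2: "((\<lambda>x. A * \<mu> * \<sigma> * exp (\<mu> * \<sigma> * x)) has_field_derivative A * \<mu>\<^sup>2 * exp (\<mu> * \<sigma> * x)) (at x)" for x
  proof -
    have "((\<lambda>x. A * \<mu> * \<sigma> * exp (\<mu> * \<sigma> * x)) has_field_derivative A * \<mu> * \<sigma> * (exp (\<mu> * \<sigma> * x) * (\<mu> * \<sigma>))) (at x)"
      by (auto intro!: derivative_eq_intros)
    also have "A * \<mu> * \<sigma> * (exp (\<mu> * \<sigma> * x) * (\<mu> * \<sigma>)) = A * \<mu>\<^sup>2 * exp (\<mu> * \<sigma> * x) * (\<sigma> * \<sigma>)"
      by (simp add: power2_eq_square mult_ac)
    finally show ?thesis by (simp add: \<sigma>2)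
  qed
  have e: "((\<lambda>t. m + c * t) has_field_derivative c) (at t)" "((\<lambda>_. c) has_field_derivative 0) (at t)" for t
    by (auto intro!: derivative_eq_intros)
  note * = C2_on_sum[of b, OF d d2 _ e]
  show ?thesis
  proof (rule that[OF A \<mu>])
    show "C2_on (Q b) (\<lambda>z. A * (exp (\<mu> * \<sigma> * fst z) - exp (\<mu> * b)) + (m + c * snd z))"
      by (rule *) (intro continuous_intros)+
    fix z assume z: "z \<in> Q b"
    obtain x t where [simp]: "z = (x, t)" by (cases z)
    have res: "residual f g (\<lambda>z. A * (exp (\<mu> * \<sigma> * fst z) - exp (\<mu> * b)) + (m + c * snd z)) (x, t) =
        c - f (g (A * \<mu> * \<sigma> * exp (\<mu> * \<sigma> * x)) * (A * \<mu>\<^sup>2 * exp (\<mu> * \<sigma> * x)))"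
      using z by (intro *) (auto intro!: continuous_intros)
    define P where "P = A * \<mu> * exp (\<mu> * \<sigma> * x)"
    have "\<bar>x\<bar> \<le> b" using z by (auto simp: Q_def)
    then have "- b \<le> \<sigma> * x" using \<sigma> by (metis abs_le_iff abs_mult minus_le_iff mult_1)
    then have "\<mu> * b + \<mu> * \<sigma> * x \<ge> 0" using \<mu> by (metis add.commute distrib_left minus_le_iff mult.assoc mult_nonneg_nonneg less_imp_le diff_ge_0_iff_ge diff_minus_eq_add)
    then have P1: "P \<ge> 1" using \<mu> by (simp add: P_def A_def flip: exp_add)
    have "g (A * \<mu> * \<sigma> * exp (\<mu> * \<sigma> * x)) \<ge> c0 * P powr - \<alpha>"
      using g_lower[of "A * \<mu> * \<sigma> * exp (\<mu> * \<sigma> * x)"] P1 A \<mu> \<sigma> by (simp add: P_def abs_mult)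
    then have "g (A * \<mu> * \<sigma> * exp (\<mu> * \<sigma> * x)) * (\<mu> * P) \<ge> c0 * P powr - \<alpha> * (\<mu> * P)"
      using \<mu> P1 by (intro mult_right_mono) auto
    also have "c0 * P powr - \<alpha> * (\<mu> * P) = c0 * \<mu> * P powr (1 - \<alpha>)"
      using P1 by (simp add: powr_diff powr_minus field_simps)
    finally have 1: "g (A * \<mu> * \<sigma> * exp (\<mu> * \<sigma> * x)) * (A * \<mu>\<^sup>2 * exp (\<mu> * \<sigma> * x)) \<ge> c0 * \<mu> * P powr (1 - \<alpha>)"
      by (simp add: P_def power2_eq_square mult_ac)
    have "c0 * \<mu> * P powr (1 - \<alpha>) \<ge> c0 * \<mu> * 1"
      using P1 \<mu> pos \<alpha>_le by (intro mult_left_mono ge_one_powr_ge_zero) auto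
    then have 2: "g (A * \<mu> * \<sigma> * exp (\<mu> * \<sigma> * x)) * (A * \<mu>\<^sup>2 * exp (\<mu> * \<sigma> * x)) \<ge> c0 * \<mu>"
      using 1 by linarith
    have c\<mu>: "c0 * \<mu> = 1 + ((\<bar>c\<bar> + 1) / a0) powr (1 / \<beta>)" using pos by (simp add: \<mu>_def)
    have "\<bar>c\<bar> + 1 = a0 * (((\<bar>c\<bar> + 1) / a0) powr (1 / \<beta>)) powr \<beta>"
      using pos \<beta>_pos by (simp add: powr_powr)
    also have "\<dots> \<le> a0 * (c0 * \<mu>) powr \<beta>"
      unfolding c\<mu> using pos \<beta>_pos by (intro mult_left_mono powr_mono2) auto
    also have "\<dots> \<le> f (c0 * \<mu>)" using c\<mu> by (intro f_lower) simp
    also have "\<dots> \<le> f (g (A * \<mu> * \<sigma> * exp (\<mu> * \<sigma> * x)) * (A * \<mu>\<^sup>2 * exp (\<mu> * \<sigma> * x)))"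
      using 2 by (rule f_le)
    finally show "residual f g (\<lambda>z. A * (exp (\<mu> * \<sigma> * fst z) - exp (\<mu> * b)) + (m + c * snd z)) z < 0"
      using res by simp
  qed
qed

text \<open>A crude bound for the region where the slope may vanish. Any polynomial rate is good
  enough there: derivatives of size \<open>exp (\<Lambda> * t)\<close> then give a diffusion of size
  \<open>exp (q * \<Lambda> * t)\<close>, which a faster exponential in time absorbs.\<close>

lemma f_polynomial_bound:
  "\<exists>A\<ge>0. \<exists>q\<ge>0. \<forall>R\<ge>1. \<forall>p z. \<bar>p\<bar> \<le> R \<longrightarrow> \<bar>z\<bar> \<le> R \<longrightarrow> f (g p * z) \<le> A * R powr q"
proof (intro exI conjI allI impI)
  show "a1 * (c1 + 1) powr \<beta> \<ge> 0" "(\<bar>\<alpha>\<bar> + 1) * \<beta> \<ge> 0" using pos \<beta>_pos by auto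
  fix R p z :: real assume R: "R \<ge> 1" "\<bar>p\<bar> \<le> R" "\<bar>z\<bar> \<le> R"
  have "g p \<le> c1 * R powr \<bar>\<alpha>\<bar>"
  proof (cases "\<bar>p\<bar> \<le> 1")
    case True
    have "c1 * 1 \<le> c1 * R powr \<bar>\<alpha>\<bar>" using R pos by (intro mult_left_mono ge_one_powr_ge_zero) auto
    then show ?thesis using g_upper_small[OF True] by simp
  next
    case False
    have "\<bar>p\<bar> powr - \<alpha> \<le> \<bar>p\<bar> powr \<bar>\<alpha>\<bar>" using False by (intro powr_mono) auto
    also have "\<dots> \<le> R powr \<bar>\<alpha>\<bar>" using R by (intro powr_mono2) auto
    finally have "c1 * \<bar>p\<bar> powr - \<alpha> \<le> c1 * R powr \<bar>\<alpha>\<bar>" using pos by (intro mult_left_mono) auto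
    then show ?thesis using g_upper[of p] False by simp
  qed
  then have "g p * z \<le> (c1 * R powr \<bar>\<alpha>\<bar>) * R"
    using R g_pos[of p] pos by (intro order_trans[OF mult_left_mono[of z R "g p"] mult_right_mono]) auto
  also have "\<dots> \<le> ((c1 + 1) * R powr \<bar>\<alpha>\<bar>) * R" using R by (intro mult_right_mono) auto
  also have "\<dots> = (c1 + 1) * R powr (\<bar>\<alpha>\<bar> + 1)" using R by (simp add: powr_add)
  finally have "f (g p * z) \<le> f ((c1 + 1) * R powr (\<bar>\<alpha>\<bar> + 1))" by (rule f_le)
  also have "\<dots> \<le> a1 * ((c1 + 1) * R powr (\<bar>\<alpha>\<bar> + 1)) powr \<beta>"
  proof (rule f_upper)
    have "1 * 1 \<le> (c1 + 1) * R powr (\<bar>\<alpha>\<bar> + 1)"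
      using R pos by (intro mult_mono ge_one_powr_ge_zero) auto
    then show "1 \<le> (c1 + 1) * R powr (\<bar>\<alpha>\<bar> + 1)" by simp
  qed
  also have "\<dots> = a1 * (c1 + 1) powr \<beta> * R powr ((\<bar>\<alpha>\<bar> + 1) * \<beta>)"
    using R pos by (simp add: powr_mult powr_powr)
  finally show "f (g p * z) \<le> a1 * (c1 + 1) powr \<beta> * R powr ((\<bar>\<alpha>\<bar> + 1) * \<beta>)" .
qed

text \<open>\<open>X\<close> is the size of the slope and \<open>X / d\<close> that of the second
  derivative. The slope is bounded from both sides because \<alpha> may have either sign, so
  \<open>\<bar>p\<bar> powr - \<alpha>\<close> may increase or decrease.\<close>

lemma f_scaling_bound:
  fixes C1 c2 D :: real
  assumes "C1 > 0" "c2 > 0" "D > 0"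
  shows "\<exists>C>0. \<forall>X d p z. 1 \<le> X \<longrightarrow> 1 \<le> c2 * X \<longrightarrow> 0 < d \<longrightarrow> d \<le> D \<longrightarrow> c2 * X \<le> \<bar>p\<bar> \<longrightarrow>
    \<bar>p\<bar> \<le> C1 * X \<longrightarrow> \<bar>z\<bar> \<le> C1 * X / d \<longrightarrow> f (g p * z) \<le> C * X powr (\<beta> * (1 - \<alpha>)) * d powr - \<beta>"
proof -
  define c3 where "c3 = c1 * (C1 powr - \<alpha> + c2 powr - \<alpha>)"
  have c3: "c3 > 0" using pos assms by (simp add: c3_def add_pos_pos)
  \<comment> \<open>The summand \<open>D\<close> gives \<open>d \<le> c4\<close>, so that the
    argument of \<open>f\<close> is at least 1 and the upper power law holds.\<close>
  define c4 where "c4 = c3 * C1 + D"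
  have c4: "c4 > 0" using c3 assms by (simp add: c4_def add_pos_pos)
  show ?thesis
  proof (intro exI conjI allI impI)
    show "a1 * c4 powr \<beta> > 0" using pos c4 by simp
    fix X d p z :: real
    assume X: "1 \<le> X" "1 \<le> c2 * X" and d: "0 < d" "d \<le> D" and p: "c2 * X \<le> \<bar>p\<bar>" "\<bar>p\<bar> \<le> C1 * X"
      and z: "\<bar>z\<bar> \<le> C1 * X / d"
    have "\<bar>p\<bar> powr - \<alpha> \<le> (C1 powr - \<alpha> + c2 powr - \<alpha>) * X powr - \<alpha>"
    proof (cases "\<alpha> \<le> 0")
      case True
      have "\<bar>p\<bar> powr - \<alpha> \<le> (C1 * X) powr - \<alpha>" using p True by (intro powr_mono2) auto
      also have "\<dots> = C1 powr - \<alpha> * X powr - \<alpha>" using X assms by (simp add: powr_mult)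
      also have "\<dots> \<le> (C1 powr - \<alpha> + c2 powr - \<alpha>) * X powr - \<alpha>" by (intro mult_right_mono) auto
      finally show ?thesis .
    next
      case False
      have "\<bar>p\<bar> powr - \<alpha> \<le> (c2 * X) powr - \<alpha>" using p False X by (intro powr_mono2') auto
      also have "\<dots> = c2 powr - \<alpha> * X powr - \<alpha>" using X assms by (simp add: powr_mult)
      also have "\<dots> \<le> (C1 powr - \<alpha> + c2 powr - \<alpha>) * X powr - \<alpha>" by (intro mult_right_mono) auto
      finally show ?thesis .
    qed
    then have "c1 * \<bar>p\<bar> powr - \<alpha> \<le> c3 * X powr - \<alpha>"
      unfolding c3_def using pos by (simp add: mult.assoc)
    then have gp: "g p \<le> c3 * X powr - \<alpha>" using g_upper[of p] p X by simp
    have "g p * z \<le> g p * (C1 * X / d)" using z g_pos[of p] by (intro mult_left_mono) auto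
    also have "\<dots> \<le> c3 * X powr - \<alpha> * (C1 * X / d)" using gp X assms d by (intro mult_right_mono) auto
    also have "\<dots> = c3 * C1 * X powr (1 - \<alpha>) / d" using X by (simp add: powr_diff powr_minus field_simps)
    also have "\<dots> \<le> c4 * X powr (1 - \<alpha>) / d"
      using d assms by (intro divide_right_mono mult_right_mono) (auto simp: c4_def)
    finally have "f (g p * z) \<le> f (c4 * X powr (1 - \<alpha>) / d)" by (rule f_le)
    also have "\<dots> \<le> a1 * (c4 * X powr (1 - \<alpha>) / d) powr \<beta>"
    proof (rule f_upper)
      have "d * 1 \<le> c4 * X powr (1 - \<alpha>)"
      proof (rule mult_mono)
        show "d \<le> c4" using d c3 assms by (simp add: c4_def add_increasing)
        show "1 \<le> X powr (1 - \<alpha>)" using X \<alpha>_le by (intro ge_one_powr_ge_zero) auto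
      qed (use c4 in auto)
      then show "1 \<le> c4 * X powr (1 - \<alpha>) / d" using d by (simp add: field_simps)
    qed
    also have "\<dots> = a1 * c4 powr \<beta> * X powr (\<beta> * (1 - \<alpha>)) * d powr - \<beta>"
      using c4 X d by (simp add: powr_mult powr_divide powr_powr powr_minus field_simps)
    finally show "f (g p * z) \<le> a1 * c4 powr \<beta> * X powr (\<beta> * (1 - \<alpha>)) * d powr - \<beta>" .
  qed
qed

end

subsection \<open>Barriers that are singular at the lateral boundary\<close>

text \<open>\<open>b\<^sup>2 - x\<^sup>2\<close> is a smooth substitute for the distance to the
  nearer end, comparable to it on the interval.\<close>

definition weight :: "real \<Rightarrow> real \<Rightarrow> real \<Rightarrow> real"
  where "weight b \<gamma> x = (b\<^sup>2 - x\<^sup>2) powr - \<gamma>"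

definition weight1 :: "real \<Rightarrow> real \<Rightarrow> real \<Rightarrow> real"
  where "weight1 b \<gamma> x = 2 * \<gamma> * x * (b\<^sup>2 - x\<^sup>2) powr (- \<gamma> - 1)"

definition weight2 :: "real \<Rightarrow> real \<Rightarrow> real \<Rightarrow> real"
  where "weight2 b \<gamma> x = 2 * \<gamma> * (b\<^sup>2 - x\<^sup>2) powr (- \<gamma> - 1) + 4 * \<gamma> * (\<gamma> + 1) * x\<^sup>2 * (b\<^sup>2 - x\<^sup>2) powr (- \<gamma> - 2)"

lemma gap_pos: "x \<in> {-b<..<b} \<Longrightarrow> 0 < b\<^sup>2 - x\<^sup>2" for x b :: real
  using abs_less_iff[of x b] power2_strict_mono[of x b] by (auto simp: abs_if split: if_splits)

lemma has_derivative_weight: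
  assumes "x \<in> {-b<..<b}"
  shows "(weight b \<gamma> has_field_derivative weight1 b \<gamma> x) (at x)"
    and "(weight1 b \<gamma> has_field_derivative weight2 b \<gamma> x) (at x)"
proof -
  have p: "((\<lambda>x. (b\<^sup>2 - x\<^sup>2) powr r) has_field_derivative r * (b\<^sup>2 - x\<^sup>2) powr (r - 1) * (- 2 * x)) (at x)" for r
    using DERIV_fun_powr[of "\<lambda>x. b\<^sup>2 - x\<^sup>2" "- 2 * x" x r] gap_pos[OF assms]
    by (auto intro!: derivative_eq_intros)
  show "(weight b \<gamma> has_field_derivative weight1 b \<gamma> x) (at x)"
    unfolding weight_def[abs_def] weight1_def using p[of "- \<gamma>"] by (simp add: mult_ac)
  have "((\<lambda>x. 2 * \<gamma> * x * (b\<^sup>2 - x\<^sup>2) powr (- \<gamma> - 1)) has_field_derivative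
     2 * \<gamma> * (b\<^sup>2 - x\<^sup>2) powr (- \<gamma> - 1) + 2 * \<gamma> * x * ((- \<gamma> - 1) * (b\<^sup>2 - x\<^sup>2) powr (- \<gamma> - 1 - 1) * (- 2 * x))) (at x)"
    by (rule derivative_eq_intros p refl | simp)+
  also have "2 * \<gamma> * (b\<^sup>2 - x\<^sup>2) powr (- \<gamma> - 1) + 2 * \<gamma> * x * ((- \<gamma> - 1) * (b\<^sup>2 - x\<^sup>2) powr (- \<gamma> - 1 - 1) * (- 2 * x)) = weight2 b \<gamma> x"
    unfolding weight2_def by (simp add: power2_eq_square algebra_simps)
  finally show "(weight1 b \<gamma> has_field_derivative weight2 b \<gamma> x) (at x)"
    unfolding weight1_def[abs_def] .
qed

lemma continuous_on_weight:
  "continuous_on {-b<..<b} (weight b \<gamma>)" "continuous_on {-b<..<b} (weight1 b \<gamma>)" "continuous_on {-b<..<b} (weight2 b \<gamma>)"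
proof -
  have p: "continuous_on {-b<..<b} (\<lambda>x. (b\<^sup>2 - x\<^sup>2) powr r)" for r
    by (intro continuous_intros ballI) (use gap_pos[of _ b] in fastforce)
  show "continuous_on {-b<..<b} (weight b \<gamma>)" "continuous_on {-b<..<b} (weight1 b \<gamma>)" "continuous_on {-b<..<b} (weight2 b \<gamma>)"
    unfolding weight_def[abs_def] weight1_def[abs_def] weight2_def[abs_def] by (intro continuous_intros p)+
qed

lemma has_derivative_weighted_square:
  assumes "x \<in> {-b<..<b}"
  shows "((\<lambda>x. (x - y)\<^sup>2 * weight b \<gamma> x) has_field_derivative 2 * (x - y) * weight b \<gamma> x + (x - y)\<^sup>2 * weight1 b \<gamma> x) (at x)"
    and "((\<lambda>x. 2 * (x - y) * weight b \<gamma> x + (x - y)\<^sup>2 * weight1 b \<gamma> x) has_field_derivative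
      2 * weight b \<gamma> x + 4 * (x - y) * weight1 b \<gamma> x + (x - y)\<^sup>2 * weight2 b \<gamma> x) (at x)"
  by (rule derivative_eq_intros has_derivative_weight[OF assms] refl | simp add: algebra_simps)+

text \<open>Each derivative costs one power of the gap \<open>b\<^sup>2 - x\<^sup>2\<close>. Less
  singular terms are absorbed since the gap is at most \<open>b\<^sup>2\<close>, and factors
  \<open>x - y\<close> since they are at most \<open>2 * b\<close> in modulus.\<close>

lemma weight_bounds:
  fixes b \<gamma> y :: real
  assumes b: "b > 0" and \<gamma>: "\<gamma> > 0" and y: "y \<in> {-b<..<b}"
  shows "\<exists>C\<ge>1. \<forall>x\<in>{-b<..<b}.
     \<bar>weight1 b \<gamma> x\<bar> \<le> C * (b\<^sup>2 - x\<^sup>2) powr (- \<gamma> - 1) \<and>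
     \<bar>weight2 b \<gamma> x\<bar> \<le> C * (b\<^sup>2 - x\<^sup>2) powr (- \<gamma> - 2) \<and>
     \<bar>2 * (x - y) * weight b \<gamma> x + (x - y)\<^sup>2 * weight1 b \<gamma> x\<bar> \<le> C * (b\<^sup>2 - x\<^sup>2) powr (- \<gamma> - 1) \<and>
     \<bar>2 * weight b \<gamma> x + 4 * (x - y) * weight1 b \<gamma> x + (x - y)\<^sup>2 * weight2 b \<gamma> x\<bar> \<le> C * (b\<^sup>2 - x\<^sup>2) powr (- \<gamma> - 2)"
proof -
  define A1 where "A1 = 2 * \<gamma> * b"
  define A2 where "A2 = 2 * \<gamma> * b\<^sup>2 + 4 * \<gamma> * (\<gamma> + 1) * b\<^sup>2"
  define B1 where "B1 = 4 * b * b\<^sup>2 + 4 * b\<^sup>2 * A1"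
  define B2 where "B2 = 2 * b ^ 4 + 8 * b * (A1 * b\<^sup>2) + 4 * b\<^sup>2 * A2"
  have nn: "A1 \<ge> 0" "A2 \<ge> 0" "B1 \<ge> 0" "B2 \<ge> 0"
    using b \<gamma> by (auto simp: A1_def A2_def B1_def B2_def)
  have "\<bar>weight1 b \<gamma> x\<bar> \<le> A1 * D1 \<and> \<bar>weight2 b \<gamma> x\<bar> \<le> A2 * D2 \<and>
     \<bar>2 * (x - y) * weight b \<gamma> x + (x - y)\<^sup>2 * weight1 b \<gamma> x\<bar> \<le> B1 * D1 \<and>
     \<bar>2 * weight b \<gamma> x + 4 * (x - y) * weight1 b \<gamma> x + (x - y)\<^sup>2 * weight2 b \<gamma> x\<bar> \<le> B2 * D2"
    if x: "x \<in> {-b<..<b}" and D1: "D1 = (b\<^sup>2 - x\<^sup>2) powr (- \<gamma> - 1)" and D2: "D2 = (b\<^sup>2 - x\<^sup>2) powr (- \<gamma> - 2)" for x D1 D2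
  proof -
    define d where "d = b\<^sup>2 - x\<^sup>2"
    have d: "d > 0" "d \<le> b\<^sup>2" using gap_pos[OF x] by (auto simp: d_def)
    have D12: "D1 = d * D2" "weight b \<gamma> x = d * D1"
    proof -
      have "- \<gamma> - 1 = 1 + (- \<gamma> - 2)" "- \<gamma> = 1 + (- \<gamma> - 1)" by simp_all
      then show "D1 = d * D2" "weight b \<gamma> x = d * D1"
        unfolding D1 D2 weight_def d_def[symmetric] using d powr_add[of d 1] by (metis powr_one less_imp_le)+
    qed
    have D0: "D1 \<ge> 0" "D2 \<ge> 0" by (auto simp: D1 D2)
    have D1le: "D1 \<le> b\<^sup>2 * D2" using d D0 by (simp add: D12 mult_right_mono)
    have wle: "\<bar>weight b \<gamma> x\<bar> \<le> b\<^sup>2 * D1" using d D0 by (simp add: D12(2) abs_mult mult_right_mono)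
    have wle2: "\<bar>weight b \<gamma> x\<bar> \<le> b ^ 4 * D2"
    proof -
      have "b\<^sup>2 * D1 \<le> b\<^sup>2 * (b\<^sup>2 * D2)" using D1le by (intro mult_left_mono) auto
      with wle show ?thesis by (simp add: power2_eq_square eval_nat_numeral mult_ac)
    qed
    have ax: "\<bar>x\<bar> \<le> b" "x\<^sup>2 \<le> b\<^sup>2" using x d by (auto simp: d_def)
    have axy: "\<bar>x - y\<bar> \<le> 2 * b" using x y by auto
    then have axy2: "(x - y)\<^sup>2 \<le> 4 * b\<^sup>2"
      using power_mono[OF axy, of 2] by (simp add: power_mult_distrib)
    have w1: "\<bar>weight1 b \<gamma> x\<bar> \<le> A1 * D1"
      using ax \<gamma> D0 by (auto simp: weight1_def A1_def abs_mult D1[symmetric] intro!: mult_right_mono)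
    have w1': "\<bar>weight1 b \<gamma> x\<bar> \<le> A1 * b\<^sup>2 * D2"
      using w1 mult_left_mono[OF D1le nn(1)] by (simp add: mult.assoc)
    have w2: "\<bar>weight2 b \<gamma> x\<bar> \<le> A2 * D2"
    proof -
      have "\<bar>weight2 b \<gamma> x\<bar> = 2 * \<gamma> * D1 + 4 * \<gamma> * (\<gamma> + 1) * x\<^sup>2 * D2"
        using \<gamma> D0 by (simp add: weight2_def D1[symmetric] D2[symmetric])
      also have "\<dots> \<le> 2 * \<gamma> * (b\<^sup>2 * D2) + 4 * \<gamma> * (\<gamma> + 1) * b\<^sup>2 * D2"
        using \<gamma> D0 D1le ax by (intro add_mono mult_left_mono mult_right_mono) auto
      finally show ?thesis by (simp add: A2_def algebra_simps)
    qed
    have "\<bar>2 * (x - y) * weight b \<gamma> x + (x - y)\<^sup>2 * weight1 b \<gamma> x\<bar> \<le> 2 * \<bar>x - y\<bar> * \<bar>weight b \<gamma> x\<bar> + (x - y)\<^sup>2 * \<bar>weight1 b \<gamma> x\<bar>"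
      using abs_triangle_ineq[of "2 * (x - y) * weight b \<gamma> x" "(x - y)\<^sup>2 * weight1 b \<gamma> x"]
      by (simp only: abs_mult abs_numeral abs_power2)
    also have "\<dots> \<le> 2 * (2 * b) * (b\<^sup>2 * D1) + (4 * b\<^sup>2) * (A1 * D1)"
      using axy axy2 wle w1 b D0 nn by (intro add_mono mult_mono) auto
    finally have k1: "\<bar>2 * (x - y) * weight b \<gamma> x + (x - y)\<^sup>2 * weight1 b \<gamma> x\<bar> \<le> B1 * D1"
      by (simp add: B1_def algebra_simps)
    have "\<bar>2 * weight b \<gamma> x + 4 * (x - y) * weight1 b \<gamma> x + (x - y)\<^sup>2 * weight2 b \<gamma> x\<bar> \<le>
        2 * \<bar>weight b \<gamma> x\<bar> + 4 * \<bar>x - y\<bar> * \<bar>weight1 b \<gamma> x\<bar> + (x - y)\<^sup>2 * \<bar>weight2 b \<gamma> x\<bar>"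
      using abs_triangle_ineq[of "2 * weight b \<gamma> x + 4 * (x - y) * weight1 b \<gamma> x" "(x - y)\<^sup>2 * weight2 b \<gamma> x"]
        abs_triangle_ineq[of "2 * weight b \<gamma> x" "4 * (x - y) * weight1 b \<gamma> x"]
      unfolding abs_mult abs_numeral abs_power2 by linarith
    also have "\<dots> \<le> 2 * (b ^ 4 * D2) + 4 * (2 * b) * (A1 * b\<^sup>2 * D2) + (4 * b\<^sup>2) * (A2 * D2)"
      using axy axy2 wle2 w1' w2 b D0 nn by (intro add_mono mult_mono) auto
    finally have k2: "\<bar>2 * weight b \<gamma> x + 4 * (x - y) * weight1 b \<gamma> x + (x - y)\<^sup>2 * weight2 b \<gamma> x\<bar> \<le> B2 * D2"
      by (simp add: B2_def algebra_simps)
    show ?thesis using w1 w2 k1 k2 by blast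
  qed
  note * = this
  define C where "C = 1 + A1 + A2 + B1 + B2"
  have C: "A1 \<le> C" "A2 \<le> C" "B1 \<le> C" "B2 \<le> C" "1 \<le> C" using nn by (auto simp: C_def)
  have up: "v \<le> C * s powr r" if "v \<le> A * s powr r" "A \<le> C" for v A s r :: real
    using that(1) mult_right_mono[OF that(2), of "s powr r"] by simp
  show ?thesis
    by (intro exI[of _ C] conjI ballI C(5)) (use *[OF _ refl refl] C(1-4) up in blast)+
qed

text \<open>Beyond \<open>b - \<eta>\<close> the point \<open>x\<close> is farther out than
  \<open>y\<close>, so \<open>x - y\<close>, \<open>weight1\<close> and \<open>x\<close> have the
  same sign. Nothing cancels, and the slope has the full order of its most singular term.\<close>

lemma weight1_lower:
  assumes b: "b > 0" and \<gamma>: "\<gamma> > 0" and y: "y \<in> {-b<..<b}" and x: "x \<in> {-b<..<b}"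
    and \<eta>: "\<eta> = (b - \<bar>y\<bar>) / 2" "b - \<eta> \<le> \<bar>x\<bar>" and B: "B \<ge> 0"
  shows "min (\<eta>\<^sup>2) 1 * \<gamma> * b * (1 + B) * (b\<^sup>2 - x\<^sup>2) powr (- \<gamma> - 1) \<le>
    \<bar>2 * (x - y) * weight b \<gamma> x + (x - y)\<^sup>2 * weight1 b \<gamma> x + B * weight1 b \<gamma> x\<bar>"
proof -
  define D where "D = (b\<^sup>2 - x\<^sup>2) powr (- \<gamma> - 1)"
  have D: "D \<ge> 0" by (simp add: D_def)
  have \<eta>': "0 < \<eta>" "\<eta> \<le> b / 2" "\<bar>y\<bar> = b - 2 * \<eta>" using y by (auto simp: \<eta>(1) abs_if field_simps split: if_splits)
  have w: "weight b \<gamma> x \<ge> 0" by (simp add: weight_def)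
  have same: "\<bar>2 * (x - y) * weight b \<gamma> x + (x - y)\<^sup>2 * weight1 b \<gamma> x + B * weight1 b \<gamma> x\<bar> =
     2 * \<bar>x - y\<bar> * weight b \<gamma> x + ((x - y)\<^sup>2 + B) * \<bar>weight1 b \<gamma> x\<bar>"
  proof (cases "x \<ge> 0")
    case True
    then have "x - y \<ge> 0" using \<eta>(2) \<eta>' by linarith
    moreover have "weight1 b \<gamma> x \<ge> 0" using True \<gamma> by (simp add: weight1_def)
    ultimately have "2 * (x - y) * weight b \<gamma> x + (x - y)\<^sup>2 * weight1 b \<gamma> x + B * weight1 b \<gamma> x \<ge> 0"
      using w B by (intro add_nonneg_nonneg mult_nonneg_nonneg) auto
    then show ?thesis using \<open>x - y \<ge> 0\<close> \<open>weight1 b \<gamma> x \<ge> 0\<close> by (simp add: distrib_right)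
  next
    case False
    then have "x - y \<le> 0" using \<eta>(2) \<eta>' by linarith
    moreover have w1: "weight1 b \<gamma> x \<le> 0" using False \<gamma> by (simp add: weight1_def mult_nonneg_nonpos mult_nonpos_nonneg)
    ultimately have "2 * (x - y) * weight b \<gamma> x \<le> 0" "(x - y)\<^sup>2 * weight1 b \<gamma> x \<le> 0" "B * weight1 b \<gamma> x \<le> 0"
      using w B by (auto intro: mult_nonneg_nonpos mult_nonpos_nonneg)
    then show ?thesis using \<open>x - y \<le> 0\<close> w1 by (simp add: algebra_simps)
  qed
  have "\<eta> \<le> \<bar>x - y\<bar>" using \<eta>(2) \<eta>' by linarith
  then have "\<eta>\<^sup>2 \<le> (x - y)\<^sup>2" using \<eta>' power_mono[of \<eta> "\<bar>x - y\<bar>" 2] by simp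
  moreover have "min (\<eta>\<^sup>2) 1 * B \<le> B" using B by (simp add: mult_left_le_one_le)
  ultimately have 1: "min (\<eta>\<^sup>2) 1 * (1 + B) \<le> (x - y)\<^sup>2 + B" unfolding distrib_left by linarith
  have 2: "\<gamma> * b * D \<le> \<bar>weight1 b \<gamma> x\<bar>"
  proof -
    have "b / 2 \<le> \<bar>x\<bar>" using \<eta>(2) \<eta>' by linarith
    then have "2 * \<gamma> * (b / 2) * D \<le> 2 * \<gamma> * \<bar>x\<bar> * D" using \<gamma> D by (intro mult_right_mono mult_left_mono) auto
    then show ?thesis using \<gamma> by (simp add: weight1_def abs_mult D_def)
  qed
  have "(min (\<eta>\<^sup>2) 1 * (1 + B)) * (\<gamma> * b * D) \<le> ((x - y)\<^sup>2 + B) * \<bar>weight1 b \<gamma> x\<bar>"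
    using 1 2 B D b \<gamma> by (intro mult_mono) auto
  moreover have "2 * \<bar>x - y\<bar> * weight b \<gamma> x \<ge> 0" using w by simp
  ultimately show ?thesis unfolding same D_def[symmetric] by (simp add: mult_ac)
qed

text \<open>The three terms have separate tasks. \<open>K * (x - y)\<^sup>2\<close> times the weight
  dominates the initial data away from \<open>y\<close>. The weight times
  \<open>exp (\<Lambda> * t) - 1\<close> pays, through its time derivative, for the diffusion near
  the ends. The term in \<open>t\<close> alone pays for it in the middle, where the slope may
  vanish; it is exponential because the derivatives of the second term grow exponentially in time.
  The condition on \<gamma> says that the diffusion is no more singular than the weight.\<close>

lemma (in power_growth) singular_strict_super:
  fixes b \<gamma> y :: real
  assumes b: "b > 0" and y: "y \<in> {-b<..<b}" and \<theta>: "\<beta> * (1 - \<alpha>) < 1"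
    and \<gamma>: "\<gamma> > 0" "\<beta> * (1 - \<alpha>) * (\<gamma> + 1) + \<beta> \<le> \<gamma>"
  shows "\<exists>K1. \<forall>K\<ge>K1. \<forall>m. \<exists>\<Phi>. C2_on (Q b) \<Phi> \<and> continuous_on (Q0 b) \<Phi> \<and> (\<forall>z\<in>Q b. residual f g \<Phi> z > 0) \<and>
    (\<forall>x t. (x, t) \<in> Q0 b \<longrightarrow> m + K * ((x - y)\<^sup>2 * weight b \<gamma> x) \<le> \<Phi> (x, t)) \<and> \<Phi> (y, 0) = m"
proof -
  define \<eta> where "\<eta> = (b - \<bar>y\<bar>) / 2"
  have \<eta>: "0 < \<eta>" "\<eta> \<le> b / 2" using y by (auto simp: \<eta>_def)
  obtain C1 where C1: "C1 \<ge> 1"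
    "\<And>x. x \<in> {-b<..<b} \<Longrightarrow> \<bar>weight1 b \<gamma> x\<bar> \<le> C1 * (b\<^sup>2 - x\<^sup>2) powr (- \<gamma> - 1)"
    "\<And>x. x \<in> {-b<..<b} \<Longrightarrow> \<bar>weight2 b \<gamma> x\<bar> \<le> C1 * (b\<^sup>2 - x\<^sup>2) powr (- \<gamma> - 2)"
    "\<And>x. x \<in> {-b<..<b} \<Longrightarrow> \<bar>2 * (x - y) * weight b \<gamma> x + (x - y)\<^sup>2 * weight1 b \<gamma> x\<bar> \<le> C1 * (b\<^sup>2 - x\<^sup>2) powr (- \<gamma> - 1)"
    "\<And>x. x \<in> {-b<..<b} \<Longrightarrow> \<bar>2 * weight b \<gamma> x + 4 * (x - y) * weight1 b \<gamma> x + (x - y)\<^sup>2 * weight2 b \<gamma> x\<bar> \<le> C1 * (b\<^sup>2 - x\<^sup>2) powr (- \<gamma> - 2)"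
    using weight_bounds[OF b \<gamma>(1) y] by blast
  define c2 where "c2 = min (\<eta>\<^sup>2) 1 * \<gamma> * b"
  have c2: "c2 > 0" using \<eta> b \<gamma> by (simp add: c2_def)
  have "C1 > 0" "b\<^sup>2 > 0" using C1(1) b by auto
  from f_scaling_bound[OF this(1) c2 this(2)] obtain C where "C > 0" and
    C': "\<forall>X d p z. 1 \<le> X \<longrightarrow> 1 \<le> c2 * X \<longrightarrow> 0 < d \<longrightarrow> d \<le> b\<^sup>2 \<longrightarrow> c2 * X \<le> \<bar>p\<bar> \<longrightarrow> \<bar>p\<bar> \<le> C1 * X \<longrightarrow>
      \<bar>z\<bar> \<le> C1 * X / d \<longrightarrow> f (g p * z) \<le> C * X powr (\<beta> * (1 - \<alpha>)) * d powr - \<beta>" by blast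
  note C = \<open>C > 0\<close> C'[rule_format]
  obtain A q where A: "A \<ge> 0" "q \<ge> 0" "\<And>R p z. R \<ge> 1 \<Longrightarrow> \<bar>p\<bar> \<le> R \<Longrightarrow> \<bar>z\<bar> \<le> R \<Longrightarrow> f (g p * z) \<le> A * R powr q"
    using f_polynomial_bound by blast
  define \<theta> where "\<theta> = \<beta> * (1 - \<alpha>)"
  have \<theta>01: "0 \<le> \<theta>" "\<theta> < 1" using \<theta> \<beta>_pos \<alpha>_le by (auto simp: \<theta>_def)
  \<comment> \<open>The surplus exponent of the gap, \<gamma> - \<theta>
    \<open>* (\<gamma> + 1)\<close> - \<beta>, is nonnegative, so this power is largest at gap
    \<open>b\<^sup>2\<close>.\<close>
  define \<Lambda> where "\<Lambda> = C * (b\<^sup>2) powr (\<gamma> - \<theta> * (\<gamma> + 1) - \<beta>) + 1"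
  have \<Lambda>: "\<Lambda> > 0" using C by (simp add: \<Lambda>_def add_nonneg_pos)
  \<comment> \<open>For \<open>K \<ge> K1\<close> the slope scale \<open>X\<close> is at least 1 and
    at least \<open>1 / c2\<close>, even where the gap takes its largest value
    \<open>b\<^sup>2\<close>.\<close>
  define K1 where "K1 = max 1 (max 1 (1 / c2) * (b\<^sup>2) powr (\<gamma> + 1))"
  define d0 where "d0 = b\<^sup>2 - (b - \<eta>)\<^sup>2"
  have d0: "d0 > 0" unfolding d0_def using \<eta> b by (intro gap_pos) auto
  show ?thesis
  proof (intro exI[of _ K1] allI impI)
    fix K m :: real assume K: "K1 \<le> K"
    then have K1: "K \<ge> 1" by (simp add: K1_def)
    \<comment> \<open>In the middle the gap is at least \<open>d0\<close>, and
      \<open>R0 * exp (\<Lambda> * t)\<close> bounds both space derivatives.\<close>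
    define R0 where "R0 = C1 * K * (d0 powr (- \<gamma> - 1) + d0 powr (- \<gamma> - 2)) + 1"
    have R0: "R0 \<ge> 1" using C1(1) K1 by (simp add: R0_def)
    define H0 where "H0 = A * R0 powr q + 1"
    have H0: "H0 > 0" using A by (simp add: H0_def add_nonneg_pos)
    \<comment> \<open>The rate must exceed \<open>q * \<Lambda>\<close>, the growth rate of the
      polynomial bound evaluated at \<open>R0 * exp (\<Lambda> * t)\<close>.\<close>
    define \<omega> where "\<omega> = q * \<Lambda> + 1"
    have \<omega>: "\<omega> \<ge> 1" using A \<Lambda> by (simp add: \<omega>_def)
    define \<Phi> where "\<Phi> = (\<lambda>z. (K * weight b \<gamma> (fst z)) * (exp (\<Lambda> * snd z) - 1) + (m + K * ((fst z - y)\<^sup>2 * weight b \<gamma> (fst z))) + H0 * (exp (\<omega> * snd z) - 1))"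
    define k1 where "k1 = (\<lambda>x. 2 * (x - y) * weight b \<gamma> x + (x - y)\<^sup>2 * weight1 b \<gamma> x)"
    define k2 where "k2 = (\<lambda>x. 2 * weight b \<gamma> x + 4 * (x - y) * weight1 b \<gamma> x + (x - y)\<^sup>2 * weight2 b \<gamma> x)"
    have D: "((\<lambda>x. K * weight b \<gamma> x) has_field_derivative K * weight1 b \<gamma> x) (at x)"
      "((\<lambda>x. K * weight1 b \<gamma> x) has_field_derivative K * weight2 b \<gamma> x) (at x)"
      "((\<lambda>x. m + K * ((x - y)\<^sup>2 * weight b \<gamma> x)) has_field_derivative K * k1 x) (at x)"
      "((\<lambda>x. K * k1 x) has_field_derivative K * k2 x) (at x)" if "x \<in> {-b<..<b}" for x
    proof -
      note w = has_derivative_weight[OF that] has_derivative_weighted_square[OF that, of y \<gamma>, folded k1_def k2_def]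
      show "((\<lambda>x. K * weight b \<gamma> x) has_field_derivative K * weight1 b \<gamma> x) (at x)"
        "((\<lambda>x. K * weight1 b \<gamma> x) has_field_derivative K * weight2 b \<gamma> x) (at x)"
        "((\<lambda>x. K * k1 x) has_field_derivative K * k2 x) (at x)"
        using w(1,2,4) by (intro DERIV_cmult; simp add: k1_def k2_def)+
      have "((\<lambda>x. K * ((x - y)\<^sup>2 * weight b \<gamma> x)) has_field_derivative K * k1 x) (at x)"
        using w(3) by (intro DERIV_cmult) (simp add: k1_def)
      from DERIV_add[OF DERIV_const[of m] this]
      show "((\<lambda>x. m + K * ((x - y)\<^sup>2 * weight b \<gamma> x)) has_field_derivative K * k1 x) (at x)" by simp
    qed
    have E: "((\<lambda>t. exp (\<Lambda> * t) - 1) has_field_derivative \<Lambda> * exp (\<Lambda> * t)) (at t)"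
      "((\<lambda>t. \<Lambda> * exp (\<Lambda> * t)) has_field_derivative \<Lambda>\<^sup>2 * exp (\<Lambda> * t)) (at t)"
      "((\<lambda>t. H0 * (exp (\<omega> * t) - 1)) has_field_derivative H0 * \<omega> * exp (\<omega> * t)) (at t)"
      "((\<lambda>t. H0 * \<omega> * exp (\<omega> * t)) has_field_derivative H0 * \<omega>\<^sup>2 * exp (\<omega> * t)) (at t)" for t
      by (auto intro!: derivative_eq_intros simp: power2_eq_square)
    have cont: "continuous_on {-b<..<b} (\<lambda>x. K * weight2 b \<gamma> x)" "continuous_on {-b<..<b} (\<lambda>x. K * k2 x)"
      "continuous_on {0<..} (\<lambda>t. \<Lambda>\<^sup>2 * exp (\<Lambda> * t))" "continuous_on {0<..} (\<lambda>t. H0 * \<omega>\<^sup>2 * exp (\<omega> * t))"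
      unfolding k2_def by (intro continuous_intros continuous_on_weight)+
    note \<Phi>C2 = C2_on_separable[of b, OF D(1,2) cont(1) D(3,4) cont(2) E(1,2) cont(3) E(3,4) cont(4), folded \<Phi>_def]
    have wcont: "continuous_on (Q0 b) (\<lambda>z. weight b \<gamma> (fst z))"
      by (rule continuous_on_compose2[OF continuous_on_weight(1)]) (auto simp: Q0_def intro: continuous_intros)
    have "continuous_on (Q0 b) \<Phi>"
      unfolding \<Phi>_def by (intro continuous_intros wcont)
    moreover have "m + K * ((x - y)\<^sup>2 * weight b \<gamma> x) \<le> \<Phi> (x, t)" if "(x, t) \<in> Q0 b" for x t
    proof -
      have "t \<ge> 0" using that by (simp add: Q0_def)
      then have "K * weight b \<gamma> x * (exp (\<Lambda> * t) - 1) \<ge> 0" "H0 * (exp (\<omega> * t) - 1) \<ge> 0"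
        using K1 H0 \<Lambda> \<omega> by (auto simp: weight_def)
      then show ?thesis by (simp add: \<Phi>_def)
    qed
    moreover have "\<Phi> (y, 0) = m" by (simp add: \<Phi>_def)
    moreover have "residual f g \<Phi> z > 0" if z: "z \<in> Q b" for z
    proof -
      obtain x t where [simp]: "z = (x, t)" by (cases z)
      have x: "x \<in> {-b<..<b}" and t: "t > 0" using z by (auto simp: Q_def)
      define B where "B = exp (\<Lambda> * t) - 1"
      have B: "B \<ge> 0" "exp (\<Lambda> * t) = 1 + B" using \<Lambda> t by (auto simp: B_def)
      define d where "d = b\<^sup>2 - x\<^sup>2"
      have d: "0 < d" "d \<le> b\<^sup>2" using gap_pos[OF x] by (auto simp: d_def)
      define p where "p = K * weight1 b \<gamma> x * B + K * k1 x"
      define s where "s = K * weight2 b \<gamma> x * B + K * k2 x"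
      define X where "X = K * (1 + B) * d powr (- \<gamma> - 1)"
      have dd: "d powr (- \<gamma> - 2) = d powr (- \<gamma> - 1) / d"
      proof -
        have "(- \<gamma> - 1) - 1 = - \<gamma> - 2" by simp
        then show ?thesis using powr_diff[of d "- \<gamma> - 1" 1] d(1) by (metis powr_one less_imp_le)
      qed
      have res: "residual f g \<Phi> z = K * weight b \<gamma> x * (\<Lambda> * exp (\<Lambda> * t)) + H0 * \<omega> * exp (\<omega> * t) - f (g p * s)"
        unfolding residual_def F_def using \<Phi>C2(2-4)[of x t] z by (simp add: p_def s_def B_def)
      have lin: "\<bar>K * u * B + K * v\<bar> \<le> C1 * (K * (1 + B) * e)" if "\<bar>u\<bar> \<le> C1 * e" "\<bar>v\<bar> \<le> C1 * e" for u v e :: real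
      proof -
        have "\<bar>K * u * B + K * v\<bar> \<le> K * \<bar>u\<bar> * B + K * \<bar>v\<bar>"
          using abs_triangle_ineq[of "K * u * B" "K * v"] K1 B by (simp add: abs_mult)
        also have "\<dots> \<le> K * (C1 * e) * B + K * (C1 * e)"
          using K1 B that by (intro add_mono mult_left_mono mult_right_mono) auto
        finally show ?thesis by (simp add: algebra_simps)
      qed
      have p_up: "\<bar>p\<bar> \<le> C1 * X"
        unfolding p_def X_def d_def k1_def by (rule lin) (use C1(2,4)[OF x] in auto)
      have "\<bar>s\<bar> \<le> C1 * (K * (1 + B) * d powr (- \<gamma> - 2))"
        unfolding s_def d_def k2_def by (rule lin) (use C1(3,5)[OF x] in auto)
      then have s_up: "\<bar>s\<bar> \<le> C1 * X / d" unfolding X_def dd by simp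
      show ?thesis
      proof (cases "b - \<eta> \<le> \<bar>x\<bar>")
        case True
        have "c2 * (1 + B) * d powr (- \<gamma> - 1) \<le> \<bar>k1 x + B * weight1 b \<gamma> x\<bar>"
          unfolding c2_def k1_def d_def by (rule weight1_lower[OF b \<gamma>(1) y x \<eta>_def True B(1)])
        then have "K * (c2 * (1 + B) * d powr (- \<gamma> - 1)) \<le> K * \<bar>k1 x + B * weight1 b \<gamma> x\<bar>"
          using K1 by (intro mult_left_mono) auto
        also have "\<dots> = \<bar>p\<bar>"
        proof -
          have "p = K * (k1 x + B * weight1 b \<gamma> x)" by (simp add: p_def algebra_simps)
          then show ?thesis using K1 by (simp add: abs_mult)
        qed
        finally have p_low: "c2 * X \<le> \<bar>p\<bar>" by (simp add: X_def mult_ac)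
        have "max 1 (1 / c2) = max 1 (1 / c2) * (b\<^sup>2) powr (\<gamma> + 1) * (b\<^sup>2) powr (- \<gamma> - 1)"
          using b by (simp add: powr_add[symmetric] mult.assoc)
        also have "\<dots> \<le> K * (b\<^sup>2) powr (- \<gamma> - 1)" using K by (intro mult_right_mono) (auto simp: K1_def)
        also have "\<dots> \<le> K * d powr (- \<gamma> - 1)" using K1 d \<gamma> by (intro mult_left_mono powr_mono2') auto
        also have "\<dots> \<le> X" unfolding X_def using K1 B by (intro mult_right_mono) auto
        finally have X: "1 \<le> X" "1 / c2 \<le> X" by auto
        then have "1 \<le> c2 * X" using c2 by (simp add: field_simps)
        then have "f (g p * s) \<le> C * X powr \<theta> * d powr - \<beta>"
          unfolding \<theta>_def using X(1) d p_low p_up s_up by (intro C(2))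
        also have "X powr \<theta> = (K * (1 + B)) powr \<theta> * d powr (- \<theta> * (\<gamma> + 1))"
        proof -
          have "X powr \<theta> = (K * (1 + B)) powr \<theta> * (d powr (- \<gamma> - 1)) powr \<theta>"
            unfolding X_def by (rule powr_mult)
          moreover have "(- \<gamma> - 1) * \<theta> = - \<theta> * (\<gamma> + 1)" by (simp add: algebra_simps)
          ultimately show ?thesis by (simp only: powr_powr)
        qed
        also have "C * ((K * (1 + B)) powr \<theta> * d powr (- \<theta> * (\<gamma> + 1))) * d powr - \<beta> =
          C * (K * (1 + B)) powr \<theta> * (d powr (\<gamma> - \<theta> * (\<gamma> + 1) - \<beta>) * d powr - \<gamma>)"
        proof -
          have "- \<theta> * (\<gamma> + 1) + - \<beta> = (\<gamma> - \<theta> * (\<gamma> + 1) - \<beta>) + - \<gamma>" by simp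
          then have "d powr (- \<theta> * (\<gamma> + 1)) * d powr - \<beta> = d powr (\<gamma> - \<theta> * (\<gamma> + 1) - \<beta>) * d powr - \<gamma>"
            unfolding powr_add[symmetric] by simp
          then show ?thesis by (simp only: mult.assoc)
        qed
        \<comment> \<open>Here \<theta> < 1 enters: for a base at least 1 the power \<theta> is at
          most the first power, so \<Lambda> need not grow with \<open>K\<close> or with
          time.\<close>
        also have "\<dots> \<le> C * (K * (1 + B)) powr 1 * ((b\<^sup>2) powr (\<gamma> - \<theta> * (\<gamma> + 1) - \<beta>) * d powr - \<gamma>)"
        proof -
          have "1 * 1 \<le> K * (1 + B)" using K1 B by (intro mult_mono) auto
          then have "(K * (1 + B)) powr \<theta> \<le> (K * (1 + B)) powr 1" using \<theta>01 by (intro powr_mono) auto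
          moreover have "d powr (\<gamma> - \<theta> * (\<gamma> + 1) - \<beta>) \<le> (b\<^sup>2) powr (\<gamma> - \<theta> * (\<gamma> + 1) - \<beta>)"
            using d \<gamma>(2) by (intro powr_mono2) (auto simp: \<theta>_def)
          ultimately show ?thesis using C(1) by (intro mult_mono) auto
        qed
        also have "\<dots> = (\<Lambda> - 1) * (K * (1 + B) * weight b \<gamma> x)"
          using K1 B by (simp add: \<Lambda>_def weight_def d_def)
        also have "\<dots> \<le> \<Lambda> * (K * (1 + B) * weight b \<gamma> x)"
          using K1 B by (intro mult_right_mono) (auto simp: weight_def)
        finally have "f (g p * s) \<le> K * weight b \<gamma> x * (\<Lambda> * exp (\<Lambda> * t))"
          unfolding B(2) by (simp add: mult_ac)
        moreover have "H0 * \<omega> * exp (\<omega> * t) > 0" using H0 \<omega> by simp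
        ultimately show ?thesis unfolding res by simp
      next
        case False
        then have "x\<^sup>2 \<le> (b - \<eta>)\<^sup>2" using power_mono[of "\<bar>x\<bar>" "b - \<eta>" 2] by simp
        then have "d0 \<le> d" by (simp add: d0_def d_def)
        then have "d powr (- \<gamma> - 1) \<le> d0 powr (- \<gamma> - 1)" "d powr (- \<gamma> - 2) \<le> d0 powr (- \<gamma> - 2)"
          using d0 \<gamma> by (auto intro!: powr_mono2')
        then have dle: "d powr (- \<gamma> - 1) \<le> d0 powr (- \<gamma> - 1) + d0 powr (- \<gamma> - 2)"
          "d powr (- \<gamma> - 2) \<le> d0 powr (- \<gamma> - 1) + d0 powr (- \<gamma> - 2)"
          by (auto intro: add_increasing add_increasing2)
        have R: "C1 * (K * (1 + B) * e) \<le> R0 * exp (\<Lambda> * t)" if "e \<le> d0 powr (- \<gamma> - 1) + d0 powr (- \<gamma> - 2)" for e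
        proof -
          have "C1 * (K * (1 + B) * e) = (C1 * K * e) * (1 + B)" by simp
          also have "\<dots> \<le> R0 * (1 + B)"
          proof (rule mult_right_mono)
            have "C1 * K * e \<le> C1 * K * (d0 powr (- \<gamma> - 1) + d0 powr (- \<gamma> - 2))"
              using that C1(1) K1 by (intro mult_left_mono) auto
            then show "C1 * K * e \<le> R0" by (simp add: R0_def)
          qed (use B in simp)
          finally show ?thesis using B by simp
        qed
        have "1 * 1 \<le> R0 * exp (\<Lambda> * t)" using R0 B by (intro mult_mono) auto
        moreover have "\<bar>p\<bar> \<le> R0 * exp (\<Lambda> * t)" using p_up R[OF dle(1)] unfolding X_def by linarith
        moreover have "\<bar>s\<bar> \<le> R0 * exp (\<Lambda> * t)" using \<open>\<bar>s\<bar> \<le> C1 * (K * (1 + B) * d powr (- \<gamma> - 2))\<close> R[OF dle(2)] by linarith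
        ultimately have "f (g p * s) \<le> A * (R0 * exp (\<Lambda> * t)) powr q" by (intro A(3)) auto
        also have "\<dots> = A * R0 powr q * exp (q * \<Lambda> * t)"
          using R0 by (simp add: powr_mult exp_powr_real mult_ac)
        also have "\<dots> < H0 * exp (q * \<Lambda> * t)" by (simp add: H0_def)
        also have "\<dots> \<le> H0 * \<omega> * exp (\<omega> * t)"
        proof -
          have "H0 * 1 * exp (q * \<Lambda> * t) \<le> H0 * \<omega> * exp (\<omega> * t)"
            using H0 \<omega> t by (intro mult_mono) (auto simp: \<omega>_def algebra_simps)
          then show ?thesis by simp
        qed
        finally have "f (g p * s) < H0 * \<omega> * exp (\<omega> * t)" .
        moreover have "K * weight b \<gamma> x * (\<Lambda> * exp (\<Lambda> * t)) \<ge> 0" using K1 \<Lambda> by (simp add: weight_def)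
        ultimately show ?thesis unfolding res by simp
      qed
    qed
    ultimately show "\<exists>\<Phi>. C2_on (Q b) \<Phi> \<and> continuous_on (Q0 b) \<Phi> \<and> (\<forall>z\<in>Q b. residual f g \<Phi> z > 0) \<and>
      (\<forall>x t. (x, t) \<in> Q0 b \<longrightarrow> m + K * ((x - y)\<^sup>2 * weight b \<gamma> x) \<le> \<Phi> (x, t)) \<and> \<Phi> (y, 0) = m"
      using \<Phi>C2(1) by (intro exI[of _ \<Phi>] conjI allI impI ballI) auto
  qed
qed

subsection \<open>Existence\<close>

lemma weighted_square_at_boundary:
  fixes b \<gamma> K m N y :: real
  assumes b: "b > 0" and \<gamma>: "\<gamma> > 0" and y: "y \<in> {-b<..<b}" and K: "K > 0"
  shows "\<exists>\<delta>>0. \<forall>x\<in>{-b<..<b}. b - \<delta> < \<bar>x\<bar> \<longrightarrow> N \<le> m + K * ((x - y)\<^sup>2 * weight b \<gamma> x)"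
proof -
  define \<eta> where "\<eta> = (b - \<bar>y\<bar>) / 2"
  have \<eta>: "0 < \<eta>" "\<bar>y\<bar> = b - 2 * \<eta>" using y by (auto simp: \<eta>_def field_simps)
  define N' where "N' = (\<bar>N - m\<bar> + 1) / (K * \<eta>\<^sup>2)"
  have N': "N' > 0" using K \<eta> by (simp add: N'_def)
  \<comment> \<open>Within \<delta> of an end the gap is at most \<open>2 * b * \<delta>\<close>,
    hence the weight is at least \<open>N'\<close>, and \<open>x\<close> keeps the distance \<eta>
    from \<open>y\<close>.\<close>
  define \<delta> where "\<delta> = min \<eta> (N' powr (- 1 / \<gamma>) / (2 * b))"
  have \<delta>: "\<delta> > 0" using \<eta> N' b by (simp add: \<delta>_def)
  have "N \<le> m + K * ((x - y)\<^sup>2 * weight b \<gamma> x)" if x: "x \<in> {-b<..<b}" "b - \<delta> < \<bar>x\<bar>" for x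
  proof -
    have "\<eta> \<le> \<bar>x - y\<bar>" using x \<eta> by (auto simp: \<delta>_def)
    then have 1: "\<eta>\<^sup>2 \<le> (x - y)\<^sup>2" using \<eta> power_mono[of \<eta> "\<bar>x - y\<bar>" 2] by simp
    have "b\<^sup>2 - x\<^sup>2 = (b - \<bar>x\<bar>) * (b + \<bar>x\<bar>)" by (simp add: power2_eq_square algebra_simps)
    also have "\<dots> \<le> \<delta> * (2 * b)" using x \<delta> by (intro mult_mono) auto
    also have "\<dots> \<le> N' powr (- 1 / \<gamma>)" using b by (simp add: \<delta>_def min_def field_simps)
    finally have "b\<^sup>2 - x\<^sup>2 \<le> N' powr (- 1 / \<gamma>)" .
    then have "(N' powr (- 1 / \<gamma>)) powr - \<gamma> \<le> weight b \<gamma> x"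
      unfolding weight_def using gap_pos[OF x(1)] \<gamma> by (intro powr_mono2') auto
    then have 2: "N' \<le> weight b \<gamma> x" using N' \<gamma> by (simp add: powr_powr)
    have "\<bar>N - m\<bar> + 1 = K * (\<eta>\<^sup>2 * N')" using K \<eta> by (simp add: N'_def)
    also have "\<dots> \<le> K * ((x - y)\<^sup>2 * weight b \<gamma> x)" using K 1 2 N' by (intro mult_left_mono mult_mono) auto
    finally show ?thesis by linarith
  qed
  with \<delta> show ?thesis by blast
qed

text \<open>\<Psi> is bounded on the closed rectangle up to time \<open>t + 1\<close>, whereas
  \<Phi> exceeds that bound near the ends uniformly in time. The order on the lateral edges of a
  slightly narrower box is then automatic.\<close>

lemma (in power_growth) classical_comparison:
  fixes \<Phi> \<Psi> :: "real \<times> real \<Rightarrow> real"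
  assumes b: "b > 0" and \<Phi>: "continuous_on (Q0 b) \<Phi>" "C2_on (Q b) \<Phi>" "\<And>z. z \<in> Q b \<Longrightarrow> residual f g \<Phi> z > 0"
    and \<Psi>: "continuous_on UNIV \<Psi>" "C2_on (Q b) \<Psi>" "\<And>z. z \<in> Q b \<Longrightarrow> residual f g \<Psi> z < 0"
    and init: "\<And>x. x \<in> {-b<..<b} \<Longrightarrow> \<Psi> (x, 0) \<le> \<Phi> (x, 0)"
    and blowup: "\<And>N. \<exists>\<delta>>0. \<forall>(x, t)\<in>Q0 b. b - \<delta> < \<bar>x\<bar> \<longrightarrow> N \<le> \<Phi> (x, t)"
    and z: "z \<in> Q0 b"
  shows "\<Psi> z \<le> \<Phi> z"
proof -
  obtain x t where [simp]: "z = (x, t)" by (cases z)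
  have xt: "\<bar>x\<bar> < b" "t \<ge> 0" using z by (auto simp: Q0_def)
  have "compact (\<Psi> ` ({-b..b} \<times> {0..t + 1}))"
    by (intro compact_continuous_image compact_Times continuous_on_subset[OF \<Psi>(1)]) auto
  then obtain N where N: "\<And>w. w \<in> {-b..b} \<times> {0..t + 1} \<Longrightarrow> \<bar>\<Psi> w\<bar> \<le> N"
    by (meson bounded_real compact_imp_bounded imageI)
  obtain \<delta> where \<delta>: "\<delta> > 0" "\<And>x t. (x, t) \<in> Q0 b \<Longrightarrow> b - \<delta> < \<bar>x\<bar> \<Longrightarrow> N \<le> \<Phi> (x, t)"
    using blowup[of N] by blast
  define \<xi> where "\<xi> = max ((\<bar>x\<bar> + b) / 2) (b - \<delta> / 2)"
  have \<xi>: "\<bar>x\<bar> < \<xi>" "\<xi> < b" "b - \<delta> < \<xi>" using xt \<delta>(1) by (simp_all add: \<xi>_def less_max_iff_disj)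
  have sub: "sub_solution b f g \<Psi>"
    using \<Psi>(3) by (intro classical_sub_solution f_mono g_pos \<Psi>(2) continuous_on_subset[OF \<Psi>(1)])
      (auto intro: less_imp_le)
  have edge: "\<Psi> (v, s) \<le> \<Phi> (v, s)" if "\<bar>v\<bar> = \<xi>" "0 \<le> s" "s < t + 1" for v s
  proof -
    have "(v, s) \<in> Q0 b" "(v, s) \<in> {-b..b} \<times> {0..t + 1}" using that \<xi> by (auto simp: Q0_def)
    then show ?thesis using \<delta>(2)[of v s] N[of "(v, s)"] that \<xi> by linarith
  qed
  have "\<Psi> (x, t) \<le> \<Phi> (x, t)"
  proof (rule sub_solution_le_box[OF sub \<Phi>(2,1), of "- \<xi>" \<xi> 0 "t + 1"])
    show "residual f g \<Phi> (v, s) > 0" if "- \<xi> < v" "v < \<xi>" "0 < s" "s < t + 1" for v s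
      using that \<xi> by (intro \<Phi>(3)) (auto simp: Q_def)
    show "\<Psi> (v, 0) \<le> \<Phi> (v, 0)" if "- \<xi> \<le> v" "v \<le> \<xi>" for v using that \<xi> by (intro init) auto
  qed (use \<xi> xt edge in auto)
  then show ?thesis by simp
qed

theorem (in power_growth) exists_viscosity_solution:
  fixes b \<gamma>0 M m0 :: real and u0 :: "real \<Rightarrow> real"
  assumes b: "b > 0" and \<theta>: "\<beta> * (1 - \<alpha>) < 1"
    and cont: "continuous_on {-b<..<b} u0" and lower: "\<And>x. x \<in> {-b<..<b} \<Longrightarrow> m0 \<le> u0 x"
    and upper: "\<gamma>0 > 0" "\<And>x. x \<in> {-b<..<b} \<Longrightarrow> u0 x \<le> M * weight b \<gamma>0 x"
  shows "\<exists>u. viscosity_solution b f g u0 u"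
proof -
  define \<theta> where "\<theta> = \<beta> * (1 - \<alpha>)"
  have \<theta>01: "0 \<le> \<theta>" "\<theta> < 1" using \<theta> \<beta>_pos \<alpha>_le by (auto simp: \<theta>_def)
  \<comment> \<open>The first entry covers the growth of the initial data; the second solves
    \<theta> \<open>* (\<gamma> + 1)\<close> + \<beta> \<le> \<gamma>, which is possible as \<theta>
    < 1.\<close>
  define \<gamma> where "\<gamma> = max \<gamma>0 ((\<theta> + \<beta>) / (1 - \<theta>))"
  have \<gamma>: "\<gamma> > 0" "\<gamma>0 \<le> \<gamma>" "\<beta> * (1 - \<alpha>) * (\<gamma> + 1) + \<beta> \<le> \<gamma>"
  proof -
    have "(\<theta> + \<beta>) / (1 - \<theta>) \<le> \<gamma>" by (simp add: \<gamma>_def)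
    then have "\<theta> + \<beta> \<le> \<gamma> * (1 - \<theta>)" using \<theta>01 by (simp add: pos_divide_le_eq)
    then show "\<beta> * (1 - \<alpha>) * (\<gamma> + 1) + \<beta> \<le> \<gamma>" unfolding \<theta>_def[symmetric] by (simp add: algebra_simps)
  qed (use upper in \<open>auto simp: \<gamma>_def\<close>)
  have weight_ge: "(b\<^sup>2) powr - \<gamma> \<le> weight b \<gamma> x" if "x \<in> {-b<..<b}" for x
    unfolding weight_def using gap_pos[OF that] \<gamma> by (intro powr_mono2') auto
  define M' where "M' = \<bar>M\<bar> * (b\<^sup>2) powr (\<gamma> - \<gamma>0)"
  have M': "M' \<ge> 0" by (simp add: M'_def)
  have upper': "u0 x \<le> M' * weight b \<gamma> x" if x: "x \<in> {-b<..<b}" for x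
  proof -
    have w: "weight b \<gamma>0 x = (b\<^sup>2 - x\<^sup>2) powr (\<gamma> - \<gamma>0) * weight b \<gamma> x"
      by (simp add: weight_def powr_add[symmetric])
    have "M * weight b \<gamma>0 x \<le> \<bar>M\<bar> * weight b \<gamma>0 x" by (intro mult_right_mono) (auto simp: weight_def)
    also have "\<dots> \<le> \<bar>M\<bar> * ((b\<^sup>2) powr (\<gamma> - \<gamma>0) * weight b \<gamma> x)"
      unfolding w using gap_pos[OF x] \<gamma> by (intro mult_left_mono mult_right_mono powr_mono2) (auto simp: weight_def)
    finally show ?thesis using upper(2)[OF x] by (simp add: M'_def mult_ac)
  qed
  \<comment> \<open>The two families consist of all strict classical functions on the right side of
    the initial data, so the ordering between them follows from one comparison, whatever barrier a
    member comes from.\<close>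
  define \<Phi>s where "\<Phi>s = {\<Phi>. continuous_on (Q0 b) \<Phi> \<and> C2_on (Q b) \<Phi> \<and> (\<forall>z\<in>Q b. residual f g \<Phi> z > 0) \<and>
     (\<forall>x\<in>{-b<..<b}. u0 x \<le> \<Phi> (x, 0)) \<and> (\<forall>N. \<exists>\<delta>>0. \<forall>(x, t)\<in>Q0 b. b - \<delta> < \<bar>x\<bar> \<longrightarrow> N \<le> \<Phi> (x, t))}"
  define \<Psi>s where "\<Psi>s = {\<Psi>. continuous_on UNIV \<Psi> \<and> C2_on (Q b) \<Psi> \<and> (\<forall>z\<in>Q b. residual f g \<Psi> z < 0) \<and>
     (\<forall>x\<in>{-b<..<b}. \<Psi> (x, 0) \<le> u0 x)}"
  have near: "\<exists>r>0. \<forall>x\<in>{-b<..<b}. \<bar>x - y\<bar> < r \<longrightarrow> \<bar>u0 x - u0 y\<bar> < e" if "y \<in> {-b<..<b}" "e > 0" for y e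
    using cont[unfolded continuous_on_iff, rule_format, OF that] by (auto simp: dist_real_def)
  have initial1: "\<exists>\<Phi>\<in>\<Phi>s. \<Phi> (y, 0) \<le> u0 y + e" if y: "y \<in> {-b<..<b}" and e: "e > 0" for y e
  proof -
    obtain r where r: "r > 0" "\<And>x. x \<in> {-b<..<b} \<Longrightarrow> \<bar>x - y\<bar> < r \<Longrightarrow> \<bar>u0 x - u0 y\<bar> < e"
      using near[OF y e] by blast
    obtain K1 where K1: "\<And>K m. K \<ge> K1 \<Longrightarrow> \<exists>\<Phi>. C2_on (Q b) \<Phi> \<and> continuous_on (Q0 b) \<Phi> \<and> (\<forall>z\<in>Q b. residual f g \<Phi> z > 0) \<and>
      (\<forall>x t. (x, t) \<in> Q0 b \<longrightarrow> m + K * ((x - y)\<^sup>2 * weight b \<gamma> x) \<le> \<Phi> (x, t)) \<and> \<Phi> (y, 0) = m"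
      using singular_strict_super[OF b y \<theta> \<gamma>(1,3)] by blast
    \<comment> \<open>\<open>L\<close> times the weight bounds \<open>u0 x - (u0 y + e)\<close>, a
      constant being at most \<open>(b\<^sup>2) powr \<gamma>\<close> times its multiple of the
      weight. \<open>K * r\<^sup>2 \<ge> L\<close> then settles all points at distance at least
      \<open>r\<close> from \<open>y\<close>, and continuity of \<open>u0\<close> the nearer
      ones.\<close>
    define L where "L = M' + \<bar>u0 y + e\<bar> * (b\<^sup>2) powr \<gamma>"
    define K where "K = max 1 (max K1 (L / r\<^sup>2))"
    have K: "K \<ge> K1" "K > 0" "L \<le> K * r\<^sup>2" using r by (auto simp: K_def pos_divide_le_eq[symmetric])
    obtain \<Phi> where \<Phi>: "C2_on (Q b) \<Phi>" "continuous_on (Q0 b) \<Phi>" "\<forall>z\<in>Q b. residual f g \<Phi> z > 0"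
      "\<And>x t. (x, t) \<in> Q0 b \<Longrightarrow> (u0 y + e) + K * ((x - y)\<^sup>2 * weight b \<gamma> x) \<le> \<Phi> (x, t)" "\<Phi> (y, 0) = u0 y + e"
      using K1[OF K(1), of "u0 y + e"] by blast
    have "u0 x \<le> \<Phi> (x, 0)" if x: "x \<in> {-b<..<b}" for x
    proof -
      have w: "weight b \<gamma> x \<ge> 0" by (simp add: weight_def)
      have "u0 x \<le> (u0 y + e) + K * ((x - y)\<^sup>2 * weight b \<gamma> x)"
      proof (cases "\<bar>x - y\<bar> < r")
        case True
        have "K * ((x - y)\<^sup>2 * weight b \<gamma> x) \<ge> 0" using K w by simp
        then show ?thesis using r(2)[OF x True] by linarith
      next
        case False
        have "1 = (b\<^sup>2) powr \<gamma> * (b\<^sup>2) powr - \<gamma>" using b by (simp add: powr_add[symmetric])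
        also have "\<dots> \<le> (b\<^sup>2) powr \<gamma> * weight b \<gamma> x" using weight_ge[OF x] by (intro mult_left_mono) auto
        finally have "\<bar>u0 y + e\<bar> * 1 \<le> \<bar>u0 y + e\<bar> * ((b\<^sup>2) powr \<gamma> * weight b \<gamma> x)" by (intro mult_left_mono) auto
        then have "u0 x - (u0 y + e) \<le> L * weight b \<gamma> x"
          using upper'[OF x] abs_ge_minus_self[of "u0 y + e"]
          unfolding L_def distrib_right mult.assoc mult_1_right by linarith
        also have "\<dots> \<le> K * r\<^sup>2 * weight b \<gamma> x" using K w by (intro mult_right_mono) auto
        also have "\<dots> \<le> K * (x - y)\<^sup>2 * weight b \<gamma> x"
          using False r K w power_mono[of r "\<bar>x - y\<bar>" 2] by (intro mult_right_mono mult_left_mono) auto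
        finally show ?thesis by (simp add: mult.assoc)
      qed
      also have "\<dots> \<le> \<Phi> (x, 0)" using x by (intro \<Phi>(4)) (simp add: Q0_def)
      finally show ?thesis .
    qed
    moreover have "\<exists>\<delta>>0. \<forall>(x, t)\<in>Q0 b. b - \<delta> < \<bar>x\<bar> \<longrightarrow> N \<le> \<Phi> (x, t)" for N
    proof -
      obtain \<delta> where \<delta>: "\<delta> > 0" "\<And>x. x \<in> {-b<..<b} \<Longrightarrow> b - \<delta> < \<bar>x\<bar> \<Longrightarrow> N \<le> (u0 y + e) + K * ((x - y)\<^sup>2 * weight b \<gamma> x)"
        using weighted_square_at_boundary[OF b \<gamma>(1) y K(2), of N "u0 y + e"] by blast
      have "N \<le> \<Phi> (x, t)" if "(x, t) \<in> Q0 b" "b - \<delta> < \<bar>x\<bar>" for x t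
        using \<delta>(2)[of x] \<Phi>(4)[OF that(1)] that by (auto simp: Q0_def)
      then show ?thesis using \<delta>(1) by blast
    qed
    ultimately show ?thesis using \<Phi> by (intro bexI[of _ \<Phi>]) (auto simp: \<Phi>s_def)
  qed
  have initial2: "\<exists>\<Psi>\<in>\<Psi>s. u0 y - e \<le> \<Psi> (y, 0)" if y: "y \<in> {-b<..<b}" and e: "e > 0" for y e
  proof -
    obtain r where r: "r > 0" "\<And>x. x \<in> {-b<..<b} \<Longrightarrow> \<bar>x - y\<bar> < r \<Longrightarrow> \<bar>u0 x - u0 y\<bar> < e"
      using near[OF y e] by blast
    \<comment> \<open>At distance \<open>r\<close> from \<open>y\<close> the paraboloid has fallen
      to the lower bound \<open>m0\<close> of the data.\<close>
    define K where "K = (u0 y - m0) / r\<^sup>2"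
    have K: "K \<ge> 0" "K * r\<^sup>2 = u0 y - m0" using r lower[OF y] by (auto simp: K_def)
    obtain \<Lambda> where \<Lambda>: "\<And>z m s. z \<in> Q b \<Longrightarrow> residual f g (\<lambda>z. (m - K * (fst z - y)\<^sup>2) + - \<Lambda> * (snd z - s)) z < 0"
      using paraboloid_strict_sub[of b K y] by auto
    define \<Psi> where "\<Psi> = (\<lambda>z. (u0 y - e - K * (fst z - y)\<^sup>2) + - \<Lambda> * (snd z - 0))"
    have "\<Psi> (x, 0) \<le> u0 x" if x: "x \<in> {-b<..<b}" for x
    proof (cases "\<bar>x - y\<bar> < r")
      case True
      have "K * (x - y)\<^sup>2 \<ge> 0" using K by simp
      then show ?thesis using r(2)[OF x True] by (simp add: \<Psi>_def)
    next
      case False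
      then have "K * r\<^sup>2 \<le> K * (x - y)\<^sup>2" using r K power_mono[of r "\<bar>x - y\<bar>" 2] by (intro mult_left_mono) auto
      then show ?thesis using K e lower[OF x] by (simp add: \<Psi>_def)
    qed
    moreover have "\<Psi> (y, 0) = u0 y - e" by (simp add: \<Psi>_def)
    moreover have "C2_on (Q b) \<Psi>" unfolding \<Psi>_def by (rule paraboloid(1))
    moreover have "continuous_on UNIV \<Psi>" unfolding \<Psi>_def by (rule paraboloid(2))
    moreover have "residual f g \<Psi> z < 0" if "z \<in> Q b" for z unfolding \<Psi>_def using that by (rule \<Lambda>)
    ultimately show ?thesis by (intro bexI[of _ \<Psi>]) (simp_all add: \<Psi>s_def)
  qed
  have wave: "\<exists>\<Psi>\<in>\<Psi>s. \<forall>\<^sub>F x in at (\<sigma> * b) within S. N \<le> \<Psi> (x, t)" if t: "t > 0" and \<sigma>: "\<bar>\<sigma>\<bar> = 1" for t N \<sigma> :: real and S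
  proof -
    \<comment> \<open>The wave then takes the value \<open>N + 1\<close> at the end \<sigma>
      \<open>b\<close> at time \<open>t\<close>.\<close>
    define c where "c = (N + 1 - m0) / t"
    obtain A \<mu> where A: "A > 0" "\<mu> > 0"
      "C2_on (Q b) (\<lambda>z. A * (exp (\<mu> * \<sigma> * fst z) - exp (\<mu> * b)) + (m0 + c * snd z))"
      "\<And>z. z \<in> Q b \<Longrightarrow> residual f g (\<lambda>z. A * (exp (\<mu> * \<sigma> * fst z) - exp (\<mu> * b)) + (m0 + c * snd z)) z < 0"
      using exponential_strict_sub[OF b \<sigma>] by blast
    define \<Psi> where "\<Psi> = (\<lambda>z. A * (exp (\<mu> * \<sigma> * fst z) - exp (\<mu> * b)) + (m0 + c * snd z))"
    have c: "continuous_on UNIV \<Psi>" unfolding \<Psi>_def by (intro continuous_intros)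
    have "\<Psi> (x, 0) \<le> u0 x" if x: "x \<in> {-b<..<b}" for x
    proof -
      have "\<sigma> * x \<le> b" using x \<sigma> by (auto simp: abs_if split: if_splits)
      then have "\<mu> * \<sigma> * x \<le> \<mu> * b" using A(2) by (simp add: mult.assoc)
      then have "A * (exp (\<mu> * \<sigma> * x) - exp (\<mu> * b)) \<le> 0" using A(1) by (simp add: mult_nonneg_nonpos)
      then show ?thesis using lower[OF x] by (simp add: \<Psi>_def)
    qed
    then have "\<Psi> \<in> \<Psi>s" using A(3,4) c by (auto simp: \<Psi>s_def \<Psi>_def)
    moreover have "\<forall>\<^sub>F x in at (\<sigma> * b) within S. N \<le> \<Psi> (x, t)"
    proof -
      have "((\<lambda>x. \<Psi> (x, t)) \<longlongrightarrow> \<Psi> (\<sigma> * b, t)) (at (\<sigma> * b) within S)"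
        unfolding \<Psi>_def by (intro tendsto_intros)
      moreover have "\<Psi> (\<sigma> * b, t) > N"
      proof -
        have "\<sigma> * \<sigma> = 1" using \<sigma> by (metis abs_mult_self_eq mult_1)
        then have "\<mu> * \<sigma> * (\<sigma> * b) = \<mu> * b" by (metis mult.assoc mult_1)
        from arg_cong[OF this, of exp] have "\<Psi> (\<sigma> * b, t) = N + 1" using t unfolding \<Psi>_def by (simp add: c_def)
        then show ?thesis by simp
      qed
      ultimately have "\<forall>\<^sub>F x in at (\<sigma> * b) within S. N < \<Psi> (x, t)" by (rule order_tendstoD)
      then show ?thesis by eventually_elim simp
    qed
    ultimately show ?thesis by blast
  qed
  show ?thesis
  proof (rule perron[OF f_cont f_mono g_cont g_pos, of \<Phi>s b \<Psi>s u0])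
    show "\<Phi>s \<noteq> {}" using initial1[of 0 1] b by auto
    show "\<And>\<Phi>. \<Phi> \<in> \<Phi>s \<Longrightarrow> continuous_on (Q0 b) \<Phi>" "\<And>\<Phi>. \<Phi> \<in> \<Phi>s \<Longrightarrow> C2_on (Q b) \<Phi>"
      "\<And>\<Phi> z. \<Phi> \<in> \<Phi>s \<Longrightarrow> z \<in> Q b \<Longrightarrow> residual f g \<Phi> z > 0"
      by (auto simp: \<Phi>s_def)
    show "continuous_on (Q0 b) \<Psi>" "sub_solution b f g \<Psi>" if "\<Psi> \<in> \<Psi>s" for \<Psi>
    proof -
      show "continuous_on (Q0 b) \<Psi>" using that continuous_on_subset by (auto simp: \<Psi>s_def)
      with that show "sub_solution b f g \<Psi>"
        by (intro classical_sub_solution f_mono g_pos) (auto simp: \<Psi>s_def intro: less_imp_le)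
    qed
    show "\<Psi> z \<le> \<Phi> z" if "\<Psi> \<in> \<Psi>s" "\<Phi> \<in> \<Phi>s" "z \<in> Q0 b" for \<Psi> \<Phi> z
    proof (rule classical_comparison[OF b _ _ _ _ _ _ _ _ that(3)])
      fix x assume x: "x \<in> {-b<..<b}"
      have "\<Psi> (x, 0) \<le> u0 x" using that(1) x by (simp add: \<Psi>s_def)
      also have "u0 x \<le> \<Phi> (x, 0)" using that(2) x by (simp add: \<Phi>s_def)
      finally show "\<Psi> (x, 0) \<le> \<Phi> (x, 0)" .
    qed (use that(1,2) in \<open>simp_all add: \<Psi>s_def \<Phi>s_def\<close>)
    show "\<exists>\<Psi>\<in>\<Psi>s. \<forall>\<^sub>F x in at_left b. N \<le> \<Psi> (x, t)" "\<exists>\<Psi>\<in>\<Psi>s. \<forall>\<^sub>F x in at_right (- b). N \<le> \<Psi> (x, t)" if "t > 0" for t N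
      using wave[OF that, where \<sigma>=1 and S="{..<b}" and N=N] wave[OF that, where \<sigma>="-1" and S="{-b<..}" and N=N] by simp_all
  qed (use initial1 initial2 b in auto)
qed

subsection \<open>Boundary behaviour of super-solutions\<close>

text \<open>The blow-up is cut at a finite level \<open>N\<close>, uniformly for times near
  \<open>T\<close>. The slack \<gamma> makes an affine lower bound that only tends to
  \<open>N\<close> at the boundary sufficient.\<close>

definition blows_up :: "real \<Rightarrow> (real \<times> real \<Rightarrow> real) \<Rightarrow> real \<Rightarrow> real \<Rightarrow> bool"
  where "blows_up b w N T \<longleftrightarrow> (\<forall>\<gamma>>0. \<exists>\<epsilon>>0. \<forall>x\<in>{b - \<epsilon><..<b}. \<forall>t\<in>{T - \<epsilon><..<T + \<epsilon>}. N - \<gamma> \<le> w (x, t))"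

lemma blows_up_uniform:
  assumes "\<And>T. T \<in> {s..s'} \<Longrightarrow> blows_up b w N T" "\<gamma> > 0"
  shows "\<exists>\<xi>>0. \<forall>x\<in>{b - \<xi><..<b}. \<forall>t\<in>{s..s'}. N - \<gamma> \<le> w (x, t)"
proof -
  have "\<forall>T\<in>{s..s'}. \<exists>\<epsilon>>0. \<forall>x\<in>{b - \<epsilon><..<b}. \<forall>t\<in>{T - \<epsilon><..<T + \<epsilon>}. N - \<gamma> \<le> w (x, t)"
    using assms unfolding blows_up_def by simp
  from bchoice[OF this] obtain \<epsilon> where
    \<epsilon>: "\<forall>T\<in>{s..s'}. \<epsilon> T > 0 \<and> (\<forall>x\<in>{b - \<epsilon> T<..<b}. \<forall>t\<in>{T - \<epsilon> T<..<T + \<epsilon> T}. N - \<gamma> \<le> w (x, t))" ..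
  have "{s..s'} \<subseteq> (\<Union>T\<in>{s..s'}. {T - \<epsilon> T<..<T + \<epsilon> T})" using \<epsilon> by fastforce
  then obtain D where D: "D \<subseteq> {s..s'}" "finite D" "{s..s'} \<subseteq> (\<Union>T\<in>D. {T - \<epsilon> T<..<T + \<epsilon> T})"
    by (rule compactE_image[OF compact_Icc, rotated]) auto
  define \<xi> where "\<xi> = Min (insert 1 (\<epsilon> ` D))"
  have "\<xi> > 0" using D \<epsilon> by (auto simp: \<xi>_def)
  moreover have "N - \<gamma> \<le> w (x, t)" if xt: "x \<in> {b - \<xi><..<b}" "t \<in> {s..s'}" for x t
  proof -
    obtain T where T: "T \<in> D" "t \<in> {T - \<epsilon> T<..<T + \<epsilon> T}" using D(3) xt(2) by blast
    have "\<xi> \<le> \<epsilon> T" unfolding \<xi>_def using D(2) T(1) by (intro Min_le) auto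
    then have "x \<in> {b - \<epsilon> T<..<b}" using xt(1) by auto
    then show ?thesis using \<epsilon> T D(1) by blast
  qed
  ultimately show ?thesis by blast
qed

text \<open>Tube lemma: on a segment that keeps away from the ends, compactness replaces the
  neighbourhoods given by semicontinuity by one common length of time.\<close>

lemma lsc_on_segment:
  assumes lsc: "lsc_on (Q0 b) w" and seg: "- b < x1" "x2 < b" and s: "s \<ge> 0"
    and ge: "\<And>x. x1 \<le> x \<Longrightarrow> x \<le> x2 \<Longrightarrow> c < w (x, s)"
  shows "\<exists>\<sigma>>0. \<forall>x\<in>{x1..x2}. \<forall>t\<in>{s..<s + \<sigma>}. c < w (x, t)"
proof -
  have "\<exists>r>0. \<forall>y t. \<bar>y - x\<bar> < r \<longrightarrow> y \<in> {-b<..<b} \<longrightarrow> s \<le> t \<longrightarrow> t < s + r \<longrightarrow> c < w (y, t)" if x: "x \<in> {x1..x2}" for x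
  proof -
    have z: "(x, s) \<in> Q0 b" using x seg s by (auto simp: Q0_def)
    have "- w (x, s) < - c" using ge x by simp
    then obtain U where U: "open U" "(x, s) \<in> U" "\<forall>z\<in>U \<inter> Q0 b. - w z < - c"
      using usc_onD[OF lsc[unfolded lsc_on_uminus] z, of "- c"] by blast
    obtain r where r: "r > 0" "{x - r..x + r} \<times> {s - r..s + r} \<subseteq> U" using small_box_in_open[OF U(1,2)] by blast
    have "c < w (y, t)" if "\<bar>y - x\<bar> < r" "y \<in> {-b<..<b}" "s \<le> t" "t < s + r" for y t
    proof -
      have "(y, t) \<in> {x - r..x + r} \<times> {s - r..s + r}" using that r(1) by auto
      then have "(y, t) \<in> U \<inter> Q0 b" using that r(2) s by (auto simp: Q0_def)
      then show ?thesis using U(3) by auto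
    qed
    then show ?thesis using r(1) by blast
  qed
  then have "\<forall>x\<in>{x1..x2}. \<exists>r>0. \<forall>y t. \<bar>y - x\<bar> < r \<longrightarrow> y \<in> {-b<..<b} \<longrightarrow> s \<le> t \<longrightarrow> t < s + r \<longrightarrow> c < w (y, t)" by blast
  from bchoice[OF this] obtain r where
    r: "\<forall>x\<in>{x1..x2}. r x > 0 \<and> (\<forall>y t. \<bar>y - x\<bar> < r x \<longrightarrow> y \<in> {-b<..<b} \<longrightarrow> s \<le> t \<longrightarrow> t < s + r x \<longrightarrow> c < w (y, t))" ..
  have "{x1..x2} \<subseteq> (\<Union>x\<in>{x1..x2}. {x - r x<..<x + r x})" using r by fastforce
  then obtain D where D: "D \<subseteq> {x1..x2}" "finite D" "{x1..x2} \<subseteq> (\<Union>x\<in>D. {x - r x<..<x + r x})"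
    by (rule compactE_image[OF compact_Icc, rotated]) auto
  define \<sigma> where "\<sigma> = Min (insert 1 (r ` D))"
  have "\<sigma> > 0" using D r by (auto simp: \<sigma>_def)
  moreover have "c < w (y, t)" if yt: "y \<in> {x1..x2}" "t \<in> {s..<s + \<sigma>}" for y t
  proof -
    obtain x where x: "x \<in> D" "y \<in> {x - r x<..<x + r x}" using D(3) yt(1) by blast
    have "\<sigma> \<le> r x" unfolding \<sigma>_def using D(2) x(1) by (intro Min_le) auto
    then have "t < s + r x" using yt by auto
    moreover have "\<bar>y - x\<bar> < r x" using x(2) by auto
    ultimately show ?thesis using r x(1) D(1) yt seg by auto
  qed
  ultimately show ?thesis by blast
qed

lemma super_solution_lsc: "super_solution b f g w \<Longrightarrow> lsc_on (Q0 b) w"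
  by (simp add: super_solution_def)

section \<open>Lower bounds inherited from earlier times, and boundary layers\<close>

context power_growth
begin

text \<open>
  A super-solution may jump up in time, so no such bound can come from times after \<open>t\<close>.
\<close>

lemma super_solution_left_limit:
  assumes super: "super_solution b f g w" and x: "x \<in> {-b<..<b}" and t: "t > 0" and r: "r > 0"
    and ge: "\<And>s0. s0 < t \<Longrightarrow> \<exists>s. s0 < s \<and> s < t \<and> (\<forall>y\<in>{-b<..<b}. \<bar>y - x\<bar> < r \<longrightarrow> M \<le> w (y, s))"
  shows "M \<le> w (x, t)"
proof -
  define r' where "r' = min (r / 2) ((b - \<bar>x\<bar>) / 2)"
  have r': "0 < r'" "r' < r" "- b < x - r'" "x + r' < b" using x r by (auto simp: r'_def min_def field_simps)
  have "compact ({x - r'..x + r'} \<times> {t / 2..t + 1})" by (intro compact_Times) auto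
  moreover have "{x - r'..x + r'} \<times> {t / 2..t + 1} \<subseteq> Q0 b" using r' t by (intro box_subset_Q0) auto
  ultimately obtain m where m: "\<And>z. z \<in> {x - r'..x + r'} \<times> {t / 2..t + 1} \<Longrightarrow> m \<le> w z"
    using lsc_on_bounded_below lsc_on_subset[OF super_solution_lsc[OF super]] by metis
  \<comment> \<open>At distance \<open>r'\<close> from \<open>x\<close> the paraboloid is down to
    \<open>m\<close>, a lower bound for \<open>w\<close> on the box.\<close>
  define K where "K = max 0 (M - m) / r'\<^sup>2"
  have K: "K \<ge> 0" "M - m \<le> K * r'\<^sup>2" using r' by (auto simp: K_def)
  obtain \<Lambda> where \<Lambda>: "\<Lambda> > 0" "\<And>z m s. z \<in> Q b \<Longrightarrow> residual f g (\<lambda>z. (m - K * (fst z - x)\<^sup>2) + - \<Lambda> * (snd z - s)) z < 0"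
    using paraboloid_strict_sub[of b K x] by auto
  show ?thesis
  proof (rule field_le_epsilon)
    fix e :: real assume e: "e > 0"
    \<comment> \<open>Starting within \<open>e / \<Lambda>\<close> of \<open>t\<close>, the
      paraboloid sinks by at most \<open>e\<close>. Its speed \<Lambda> was fixed before
      \<open>e\<close>.\<close>
    have "max (t / 2) (t - e / \<Lambda>) < t" using t e \<Lambda>(1) by simp
    from ge[OF this] obtain s where s: "t / 2 < s" "t - e / \<Lambda> < s" "s < t" and
      ws: "\<And>y. y \<in> {-b<..<b} \<Longrightarrow> \<bar>y - x\<bar> < r \<Longrightarrow> M \<le> w (y, s)" by auto
    define \<phi> where "\<phi> = (\<lambda>z. (M - K * (fst z - x)\<^sup>2) + - \<Lambda> * (snd z - s))"
    have "\<phi> (x, t) \<le> w (x, t)"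
    proof (rule super_solution_ge_box[OF super, of \<phi> "x - r'" "x + r'" s "t + 1"])
      show "C2_on (Q b) \<phi>" "continuous_on (Q0 b) \<phi>" unfolding \<phi>_def by (rule paraboloid)+
      show "residual f g \<phi> (y, \<tau>) < 0" if "x - r' < y" "y < x + r'" "s < \<tau>" "\<tau> < t + 1" for y \<tau>
        unfolding \<phi>_def using that r' s t by (intro \<Lambda>(2)) (auto simp: Q_def)
      show "\<phi> (y, s) \<le> w (y, s)" if "x - r' \<le> y" "y \<le> x + r'" for y
      proof -
        have "M \<le> w (y, s)" using that r' by (intro ws) auto
        moreover have "K * (y - x)\<^sup>2 \<ge> 0" using K by simp
        ultimately show ?thesis by (simp add: \<phi>_def)
      qed
      have side: "\<phi> (y, \<tau>) \<le> w (y, \<tau>)" if "y = x - r' \<or> y = x + r'" "s \<le> \<tau>" "\<tau> < t + 1" for y \<tau>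
      proof -
        have "(y - x)\<^sup>2 = r'\<^sup>2" using that by auto
        then have "\<phi> (y, \<tau>) \<le> M - K * r'\<^sup>2" using \<Lambda>(1) that by (simp add: \<phi>_def)
        also have "\<dots> \<le> m" using K by simp
        also have "\<dots> \<le> w (y, \<tau>)" using that s r' by (intro m) auto
        finally show ?thesis .
      qed
      show "\<phi> (x - r', \<tau>) \<le> w (x - r', \<tau>)" "\<phi> (x + r', \<tau>) \<le> w (x + r', \<tau>)" if "s \<le> \<tau>" "\<tau> < t + 1" for \<tau>
        using side that by auto
    qed (use r' s t in auto)
    moreover have "\<Lambda> * (t - s) \<le> e" using s(2) \<Lambda>(1) by (simp add: field_simps)
    ultimately show "M \<le> w (x, t) + e" by (simp add: \<phi>_def)
  qed
qed

text \<open>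
  The next two barriers compare how fast a super-solution can lose height near the boundary and how
  fast it must regain it. Both speeds scale like \<open>\<rho>\<close> to the power \<open>- (2 - \<alpha>) * \<beta>\<close> in the distance
  \<open>\<rho>\<close> to the boundary, so their quotient is bounded.
\<close>

lemma loss_barrier:
  fixes H k b :: real
  assumes "H > 0" "k > 0"
  shows "\<exists>C>0. \<forall>\<rho> s. 0 < \<rho> \<longrightarrow> \<rho> \<le> 1 \<longrightarrow>
    C2_on (Q b) (\<lambda>z. - H * exp (2 * k / \<rho> * (fst z - b + \<rho> / 2)) + (H + - (C * \<rho> powr (- (2 - \<alpha>) * \<beta>)) * (snd z - s))) \<and>
    (\<forall>x t. (x, t) \<in> Q b \<longrightarrow> x \<le> b - \<rho> / 2 \<longrightarrow>
      residual f g (\<lambda>z. - H * exp (2 * k / \<rho> * (fst z - b + \<rho> / 2)) + (H + - (C * \<rho> powr (- (2 - \<alpha>) * \<beta>)) * (snd z - s))) (x, t) < 0)"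
proof -
  \<comment> \<open>In units of \<open>\<rho> powr (- (2 - \<alpha>))\<close>, \<open>c\<close>
    bounds the modulus of the argument of \<open>f\<close> in both regimes: one part for slopes of
    modulus at least 1, where the power law for \<open>g\<close> holds, one for smaller slopes,
    where \<open>g\<close> is at most \<open>c1\<close>.\<close>
  define c where "c = 2 * k * c1 * ((2 * k * H) powr (1 - \<alpha>) + 1) + 1"
  have c: "c \<ge> 1" using assms pos by (simp add: c_def)
  define C where "C = a1 * c powr \<beta> + 1"
  have C: "C > 0" using pos by (simp add: C_def add_nonneg_pos)
  show ?thesis
  proof (intro exI[of _ C] conjI allI impI)
    show "C > 0" by (rule C)
    fix \<rho> s :: real assume \<rho>: "0 < \<rho>" "\<rho> \<le> 1"
    define \<kappa> where "\<kappa> = 2 * k / \<rho>"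
    define \<Lambda> where "\<Lambda> = C * \<rho> powr (- (2 - \<alpha>) * \<beta>)"
    have d: "((\<lambda>x. - H * exp (\<kappa> * (x - b + \<rho> / 2))) has_field_derivative - H * \<kappa> * exp (\<kappa> * (x - b + \<rho> / 2))) (at x)"
      "((\<lambda>x. - H * \<kappa> * exp (\<kappa> * (x - b + \<rho> / 2))) has_field_derivative - H * \<kappa>\<^sup>2 * exp (\<kappa> * (x - b + \<rho> / 2))) (at x)" for x
      by (auto intro!: derivative_eq_intros simp: power2_eq_square)
    have e: "((\<lambda>t. H + - \<Lambda> * (t - s)) has_field_derivative - \<Lambda>) (at t)" "((\<lambda>_. - \<Lambda>) has_field_derivative 0) (at t)" for t
      by (auto intro!: derivative_eq_intros)
    have cont: "continuous_on {-b<..<b} (\<lambda>x. - H * \<kappa>\<^sup>2 * exp (\<kappa> * (x - b + \<rho> / 2)))" "continuous_on {0<..} (\<lambda>_::real. 0::real)"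
      by (intro continuous_intros)+
    note * = C2_on_sum[of b, OF d cont(1) e cont(2)]
    show "C2_on (Q b) (\<lambda>z. - H * exp (2 * k / \<rho> * (fst z - b + \<rho> / 2)) + (H + - (C * \<rho> powr (- (2 - \<alpha>) * \<beta>)) * (snd z - s)))"
      unfolding \<kappa>_def[symmetric] \<Lambda>_def[symmetric] by (rule *(1))
    fix x t assume Q: "(x, t) \<in> Q b" and x: "x \<le> b - \<rho> / 2"
    \<comment> \<open>Minus the slope of the layer. It is largest at the right end
      \<open>b - \<rho> / 2\<close>, where it equals \<open>2 * k * H / \<rho>\<close>.\<close>
    define P where "P = H * \<kappa> * exp (\<kappa> * (x - b + \<rho> / 2))"
    have \<kappa>: "\<kappa> > 0" using assms \<rho> by (simp add: \<kappa>_def)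
    have P: "P > 0" using assms \<kappa> by (simp add: P_def)
    have "exp (\<kappa> * (x - b + \<rho> / 2)) \<le> 1" using \<kappa> x by (simp add: mult_nonneg_nonpos)
    then have P_le: "P \<le> 2 * k * H / \<rho>" using assms \<rho> \<kappa> by (simp add: P_def \<kappa>_def divide_right_mono mult_left_le)
    have res: "residual f g (\<lambda>z. - H * exp (\<kappa> * (fst z - b + \<rho> / 2)) + (H + - \<Lambda> * (snd z - s))) (x, t) = - \<Lambda> - f (g (- P) * (- (\<kappa> * P)))"
      using *(2)[OF Q] by (simp add: P_def power2_eq_square mult_ac)
    define Y where "Y = c * \<rho> powr (- (2 - \<alpha>))"
    have \<rho>1: "1 / \<rho> \<le> \<rho> powr (- (2 - \<alpha>))"
    proof -
      have "\<rho> powr (- 1) \<le> \<rho> powr (- (2 - \<alpha>))" using \<rho> \<alpha>_le by (intro powr_mono') auto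
      then show ?thesis using \<rho> by (simp add: powr_minus_divide)
    qed
    have "1 \<le> 1 / \<rho>" using \<rho> by simp
    then have \<rho>2: "1 \<le> \<rho> powr (- (2 - \<alpha>))" using \<rho>1 by linarith
    have Y: "Y \<ge> 1" using mult_mono[OF c \<rho>2] c unfolding Y_def by simp
    have "g (- P) * (\<kappa> * P) \<le> Y"
    proof (cases "P \<ge> 1")
      case True
      have "g (- P) * (\<kappa> * P) \<le> (c1 * P powr - \<alpha>) * (\<kappa> * P)"
        using g_upper[of "- P"] True \<kappa> by (intro mult_right_mono) auto
      also have "\<dots> = c1 * \<kappa> * P powr (1 - \<alpha>)" using P by (simp add: powr_diff powr_minus field_simps)
      also have "\<dots> \<le> c1 * \<kappa> * (2 * k * H / \<rho>) powr (1 - \<alpha>)"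
        using P P_le \<kappa> pos \<alpha>_le by (intro mult_left_mono powr_mono2) auto
      also have "\<dots> = 2 * k * c1 * (2 * k * H) powr (1 - \<alpha>) * \<rho> powr (- (2 - \<alpha>))"
      proof -
        have pw: "(2 * k * H / \<rho>) powr (1 - \<alpha>) = (2 * k * H) powr (1 - \<alpha>) * \<rho> powr - (1 - \<alpha>)"
          using powr_divide[of "2 * k * H" \<rho> "1 - \<alpha>"] powr_minus_divide[of \<rho> "1 - \<alpha>"] assms \<rho> by simp
        have eq: "\<rho> powr - (1 - \<alpha>) / \<rho> = \<rho> powr (- (2 - \<alpha>))"
        proof -
          have "- (1 - \<alpha>) - 1 = - (2 - \<alpha>)" by simp
          then show ?thesis using \<rho> powr_diff[of \<rho> "- (1 - \<alpha>)" 1] by (metis less_imp_le powr_one)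
        qed
        have "c1 * \<kappa> * (2 * k * H / \<rho>) powr (1 - \<alpha>) = 2 * k * c1 * (2 * k * H) powr (1 - \<alpha>) * (\<rho> powr - (1 - \<alpha>) / \<rho>)"
          unfolding pw \<kappa>_def by simp
        then show ?thesis unfolding eq .
      qed
      also have "\<dots> \<le> Y" unfolding Y_def
        using assms pos by (intro mult_right_mono) (auto simp: c_def algebra_simps)
      finally show ?thesis .
    next
      case False
      have "g (- P) * (\<kappa> * P) \<le> c1 * (\<kappa> * 1)"
        using g_upper_small[of "- P"] P False \<kappa> pos by (intro mult_mono) auto
      also have "\<dots> = 2 * k * c1 * (1 / \<rho>)" by (simp add: \<kappa>_def)
      also have "\<dots> \<le> 2 * k * c1 * \<rho> powr (- (2 - \<alpha>))" using \<rho>1 assms pos by (intro mult_left_mono) auto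
      also have "\<dots> \<le> Y" unfolding Y_def
        using assms pos by (intro mult_right_mono) (auto simp: c_def algebra_simps)
      finally show ?thesis .
    qed
    then have "f (- Y) \<le> f (g (- P) * (- (\<kappa> * P)))" by (intro f_le) simp
    moreover have "- a1 * Y powr \<beta> \<le> f (- Y)" using Y by (rule f_lower_neg)
    moreover have "a1 * Y powr \<beta> = (C - 1) * \<rho> powr (- (2 - \<alpha>) * \<beta>)"
      using c \<rho> by (simp add: Y_def powr_mult powr_powr C_def)
    moreover have "(C - 1) * \<rho> powr (- (2 - \<alpha>) * \<beta>) < \<Lambda>" using \<rho> by (simp add: \<Lambda>_def)
    ultimately show "residual f g (\<lambda>z. - H * exp (2 * k / \<rho> * (fst z - b + \<rho> / 2)) + (H + - (C * \<rho> powr (- (2 - \<alpha>) * \<beta>)) * (snd z - s))) (x, t) < 0"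
      unfolding \<kappa>_def[symmetric] \<Lambda>_def[symmetric] res by linarith
  qed
qed

lemma gain_barrier:
  fixes D b :: real
  assumes "D > 0"
  shows "\<exists>C>0. \<exists>\<rho>0>0. \<forall>\<rho> c m s. 0 < \<rho> \<longrightarrow> \<rho> \<le> \<rho>0 \<longrightarrow> c < C \<longrightarrow>
    C2_on (Q b) (\<lambda>z. D * (exp ((b - fst z) / \<rho>) - 1) + (m + c * \<rho> powr (- (2 - \<alpha>) * \<beta>) * (snd z - s))) \<and>
    (\<forall>z\<in>Q b. residual f g (\<lambda>z. D * (exp ((b - fst z) / \<rho>) - 1) + (m + c * \<rho> powr (- (2 - \<alpha>) * \<beta>) * (snd z - s))) z < 0)"
proof -
  \<comment> \<open>The slope is at least \<open>D / \<rho>\<close> in modulus and the second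
    derivative is \<open>1 / \<rho>\<close> times as large, so the argument of \<open>f\<close> is
    at least \<open>c0 * D powr (1 - \<alpha>) * \<rho> powr (- (2 - \<alpha>))\<close>. The bound
    \<open>\<rho>0\<close> makes both the slope and this argument at least 1.\<close>
  define C where "C = a0 * (c0 * D powr (1 - \<alpha>)) powr \<beta>"
  define \<rho>0 where "\<rho>0 = min 1 (min D (c0 * D powr (1 - \<alpha>)))"
  have pos': "C > 0" "\<rho>0 > 0" using assms pos by (auto simp: C_def \<rho>0_def)
  have "C2_on (Q b) (\<lambda>z. D * (exp ((b - fst z) / \<rho>) - 1) + (m + c * \<rho> powr (- (2 - \<alpha>) * \<beta>) * (snd z - s))) \<and>
    (\<forall>z\<in>Q b. residual f g (\<lambda>z. D * (exp ((b - fst z) / \<rho>) - 1) + (m + c * \<rho> powr (- (2 - \<alpha>) * \<beta>) * (snd z - s))) z < 0)"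
    if \<rho>: "0 < \<rho>" "\<rho> \<le> \<rho>0" and c: "c < C" for \<rho> c m s
  proof -
    define \<Lambda> where "\<Lambda> = c * \<rho> powr (- (2 - \<alpha>) * \<beta>)"
    have d: "((\<lambda>x. D * (exp ((b - x) / \<rho>) - 1)) has_field_derivative - (D / \<rho> * exp ((b - x) / \<rho>))) (at x)"
      "((\<lambda>x. - (D / \<rho> * exp ((b - x) / \<rho>))) has_field_derivative D / \<rho> * exp ((b - x) / \<rho>) / \<rho>) (at x)" for x
      using \<rho> by (auto intro!: derivative_eq_intros)
    have e: "((\<lambda>t. m + \<Lambda> * (t - s)) has_field_derivative \<Lambda>) (at t)" "((\<lambda>_. \<Lambda>) has_field_derivative 0) (at t)" for t
      by (auto intro!: derivative_eq_intros)
    have cont: "continuous_on {-b<..<b} (\<lambda>x. D / \<rho> * exp ((b - x) / \<rho>) / \<rho>)" "continuous_on {0<..} (\<lambda>_::real. 0::real)"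
      using \<rho> by (intro continuous_intros; simp)+
    note * = C2_on_sum[of b, OF d cont(1) e cont(2)]
    have "residual f g (\<lambda>z. D * (exp ((b - fst z) / \<rho>) - 1) + (m + \<Lambda> * (snd z - s))) (x, t) < 0" if Q: "(x, t) \<in> Q b" for x t
    proof -
      define P where "P = D / \<rho> * exp ((b - x) / \<rho>)"
      have "(b - x) / \<rho> \<ge> 0" using Q \<rho> by (auto simp: Q_def)
      then have "D / \<rho> * 1 \<le> P" unfolding P_def using assms \<rho> by (intro mult_left_mono) auto
      moreover have "1 \<le> D / \<rho>" using \<rho> by (simp add: \<rho>0_def)
      ultimately have P: "D / \<rho> \<le> P" "1 \<le> P" by auto
      define Y where "Y = c0 * D powr (1 - \<alpha>) * \<rho> powr (- (2 - \<alpha>))"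
      have Y: "Y \<ge> 1"
      proof -
        have "\<rho> powr (- 1) \<le> \<rho> powr (- (2 - \<alpha>))" using \<rho> \<alpha>_le by (intro powr_mono') (auto simp: \<rho>0_def)
        then have "c0 * D powr (1 - \<alpha>) * (1 / \<rho>) \<le> Y"
          unfolding Y_def using pos \<rho> by (intro mult_left_mono) (auto simp: powr_minus_divide)
        moreover have "1 \<le> c0 * D powr (1 - \<alpha>) * (1 / \<rho>)" using \<rho> by (simp add: \<rho>0_def)
        ultimately show ?thesis by linarith
      qed
      have "\<rho> powr - (1 - \<alpha>) / \<rho> = \<rho> powr (- (2 - \<alpha>))"
      proof -
        have "- (1 - \<alpha>) - 1 = - (2 - \<alpha>)" by simp
        then show ?thesis using \<rho>(1) powr_diff[of \<rho> "- (1 - \<alpha>)" 1] by (metis less_imp_le powr_one)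
      qed
      moreover have "(D / \<rho>) powr (1 - \<alpha>) = D powr (1 - \<alpha>) * \<rho> powr - (1 - \<alpha>)"
        using powr_divide[of D \<rho> "1 - \<alpha>"] powr_minus_divide[of \<rho> "1 - \<alpha>"] assms \<rho> by simp
      ultimately have "Y = c0 * (D / \<rho>) powr (1 - \<alpha>) / \<rho>"
        by (metis Y_def mult.assoc times_divide_eq_right)
      also have "\<dots> \<le> c0 * P powr (1 - \<alpha>) / \<rho>"
        using P assms \<rho> pos \<alpha>_le by (intro divide_right_mono mult_left_mono powr_mono2) auto
      also have "\<dots> = (c0 * P powr - \<alpha>) * (P / \<rho>)" using P by (simp add: powr_diff powr_minus field_simps)
      also have "\<dots> \<le> g (- P) * (P / \<rho>)" using g_lower[of "- P"] P \<rho> by (intro mult_right_mono) auto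
      finally have "f Y \<le> f (g (- P) * (P / \<rho>))" by (rule f_le)
      moreover have "a0 * Y powr \<beta> \<le> f Y" using Y by (rule f_lower)
      moreover have "a0 * Y powr \<beta> = C * \<rho> powr (- (2 - \<alpha>) * \<beta>)"
        using pos \<rho> by (simp add: Y_def powr_mult powr_powr C_def mult.assoc)
      moreover have "\<Lambda> < C * \<rho> powr (- (2 - \<alpha>) * \<beta>)" using c \<rho> by (simp add: \<Lambda>_def)
      moreover have "residual f g (\<lambda>z. D * (exp ((b - fst z) / \<rho>) - 1) + (m + \<Lambda> * (snd z - s))) (x, t) = \<Lambda> - f (g (- P) * (P / \<rho>))"
        using *(2)[OF Q] by (simp add: P_def)
      ultimately show ?thesis by linarith
    qed
    then show ?thesis using *(1) unfolding \<Lambda>_def by auto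
  qed
  then show ?thesis using pos' by blast
qed

end

section \<open>Estimates at a corner and along an interval of good times\<close>

context power_growth
begin

text \<open>A concave layer that vanishes at \<open>b - \<rho> / 2\<close> and is nearly flat to the
  left of \<open>b - \<rho>\<close> lies below \<open>w\<close> and sinks slowly: distance \<rho>
  from the boundary is protected for a time of order
  \<open>\<rho> powr ((2 - \<alpha>) * \<beta>)\<close>, whatever happens at the boundary itself, as
  long as \<open>w\<close> is nonnegative.\<close>

lemma corner_loss:
  fixes \<delta> s N b :: real
  assumes super: "super_solution b f g w" and \<delta>: "0 < \<delta>" "\<delta> \<le> b" and s: "0 < s" "s < t1" and N: "N \<ge> 0"
    and nonneg: "\<And>x t. x \<in> {b - \<delta><..<b} \<Longrightarrow> t \<in> {s..<t1} \<Longrightarrow> 0 \<le> w (x, t)"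
    and start: "\<And>x. x \<in> {b - \<delta><..<b} \<Longrightarrow> N + 1 \<le> w (x, s)"
  shows "\<exists>C>0. \<exists>\<sigma>>0. \<exists>\<rho>0>0. \<forall>\<rho> t x. 0 < \<rho> \<longrightarrow> \<rho> \<le> \<rho>0 \<longrightarrow> s \<le> t \<longrightarrow> t < s + \<sigma> \<longrightarrow>
    C * \<rho> powr (- (2 - \<alpha>) * \<beta>) * (t - s) \<le> 1 / 4 \<longrightarrow> b - \<delta> / 2 \<le> x \<longrightarrow> x \<le> b - \<rho> \<longrightarrow> N + 1 / 8 \<le> w (x, t)"
proof -
  \<comment> \<open>The budget: of \<open>N + 1 / 2\<close>, the layer takes
    \<open>H * exp (- k) \<le> 1 / 8\<close> at distance \<rho> and sinking takes
    \<open>1 / 4\<close>, which leaves \<open>N + 1 / 8\<close>. The choice of \<open>k\<close> uses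
    only \<open>exp k \<ge> k\<close>.\<close>
  define H where "H = N + 1 / 2"
  have H: "H > 0" using N by (simp add: H_def)
  define k where "k = 8 * H"
  have k: "k > 0" using H by (simp add: k_def)
  have Hk: "H * exp (- k) \<le> 1 / 8"
  proof -
    have "8 * H \<le> exp k" using exp_ge_add_one_self[of k] unfolding k_def by linarith
    then show ?thesis by (simp add: exp_minus field_simps)
  qed
  obtain C where C: "C > 0" and bar: "\<And>\<rho> s. 0 < \<rho> \<Longrightarrow> \<rho> \<le> 1 \<Longrightarrow>
    C2_on (Q b) (\<lambda>z. - H * exp (2 * k / \<rho> * (fst z - b + \<rho> / 2)) + (H + - (C * \<rho> powr (- (2 - \<alpha>) * \<beta>)) * (snd z - s))) \<and>
    (\<forall>x t. (x, t) \<in> Q b \<longrightarrow> x \<le> b - \<rho> / 2 \<longrightarrow>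
      residual f g (\<lambda>z. - H * exp (2 * k / \<rho> * (fst z - b + \<rho> / 2)) + (H + - (C * \<rho> powr (- (2 - \<alpha>) * \<beta>)) * (snd z - s))) (x, t) < 0)"
    using loss_barrier[OF H k, of b] by auto
  define x1 where "x1 = b - \<delta> / 2"
  have x1: "x1 \<in> {b - \<delta><..<b}" "- b < x1" "x1 < b" using \<delta> by (auto simp: x1_def)
  have x1s: "N + 1 / 2 < w (x, s)" if "x1 \<le> x" "x \<le> x1" for x using start[OF x1(1)] that by simp
  obtain \<sigma> where \<sigma>: "\<sigma> > 0" "\<And>t. t \<in> {s..<s + \<sigma>} \<Longrightarrow> N + 1 / 2 < w (x1, t)"
    using lsc_on_segment[OF super_solution_lsc[OF super] x1(2,3) less_imp_le[OF s(1)] x1s] by auto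
  define \<sigma>' where "\<sigma>' = min \<sigma> (t1 - s)"
  have \<sigma>': "\<sigma>' > 0" "\<sigma>' \<le> \<sigma>" using \<sigma> s by (auto simp: \<sigma>'_def)
  define \<rho>0 where "\<rho>0 = min 1 (\<delta> / 2)"
  have \<rho>0: "\<rho>0 > 0" using \<delta> by (simp add: \<rho>0_def)
  have "N + 1 / 8 \<le> w (x, t)"
    if \<rho>: "0 < \<rho>" "\<rho> \<le> \<rho>0" and t: "s \<le> t" "t < s + \<sigma>'" "C * \<rho> powr (- (2 - \<alpha>) * \<beta>) * (t - s) \<le> 1 / 4"
      and x: "b - \<delta> / 2 \<le> x" "x \<le> b - \<rho>" for \<rho> t x
  proof -
    define \<Lambda> where "\<Lambda> = C * \<rho> powr (- (2 - \<alpha>) * \<beta>)"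
    have \<Lambda>: "\<Lambda> \<ge> 0" using C by (simp add: \<Lambda>_def)
    define \<phi> where "\<phi> = (\<lambda>z. - H * exp (2 * k / \<rho> * (fst z - b + \<rho> / 2)) + (H + - \<Lambda> * (snd z - s)))"
    have "\<rho> \<le> 1" using \<rho> by (simp add: \<rho>0_def)
    note bar' = bar[OF \<rho>(1) this, of s, folded \<Lambda>_def, folded \<phi>_def]
    have \<phi>_le: "\<phi> (y, \<tau>) \<le> H" if "s \<le> \<tau>" for y \<tau>
    proof -
      have "H * exp (2 * k / \<rho> * (y - b + \<rho> / 2)) \<ge> 0" "\<Lambda> * (\<tau> - s) \<ge> 0" using H \<Lambda> that by auto
      then show ?thesis by (simp add: \<phi>_def)
    qed
    have "\<phi> (x, t) \<le> w (x, t)"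
    proof (rule super_solution_ge_box[OF super, of \<phi> x1 "b - \<rho> / 2" s "s + \<sigma>'"])
      show "C2_on (Q b) \<phi>" using bar' by blast
      show "continuous_on (Q0 b) \<phi>" unfolding \<phi>_def using \<rho> by (intro continuous_intros) auto
      show "residual f g \<phi> (y, \<tau>) < 0" if "x1 < y" "y < b - \<rho> / 2" "s < \<tau>" "\<tau> < s + \<sigma>'" for y \<tau>
      proof -
        have "(y, \<tau>) \<in> Q b" using that x1 \<rho> s by (auto simp: Q_def)
        then show ?thesis using bar' that by auto
      qed
      show "\<phi> (y, s) \<le> w (y, s)" if "x1 \<le> y" "y \<le> b - \<rho> / 2" for y
        using \<phi>_le[of s y] start[of y] that \<rho> x1 N by (auto simp: H_def)
      show "\<phi> (x1, \<tau>) \<le> w (x1, \<tau>)" if "s \<le> \<tau>" "\<tau> < s + \<sigma>'" for \<tau>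
        using \<phi>_le[of \<tau> x1] \<sigma>(2)[of \<tau>] that \<sigma>'(2) by (auto simp: H_def)
      show "\<phi> (b - \<rho> / 2, \<tau>) \<le> w (b - \<rho> / 2, \<tau>)" if "s \<le> \<tau>" "\<tau> < s + \<sigma>'" for \<tau>
      proof -
        have "\<phi> (b - \<rho> / 2, \<tau>) \<le> 0" using \<Lambda> that by (simp add: \<phi>_def)
        also have "0 \<le> w (b - \<rho> / 2, \<tau>)" using that \<rho> \<delta> by (intro nonneg) (auto simp: \<sigma>'_def \<rho>0_def)
        finally show ?thesis .
      qed
    qed (use x1 \<rho> x t s in \<open>auto simp: x1_def\<close>)
    moreover have "H * exp (2 * k / \<rho> * (x - b + \<rho> / 2)) \<le> 1 / 8"
    proof -
      have "2 * k / \<rho> * (x - b + \<rho> / 2) \<le> 2 * k / \<rho> * (- \<rho> / 2)" using k \<rho> x by (intro mult_left_mono) auto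
      also have "\<dots> = - k" using \<rho> by simp
      finally have "H * exp (2 * k / \<rho> * (x - b + \<rho> / 2)) \<le> H * exp (- k)" using H by (intro mult_left_mono) auto
      then show ?thesis using Hk by linarith
    qed
    moreover have "\<Lambda> * (t - s) \<le> 1 / 4" using t(3) by (simp add: \<Lambda>_def)
    ultimately show ?thesis using H_def unfolding \<phi>_def fst_conv snd_conv mult_minus_left by linarith
  qed
  then show ?thesis using C \<sigma>'(1) \<rho>0 by blast
qed

text \<open>
  The corner \<open>(b, s)\<close> carries no information about a super-solution that is bounded below: a lower
  bound \<open>m\<close> near the corner self-improves by a fixed amount.
\<close>

lemma corner_lower_bound:
  fixes \<delta> s N b :: real
  assumes super: "super_solution b f g w" and \<delta>: "0 < \<delta>" "\<delta> \<le> b" and s: "0 < s" "s < t1" and N: "N \<ge> 0"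
    and nonneg: "\<And>x t. x \<in> {b - \<delta><..<b} \<Longrightarrow> t \<in> {s..<t1} \<Longrightarrow> 0 \<le> w (x, t)"
    and start: "\<And>x. x \<in> {b - \<delta><..<b} \<Longrightarrow> N + 1 \<le> w (x, s)"
    and bdry: "\<And>T. T \<in> {s<..<t1} \<Longrightarrow> blows_up b w N T" and \<gamma>: "\<gamma> > 0"
  shows "\<exists>\<epsilon>>0. \<forall>x\<in>{b - \<epsilon><..<b}. \<forall>t\<in>{s<..<s + \<epsilon>}. N - \<gamma> \<le> w (x, t)"
proof -
  let ?near = "\<lambda>m. \<exists>\<epsilon>>0. \<forall>x\<in>{b - \<epsilon><..<b}. \<forall>t\<in>{s<..<s + \<epsilon>}. m \<le> w (x, t)"
  define \<nu> where "\<nu> = (2 - \<alpha>) * \<beta>"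
  have \<nu>: "\<nu> > 0" using \<alpha>_le \<beta>_pos by (simp add: \<nu>_def)
  obtain C1 \<sigma> \<rho>1 where C1: "C1 > 0" and \<sigma>: "\<sigma> > 0" and \<rho>1: "\<rho>1 > 0" and
    loss: "\<And>\<rho> t x. 0 < \<rho> \<Longrightarrow> \<rho> \<le> \<rho>1 \<Longrightarrow> s \<le> t \<Longrightarrow> t < s + \<sigma> \<Longrightarrow>
    C1 * \<rho> powr - \<nu> * (t - s) \<le> 1 / 4 \<Longrightarrow> b - \<delta> / 2 \<le> x \<Longrightarrow> x \<le> b - \<rho> \<Longrightarrow> N + 1 / 8 \<le> w (x, t)"
    using corner_loss[OF super \<delta> s N nonneg start] unfolding \<nu>_def minus_mult_left by auto
  obtain C2 \<rho>2 where C2: "C2 > 0" and \<rho>2: "\<rho>2 > 0" and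
    gain: "\<And>\<rho> c m s. 0 < \<rho> \<Longrightarrow> \<rho> \<le> \<rho>2 \<Longrightarrow> c < C2 \<Longrightarrow>
    C2_on (Q b) (\<lambda>z. 1 / 32 * (exp ((b - fst z) / \<rho>) - 1) + (m + c * \<rho> powr - \<nu> * (snd z - s))) \<and>
    (\<forall>z\<in>Q b. residual f g (\<lambda>z. 1 / 32 * (exp ((b - fst z) / \<rho>) - 1) + (m + c * \<rho> powr - \<nu> * (snd z - s))) z < 0)"
    using gain_barrier[of "1 / 32" b] unfolding \<nu>_def minus_mult_left by auto
  \<comment> \<open>The second entry keeps the speed constant \<open>8 * C1 * \<kappa>\<close> below
    \<open>C2\<close>, as the gain barrier demands. The step size does not depend on
    \<open>m\<close>, so finitely many steps reach \<open>N - \<gamma>\<close>.\<close>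
  define \<kappa>0 where "\<kappa>0 = min (1 / 16) (C2 / (16 * C1))"
  have \<kappa>0: "\<kappa>0 > 0" using C1 C2 by (simp add: \<kappa>0_def)
  have step: "?near (m + \<kappa>)" if near: "?near m" and \<kappa>: "0 \<le> \<kappa>" "\<kappa> \<le> \<kappa>0" and m: "m + \<kappa> \<le> N - \<gamma>" for m \<kappa>
  proof -
    obtain \<epsilon> where \<epsilon>: "\<epsilon> > 0" "\<And>x t. x \<in> {b - \<epsilon><..<b} \<Longrightarrow> t \<in> {s<..<s + \<epsilon>} \<Longrightarrow> m \<le> w (x, t)"
      using near by blast
    \<comment> \<open>With \<rho> tied to the elapsed time \<tau> as below, the gain barrier rises
      at the rate \<open>\<kappa> / \<tau>\<close>, that is by \<kappa> during \<tau>.\<close>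
    define c where "c = 8 * C1 * \<kappa>"
    have c: "0 \<le> c" "c < C2"
    proof -
      have "\<kappa> \<le> C2 / (16 * C1)" using \<kappa>(2) by (simp add: \<kappa>0_def)
      then have "c \<le> C2 / 2" using C1 by (simp add: c_def field_simps)
      then show "c < C2" using C2 by linarith
    qed (use C1 \<kappa> in \<open>simp add: c_def\<close>)
    define \<rho>3 where "\<rho>3 = min (min \<rho>1 \<rho>2) (min (\<delta> / 2) (\<epsilon> / 2))"
    have \<rho>3: "\<rho>3 > 0" using \<rho>1 \<rho>2 \<delta> \<epsilon> by (simp add: \<rho>3_def)
    define \<tau>0 where "\<tau>0 = min (\<rho>3 powr \<nu> / (8 * C1)) (min (\<epsilon> / 2) (min (\<sigma> / 2) ((t1 - s) / 2)))"
    have \<tau>0: "\<tau>0 > 0" using \<rho>3 C1 \<epsilon> \<sigma> s by (simp add: \<tau>0_def)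
    have "m + \<kappa> \<le> w (x, t)" if x: "x \<in> {b - \<delta> / 2<..<b}" and t: "t \<in> {s<..<s + \<tau>0}" for x t
    proof -
      define \<tau> where "\<tau> = t - s"
      have "\<tau> < \<tau>0" using t by (simp add: \<tau>_def)
      then have \<tau>: "0 < \<tau>" "\<tau> < \<rho>3 powr \<nu> / (8 * C1)" "\<tau> < \<epsilon> / 2" "\<tau> < \<sigma> / 2" "\<tau> < (t1 - s) / 2" "t = s + \<tau>"
        using t unfolding \<tau>0_def min_less_iff_conj by (auto simp: \<tau>_def)
      \<comment> \<open>\<rho> is adapted to \<tau>: at this distance the loss accumulated up to
        time \<open>s + 2 * \<tau>\<close> is exactly the admissible \<open>1 / 4\<close>.\<close>
      define \<rho> where "\<rho> = (8 * C1 * \<tau>) powr (1 / \<nu>)"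
      have \<rho>\<nu>: "\<rho> powr \<nu> = 8 * C1 * \<tau>" using \<nu> C1 \<tau> by (simp add: \<rho>_def powr_powr)
      have \<rho>: "\<rho> > 0" using C1 \<tau> by (simp add: \<rho>_def)
      have "\<rho> powr \<nu> < \<rho>3 powr \<nu>" unfolding \<rho>\<nu> using \<tau>(2) C1 by (simp add: field_simps)
      then have "\<rho> < \<rho>3" using \<rho> \<rho>3 \<nu> powr_less_cancel2 by blast
      then have \<rho>_le: "\<rho> \<le> \<rho>1" "\<rho> \<le> \<rho>2" "\<rho> < \<delta> / 2" "\<rho> < \<epsilon>" using \<epsilon> by (auto simp: \<rho>3_def)
      have inv: "\<rho> powr - \<nu> = 1 / (8 * C1 * \<tau>)" by (simp add: powr_minus_divide \<rho>\<nu>)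
      have C1\<rho>: "C1 * \<rho> powr - \<nu> * \<tau>' \<le> 1 / 4" if "\<tau>' \<le> 2 * \<tau>" for \<tau>'
      proof -
        have "C1 * \<rho> powr - \<nu> * \<tau>' = \<tau>' / (8 * \<tau>)" unfolding inv using C1 by simp
        also have "\<dots> \<le> 1 / 4" using that \<tau>(1) by (simp add: pos_divide_le_eq)
        finally show ?thesis .
      qed
      have c\<rho>: "c * \<rho> powr - \<nu> = \<kappa> / \<tau>" unfolding inv c_def using C1 by simp
      show ?thesis
      proof (cases "x \<le> b - \<rho>")
        case True
        have "N + 1 / 8 \<le> w (x, t)"
          using x \<tau> \<rho> \<rho>_le True C1\<rho>[of \<tau>] by (intro loss[of \<rho>]) auto
        then show ?thesis using m \<gamma> by linarith
      next
        case False
        show ?thesis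
        proof (rule field_le_epsilon)
          fix e0 :: real assume e0: "e0 > 0"
          define e where "e = e0 / 2"
          have e: "e > 0" using e0 by (simp add: e_def)
          \<comment> \<open>Within \<open>r\<close> of the boundary the spatial part of the gain
            barrier is at most \<open>e\<close>. Farther left its larger value is covered by the
            height at time \<open>s\<close>, which semicontinuity preserves for a short
            while.\<close>
          define r where "r = min (\<rho> / 2) (\<rho> * ln (1 + e))"
          have r: "0 < r" "r < \<rho>" "exp (r / \<rho>) - 1 \<le> e"
          proof -
            show "0 < r" using \<rho> e by (simp add: r_def)
            show "r < \<rho>" using \<rho> by (simp add: r_def min_def)
            have "r / \<rho> \<le> ln (1 + e)" using \<rho> by (simp add: r_def pos_divide_le_eq mult.commute)
            then have "exp (r / \<rho>) \<le> exp (ln (1 + e))" by simp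
            then show "exp (r / \<rho>) - 1 \<le> e" using e by simp
          qed
          have seg: "- b < b - \<rho>" "b - r < b" "0 \<le> s" using \<rho>_le \<delta> r s by auto
          have "N + 1 / 2 < w (y, s)" if "b - \<rho> \<le> y" "y \<le> b - r" for y
            using start[of y] that \<rho>_le r \<delta> by auto
          from lsc_on_segment[OF super_solution_lsc[OF super] seg this] obtain \<eta>1 where
            \<eta>1: "\<eta>1 > 0" "\<And>y t. y \<in> {b - \<rho>..b - r} \<Longrightarrow> t \<in> {s..<s + \<eta>1} \<Longrightarrow> N + 1 / 2 < w (y, t)" by blast
          \<comment> \<open>Neither the bound \<open>m\<close> nor the blow-up is available at time
            \<open>s\<close> itself, so the comparison starts at \<open>s + \<eta>\<close>. The rise
            missed by the delay, \<open>\<kappa> / \<tau> * \<eta>\<close>, is at most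
            \<open>e\<close>.\<close>
          define \<eta> where "\<eta> = min (\<eta>1 / 2) (min (\<tau> / 2) (\<tau> * e / (\<kappa> + 1)))"
          have \<eta>: "0 < \<eta>" "\<eta> < \<eta>1" "\<eta> < \<tau>" "\<eta> \<le> \<tau> * e / (\<kappa> + 1)"
          proof -
            have "\<eta> \<le> \<eta>1 / 2" "\<eta> \<le> \<tau> / 2" "\<eta> \<le> \<tau> * e / (\<kappa> + 1)"
              unfolding \<eta>_def by (intro min.cobounded1 min.coboundedI2 min.cobounded2)+
            then show "\<eta> < \<eta>1" "\<eta> < \<tau>" "\<eta> \<le> \<tau> * e / (\<kappa> + 1)" using \<eta>1(1) \<tau>(1) by linarith+
            show "0 < \<eta>" using \<eta>1(1) \<tau>(1) e \<kappa> by (simp add: \<eta>_def)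
          qed
          have \<eta>e: "\<kappa> / \<tau> * \<eta> \<le> e"
          proof -
            have "\<kappa> / \<tau> * \<eta> \<le> \<kappa> / \<tau> * (\<tau> * e / (\<kappa> + 1))" using \<eta>(4) \<kappa> \<tau> by (intro mult_left_mono) auto
            also have "\<dots> = e * (\<kappa> / (\<kappa> + 1))" using \<tau> by simp
            also have "\<dots> \<le> e * 1" using e \<kappa> by (intro mult_left_mono) auto
            finally show ?thesis by simp
          qed
          \<comment> \<open>The box ends after the time \<open>s + \<tau>\<close> of interest, and
            from \<open>s + \<eta>\<close> to \<open>t2\<close> the barrier rises by exactly
            \<kappa>, which the blow-up at level \<open>N\<close> covers on the right edge.\<close>
          define t2 where "t2 = s + \<tau> + \<eta>"
          have t2: "t2 < s + 2 * \<tau>" "t2 < t1" "t2 < s + \<epsilon>" "t2 < s + \<sigma>" using \<eta> \<tau> by (auto simp: t2_def)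
          have "blows_up b w N T" if "T \<in> {s + \<eta>..t2}" for T using that \<eta> t2 by (intro bdry) auto
          from blows_up_uniform[OF this \<gamma>] obtain \<xi> where
            \<xi>: "\<xi> > 0" "\<And>x t. x \<in> {b - \<xi><..<b} \<Longrightarrow> t \<in> {s + \<eta>..t2} \<Longrightarrow> N - \<gamma> \<le> w (x, t)" by blast
          define \<xi>' where "\<xi>' = min (r / 2) (min (\<xi> / 2) ((b - x) / 2))"
          have \<xi>': "0 < \<xi>'" "\<xi>' < r" "\<xi>' < \<xi>" "x < b - \<xi>'" using r \<xi> x by (auto simp: \<xi>'_def min_def field_simps)
          define \<phi> where "\<phi> = (\<lambda>z. 1 / 32 * (exp ((b - fst z) / \<rho>) - 1) + ((m - e) + \<kappa> / \<tau> * (snd z - (s + \<eta>))))"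
          note bar = gain[OF \<rho> \<rho>_le(2) c(2), of "m - e" "s + \<eta>", unfolded c\<rho>, folded \<phi>_def]
          have time: "\<kappa> / \<tau> * (q - (s + \<eta>)) \<le> \<kappa>" if "q \<le> t2" for q
          proof -
            have "\<kappa> / \<tau> * (q - (s + \<eta>)) \<le> \<kappa> / \<tau> * \<tau>" using that \<kappa> \<tau> by (intro mult_left_mono) (auto simp: t2_def)
            then show ?thesis using \<tau> by simp
          qed
          have space: "1 / 32 * (exp ((b - y) / \<rho>) - 1) \<le> 1 / 16" if "b - \<rho> \<le> y" for y
          proof -
            have "(b - y) / \<rho> \<le> 1" using that \<rho> by simp
            then have "exp ((b - y) / \<rho>) \<le> exp 1" by simp
            then have "exp ((b - y) / \<rho>) \<le> 3" using exp_le by linarith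
            then show ?thesis by simp
          qed
          have space': "1 / 32 * (exp ((b - y) / \<rho>) - 1) \<le> e" if "b - r \<le> y" for y
          proof -
            have "(b - y) / \<rho> \<le> r / \<rho>" using that \<rho> by (intro divide_right_mono) auto
            then have "exp ((b - y) / \<rho>) \<le> exp (r / \<rho>)" by simp
            then have "exp ((b - y) / \<rho>) - 1 \<le> e" using r(3) by linarith
            then show ?thesis using e by simp
          qed
          have \<kappa>16: "\<kappa> \<le> 1 / 16" using \<kappa>(2) by (simp add: \<kappa>0_def)
          have "\<phi> (x, s + \<tau>) \<le> w (x, s + \<tau>)"
          proof (rule super_solution_ge_box[OF super, of \<phi> "b - \<rho>" "b - \<xi>'" "s + \<eta>" t2])
            show "C2_on (Q b) \<phi>" using bar by blast
            show "continuous_on (Q0 b) \<phi>" unfolding \<phi>_def using \<rho> by (intro continuous_intros) auto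
            show "residual f g \<phi> (y, q) < 0" if "b - \<rho> < y" "y < b - \<xi>'" "s + \<eta> < q" "q < t2" for y q
            proof -
              have "(y, q) \<in> Q b" using that seg \<xi>' \<eta> s by (auto simp: Q_def)
              then show ?thesis using bar by blast
            qed
            show "\<phi> (y, s + \<eta>) \<le> w (y, s + \<eta>)" if y: "b - \<rho> \<le> y" "y \<le> b - \<xi>'" for y
            proof (cases "y \<le> b - r")
              case True
              have "\<phi> (y, s + \<eta>) \<le> 1 / 16 + (m - e)" using space[OF y(1)] by (simp add: \<phi>_def)
              also have "\<dots> \<le> N + 1 / 2" using m \<kappa> \<gamma> e by simp
              also have "\<dots> \<le> w (y, s + \<eta>)" using \<eta>1(2)[of y "s + \<eta>"] y True \<eta> by simp
              finally show ?thesis .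
            next
              case False
              have "\<phi> (y, s + \<eta>) \<le> e + (m - e)" using space'[of y] False by (simp add: \<phi>_def)
              also have "\<dots> \<le> w (y, s + \<eta>)" using \<epsilon>(2)[of y "s + \<eta>"] y False r \<rho>_le \<xi>' \<eta> \<tau> by simp
              finally show ?thesis .
            qed
            show "\<phi> (b - \<rho>, q) \<le> w (b - \<rho>, q)" if "s + \<eta> \<le> q" "q < t2" for q
            proof -
              have "\<phi> (b - \<rho>, q) \<le> 1 / 16 + ((m - e) + \<kappa>)"
                using space[of "b - \<rho>"] time[of q] that unfolding \<phi>_def fst_conv snd_conv by linarith
              also have "\<dots> \<le> N + 1 / 8" using m \<gamma> e \<kappa>16 by simp
              also have "\<dots> \<le> w (b - \<rho>, q)"
                using that \<eta> t2 \<rho> \<rho>_le C1\<rho>[of "q - s"] by (intro loss[of \<rho>]) auto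
              finally show ?thesis .
            qed
            show "\<phi> (b - \<xi>', q) \<le> w (b - \<xi>', q)" if "s + \<eta> \<le> q" "q < t2" for q
            proof -
              have "\<phi> (b - \<xi>', q) \<le> e + ((m - e) + \<kappa>)"
                using space'[of "b - \<xi>'"] \<xi>' time[of q] that unfolding \<phi>_def fst_conv snd_conv by linarith
              also have "\<dots> \<le> N - \<gamma>" using m by simp
              also have "\<dots> \<le> w (b - \<xi>', q)" using that \<xi>' by (intro \<xi>(2)) auto
              finally show ?thesis .
            qed
          qed (use seg \<xi>' \<eta> s False in \<open>auto simp: t2_def\<close>)
          moreover have "\<phi> (x, s + \<tau>) \<ge> m - e + \<kappa> - e"
          proof -
            have "(b - x) / \<rho> \<ge> 0" using x \<rho> by simp
            then have "1 / 32 * (exp ((b - x) / \<rho>) - 1) \<ge> 0" by simp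
            moreover have eq: "\<kappa> / \<tau> * (s + \<tau> - (s + \<eta>)) = \<kappa> - \<kappa> / \<tau> * \<eta>" using \<tau> by (simp add: field_simps)
            have "\<phi> (x, s + \<tau>) = 1 / 32 * (exp ((b - x) / \<rho>) - 1) + ((m - e) + (\<kappa> - \<kappa> / \<tau> * \<eta>))"
              unfolding \<phi>_def fst_conv snd_conv eq ..
            ultimately show ?thesis using \<eta>e by linarith
          qed
          ultimately show "m + \<kappa> \<le> w (x, t) + e0" unfolding \<tau>(6) e_def by simp
        qed
      qed
    qed
    then show ?thesis
      using \<tau>0 \<delta> by (intro exI[of _ "min \<tau>0 (\<delta> / 2)"]) auto
  qed
  have base: "?near 0"
  proof (intro exI conjI ballI)
    show "min \<delta> (t1 - s) > 0" using \<delta> s by simp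
    fix x t assume "x \<in> {b - min \<delta> (t1 - s)<..<b}" "t \<in> {s<..<s + min \<delta> (t1 - s)}"
    then show "0 \<le> w (x, t)" by (intro nonneg) auto
  qed
  show ?thesis
  proof (cases "N - \<gamma> \<le> 0")
    case True
    from base obtain \<epsilon> where \<epsilon>: "\<epsilon> > 0" "\<And>x t. x \<in> {b - \<epsilon><..<b} \<Longrightarrow> t \<in> {s<..<s + \<epsilon>} \<Longrightarrow> 0 \<le> w (x, t)" by blast
    show ?thesis by (intro exI[of _ \<epsilon>] conjI ballI \<epsilon>(1) order_trans[OF True \<epsilon>(2)])
  next
    case False
    \<comment> \<open>The height from 0 to \<open>N - \<gamma>\<close> is split into equal steps not
      exceeding \<open>\<kappa>0\<close>. Each step may shrink the neighbourhood, but there are only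
      finitely many.\<close>
    obtain n :: nat where n: "(N - \<gamma>) / \<kappa>0 < n" using reals_Archimedean2 by blast
    have "n > 0" using n False \<kappa>0 by (cases n) (auto simp: field_simps)
    define \<kappa> where "\<kappa> = (N - \<gamma>) / n"
    have \<kappa>: "0 \<le> \<kappa>" "\<kappa> \<le> \<kappa>0" using n False \<kappa>0 \<open>n > 0\<close> by (auto simp: \<kappa>_def field_simps)
    have "?near (real j * \<kappa>)" if "j \<le> n" for j
      using that
    proof (induction j)
      case 0
      then show ?case using base by simp
    next
      case (Suc j)
      have "real (Suc j) * \<kappa> \<le> real n * \<kappa>" using Suc.prems \<kappa> by (intro mult_right_mono) auto
      moreover have "real n * \<kappa> = N - \<gamma>" using \<open>n > 0\<close> by (simp add: \<kappa>_def)
      moreover have "real (Suc j) * \<kappa> = real j * \<kappa> + \<kappa>" by (simp add: distrib_right)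
      ultimately have "real j * \<kappa> + \<kappa> \<le> N - \<gamma>" by linarith
      from step[OF Suc.IH \<kappa> this] Suc.prems show ?case by (simp add: algebra_simps)
    qed
    from this[of n] show ?thesis using \<open>n > 0\<close> by (simp add: \<kappa>_def)
  qed
qed

text \<open>An affine function has no diffusion, as \<open>f\<close> vanishes at 0, so after an
  arbitrarily slow descent it is a strict sub-solution. It vanishes at
  \<open>b - \<delta> / 2\<close>, where \<open>w\<close> is nonnegative; on the right edge it is
  covered by the corner bound at first and by the blow-up later. The length of the time interval
  does not enter the result.\<close>

lemma gap_lower_bound:
  fixes \<delta> s N b :: real
  assumes super: "super_solution b f g w" and \<delta>: "0 < \<delta>" "\<delta> \<le> b" and s: "0 < s" "s < t1" and N: "N \<ge> 0"
    and nonneg: "\<And>x t. x \<in> {b - \<delta><..<b} \<Longrightarrow> t \<in> {s..<t1} \<Longrightarrow> 0 \<le> w (x, t)"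
    and start: "\<And>x. x \<in> {b - \<delta><..<b} \<Longrightarrow> N + 1 \<le> w (x, s)"
    and bdry: "\<And>T. T \<in> {s<..<t1} \<Longrightarrow> blows_up b w N T"
    and x: "x \<in> {b - \<delta><..<b}" and t: "t \<in> {s..<t1}"
  shows "N - 2 * N / \<delta> * (b - x) \<le> w (x, t)"
proof (cases "x \<le> b - \<delta> / 2")
  case True
  have "N = 2 * N / \<delta> * (\<delta> / 2)" using \<delta> by simp
  also have "\<dots> \<le> 2 * N / \<delta> * (b - x)" using True N \<delta> by (intro mult_left_mono) auto
  finally show ?thesis using nonneg[OF x t] by linarith
next
  case False
  show ?thesis
  proof (rule field_le_epsilon)
    fix e0 :: real assume e0: "e0 > 0"
    define e where "e = e0 / 2"
    have e: "e > 0" using e0 by (simp add: e_def)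
    \<comment> \<open>The descent provides strictness, and over the whole interval it costs at most
      \<open>e\<close>.\<close>
    define e' where "e' = e / (t1 - s)"
    have e': "e' > 0" using e s by (simp add: e'_def)
    obtain \<epsilon> where \<epsilon>: "\<epsilon> > 0" "\<And>x t. x \<in> {b - \<epsilon><..<b} \<Longrightarrow> t \<in> {s<..<s + \<epsilon>} \<Longrightarrow> N - e \<le> w (x, t)"
      using corner_lower_bound[OF super \<delta> s N nonneg start bdry e] by blast
    define t2 where "t2 = (t + t1) / 2"
    have t2: "t < t2" "t2 < t1" "s < t2" using t by (auto simp: t2_def)
    have "blows_up b w N T" if "T \<in> {s + \<epsilon> / 2..t2}" for T using that \<epsilon> t2 by (intro bdry) auto
    from blows_up_uniform[OF this e] obtain \<xi> where
      \<xi>: "\<xi> > 0" "\<And>x t. x \<in> {b - \<xi><..<b} \<Longrightarrow> t \<in> {s + \<epsilon> / 2..t2} \<Longrightarrow> N - e \<le> w (x, t)" by blast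
    define \<xi>' where "\<xi>' = min (min (\<epsilon> / 2) (\<delta> / 4)) (min (\<xi> / 2) ((b - x) / 2))"
    have \<xi>': "0 < \<xi>'" "\<xi>' < \<epsilon>" "\<xi>' < \<delta> / 2" "\<xi>' < \<xi>" "x < b - \<xi>'"
      using \<epsilon> \<delta> \<xi> x by (auto simp: \<xi>'_def min_def field_simps)
    define \<phi> where "\<phi> = (\<lambda>z. - (2 * N / \<delta>) * (b - fst z) + (N - e + - e' * (snd z - s)))"
    have d: "((\<lambda>x. - (2 * N / \<delta>) * (b - x)) has_field_derivative 2 * N / \<delta>) (at x)"
      "((\<lambda>_. 2 * N / \<delta>) has_field_derivative 0) (at x)" for x
      using \<delta> by (auto intro!: derivative_eq_intros)
    have dt: "((\<lambda>t. N - e + - e' * (t - s)) has_field_derivative - e') (at t)"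
      "((\<lambda>_. - e') has_field_derivative 0) (at t)" for t
      by (auto intro!: derivative_eq_intros)
    have cont: "continuous_on A (\<lambda>_. 0 :: real)" for A :: "real set" by (intro continuous_intros)
    note * = C2_on_sum[of b, OF d cont dt cont, folded \<phi>_def]
    have \<phi>_le: "\<phi> (y, q) \<le> N - e" "\<phi> (y, q) \<le> N - 2 * N / \<delta> * (b - y)" if "y \<le> b" "s \<le> q" for y q
    proof -
      have "2 * N / \<delta> * (b - y) \<ge> 0" "e' * (q - s) \<ge> 0" using that N \<delta> e' by auto
      then show "\<phi> (y, q) \<le> N - e" "\<phi> (y, q) \<le> N - 2 * N / \<delta> * (b - y)"
        using e unfolding \<phi>_def fst_conv snd_conv by linarith+
    qed
    have "\<phi> (x, t) \<le> w (x, t)"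
    proof (rule super_solution_ge_box[OF super, of \<phi> "b - \<delta> / 2" "b - \<xi>'" s t2])
      show "C2_on (Q b) \<phi>" by (rule *)
      show "continuous_on (Q0 b) \<phi>" unfolding \<phi>_def by (intro continuous_intros)
      show "residual f g \<phi> (y, q) < 0" if "b - \<delta> / 2 < y" "y < b - \<xi>'" "s < q" "q < t2" for y q
      proof -
        have "(y, q) \<in> Q b" using that \<delta> \<xi>' s by (auto simp: Q_def)
        then show ?thesis using *(2)[of y q f g] e' f_0 by simp
      qed
      show "\<phi> (y, s) \<le> w (y, s)" if "b - \<delta> / 2 \<le> y" "y \<le> b - \<xi>'" for y
        using \<phi>_le(1)[of y s] start[of y] that \<delta> \<xi>' e by auto
      show "\<phi> (b - \<delta> / 2, q) \<le> w (b - \<delta> / 2, q)" if "s \<le> q" "q < t2" for q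
        using \<phi>_le(2)[of "b - \<delta> / 2" q] nonneg[of "b - \<delta> / 2" q] that \<delta> t2 by auto
      show "\<phi> (b - \<xi>', q) \<le> w (b - \<xi>', q)" if q: "s \<le> q" "q < t2" for q
      proof -
        have "N - e \<le> w (b - \<xi>', q)"
        proof -
          consider "q = s" | "q \<in> {s<..<s + \<epsilon>}" | "q \<in> {s + \<epsilon> / 2..t2}" using q \<epsilon>(1) by fastforce
          then show ?thesis
          proof cases
            case 1
            then show ?thesis using start[of "b - \<xi>'"] \<xi>' \<delta> e by auto
          next
            case 2
            then show ?thesis using \<xi>' by (intro \<epsilon>(2)) auto
          next
            case 3
            then show ?thesis using \<xi>' by (intro \<xi>(2)) auto
          qed
        qed
        then show ?thesis using \<phi>_le(1)[of "b - \<xi>'" q] q \<xi>' by auto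
      qed
    qed (use \<delta> \<xi>' s t t2 False in auto)
    moreover have "e' * (t - s) \<le> e"
    proof -
      have "e' * (t - s) \<le> e' * (t1 - s)" using e' t by (intro mult_left_mono) auto
      then show ?thesis using s by (simp add: e'_def)
    qed
    ultimately show "N - 2 * N / \<delta> * (b - x) \<le> w (x, t) + e0"
      unfolding \<phi>_def fst_conv snd_conv e_def by linarith
  qed
qed

end

subsection \<open>Non-existence\<close>

text \<open>The sets \<open>E n\<close> of times with a uniform bound need not be closed, so the
  category theorem only yields density of one of them in a portion of \<open>C\<close>. Lower bounds
  at a dense set of times are recovered afterwards by passing to limits from the past.\<close>

lemma baire_closed_union:
  fixes C :: "real set" and E :: "nat \<Rightarrow> real set"
  assumes C: "closed C" "C \<noteq> {}" and cover: "C \<subseteq> (\<Union>n. E n)"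
  shows "\<exists>n. \<exists>x\<in>C. \<exists>e>0. \<forall>y\<in>C. dist y x < e \<longrightarrow> y \<in> closure (E n)"
proof (rule ccontr)
  assume *: "\<not> ?thesis"
  define \<G> where "\<G> = range (\<lambda>n. C - closure (E n))"
  have "C \<subseteq> closure (\<Inter>\<G>)"
  proof (rule Baire[OF C(1)])
    show "countable \<G>" by (simp add: \<G>_def)
    fix T assume "T \<in> \<G>"
    then obtain n where T: "T = C - closure (E n)" by (auto simp: \<G>_def)
    have "openin (top_of_set C) T"
      unfolding T openin_open by (intro exI[of _ "- closure (E n)"]) (auto simp: open_Compl)
    moreover have "C \<subseteq> closure T"
    proof
      fix x assume x: "x \<in> C"
      have "\<exists>y\<in>T. dist y x < e" if "e > 0" for e
        using * x that unfolding T by blast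
      then show "x \<in> closure T" unfolding closure_approachable by blast
    qed
    ultimately show "openin (top_of_set C) T \<and> C \<subseteq> closure T" ..
  qed
  moreover have "\<Inter>\<G> = {}"
  proof -
    have "y \<notin> \<Inter>\<G>" for y
    proof
      assume y: "y \<in> \<Inter>\<G>"
      then have "y \<in> C" by (auto simp: \<G>_def)
      then obtain n where "y \<in> E n" using cover by blast
      then have "y \<in> closure (E n)" using closure_subset by blast
      with y show False by (auto simp: \<G>_def)
    qed
    then show ?thesis by blast
  qed
  ultimately show False using C(2) by simp
qed

lemma at_left_large:
  fixes h :: "real \<Rightarrow> real"
  assumes "filterlim h at_top (at_left b)"
  shows "\<exists>\<delta>>0. \<forall>x\<in>{b - \<delta><..<b}. N \<le> h x"
proof -
  have "\<forall>\<^sub>F x in at_left b. N \<le> h x" using assms unfolding filterlim_at_top by blast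
  then obtain a where a: "a < b" "\<And>x. a < x \<Longrightarrow> x < b \<Longrightarrow> N \<le> h x"
    unfolding eventually_at_left_field by auto
  then show ?thesis by (intro exI[of _ "b - a"]) auto
qed

lemma at_left_large_nat:
  fixes h :: "real \<Rightarrow> real"
  assumes "filterlim h at_top (at_left b)" "\<delta> > 0"
  shows "\<exists>n. \<forall>x\<in>{b - \<delta> / real (Suc n)<..<b}. N \<le> h x"
proof -
  obtain d where d: "d > 0" "\<And>x. x \<in> {b - d<..<b} \<Longrightarrow> N \<le> h x" using at_left_large[OF assms(1)] by blast
  obtain n :: nat where n: "\<delta> / d < n" using reals_Archimedean2 by blast
  then have "\<delta> < d * real (Suc n)" using d by (simp add: field_simps)
  then have "\<delta> / real (Suc n) \<le> d" by (simp add: pos_divide_le_eq)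
  then show ?thesis using d(2) by (intro exI[of _ n]) auto
qed

section \<open>Locally uniform blow-up and the contradiction\<close>

context power_growth
begin

text \<open>At each time \<open>w\<close> is nonnegative on some strip at the right end. By Baire
  one width works for a set of times dense in an interval, and every later time in the interval is a
  limit of such times from the past.\<close>

lemma super_solution_nonneg_strip:
  fixes b :: real
  assumes b: "b > 0" and super: "super_solution b f g w"
  shows "\<exists>\<delta> T1 T2. 0 < \<delta> \<and> \<delta> \<le> b \<and> 0 < T1 \<and> T1 < T2 \<and> (\<forall>x\<in>{b - \<delta><..<b}. \<forall>t\<in>{T1<..<T2}. 0 \<le> w (x, t))"
proof -
  have lim: "filterlim (\<lambda>x. w (x, t)) at_top (at_left b)" if "t > 0" for t
    using super that by (simp add: super_solution_def)
  define E where "E = (\<lambda>n. {t \<in> {1..2::real}. \<forall>x\<in>{b - b / real (Suc n)<..<b}. 0 \<le> w (x, t)})"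
  have "{1..2} \<subseteq> (\<Union>n. E n)"
  proof
    fix t :: real assume t: "t \<in> {1..2}"
    then have "t > 0" by simp
    from at_left_large_nat[OF lim[OF this] b, of 0] t show "t \<in> (\<Union>n. E n)" by (auto simp: E_def)
  qed
  from baire_closed_union[OF _ _ this] obtain n x0 e where x0: "x0 \<in> {1..2}" and e: "e > 0" and
    dense: "\<And>y. y \<in> {1..2} \<Longrightarrow> dist y x0 < e \<Longrightarrow> y \<in> closure (E n)"
    by fastforce
  define \<delta> where "\<delta> = b / real (Suc n)"
  have \<delta>: "0 < \<delta>" "\<delta> \<le> b" using b by (auto simp: \<delta>_def pos_divide_le_eq mult_le_cancel_left1)
  \<comment> \<open>The centre found by Baire may be an endpoint of \<open>{1..2}\<close>, so the
    interval is taken on the side of \<open>x0\<close> that stays inside.\<close>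
  define T1 where "T1 = (if x0 < 2 then x0 else max 1 (x0 - e))"
  define T2 where "T2 = (if x0 < 2 then min 2 (x0 + e) else x0)"
  have T: "1 \<le> T1" "T1 < T2" "T2 \<le> 2" "x0 - e \<le> T1" "T2 \<le> x0 + e" using x0 e by (auto simp: T1_def T2_def)
  have "0 \<le> w (x, t)" if x: "x \<in> {b - \<delta><..<b}" and t: "t \<in> {T1<..<T2}" for x t
  proof (rule super_solution_left_limit[OF super])
    show "x \<in> {-b<..<b}" "t > 0" "min (x - (b - \<delta>)) (b - x) > 0" using x \<delta> t T by auto
    fix s0 assume s0: "s0 < t"
    define l where "l = max s0 T1"
    \<comment> \<open>Density is used at the midpoint, so that the approximating time falls strictly
      between \<open>l\<close> and \<open>t\<close>.\<close>
    define c where "c = (l + t) / 2"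
    have c: "l < c" "c < t" using s0 t by (auto simp: c_def l_def)
    have "c \<in> closure (E n)" using c t T by (intro dense) (auto simp: l_def dist_real_def)
    then obtain s where s: "s \<in> E n" "dist s c < (t - l) / 2"
      using c closure_approachable[of c "E n"] by (metis diff_gt_0_iff_gt half_gt_zero less_trans)
    have "l < s" "s < t" using s(2) by (auto simp: c_def dist_real_def abs_less_iff field_simps)
    then show "\<exists>s>s0. s < t \<and> (\<forall>y\<in>{-b<..<b}. \<bar>y - x\<bar> < min (x - (b - \<delta>)) (b - x) \<longrightarrow> 0 \<le> w (y, s))"
      using s(1) by (intro exI[of _ s]) (auto simp: l_def E_def \<delta>_def)
  qed
  then show ?thesis using \<delta> T by (intro exI[of _ \<delta>] exI[of _ T1] exI[of _ T2]) auto
qed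

text \<open>
  The boundary condition is only required for each time separately. Baire's theorem on the closed
  set of times near which it is not locally uniform gives a portion of this set on which it is
  uniform, and the lower bound on gaps extends it to the times in between.
\<close>

lemma super_solution_blows_up:
  fixes b \<delta> T1 T2 N :: real
  assumes b: "b > 0" and super: "super_solution b f g w" and \<delta>: "0 < \<delta>" "\<delta> \<le> b" and T1: "0 < T1"
    and nonneg: "\<And>x t. x \<in> {b - \<delta><..<b} \<Longrightarrow> t \<in> {T1<..<T2} \<Longrightarrow> 0 \<le> w (x, t)"
    and N: "N > 0" and T: "T \<in> {T1<..<T2}"
  shows "blows_up b w N T"
proof (rule ccontr)
  assume bad: "\<not> blows_up b w N T"
  have lim: "filterlim (\<lambda>x. w (x, t)) at_top (at_left b)" if "t > 0" for t
    using super that by (simp add: super_solution_def)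
  define A where "A = {t. blows_up b w N t}"
  \<comment> \<open>Removing the interior of the good times makes the bad set relatively closed, and
    every time outside it has a whole interval of good times around it.\<close>
  define C where "C = {T1<..<T2} - interior A"
  have "T \<in> C" using bad T interior_subset by (auto simp: C_def A_def)
  define e where "e = min (T - T1) (T2 - T) / 2"
  have e: "0 < e" "T1 < T - e" "T + e < T2" using T by (auto simp: e_def min_def field_simps)
  \<comment> \<open>Baire needs a closed set. Since \<open>T - e\<close> and \<open>T + e\<close>
    are still inside the strip of times, the closure adds only points of \<open>C\<close>.\<close>
  define C' where "C' = closure (C \<inter> {T - e<..<T + e})"
  have "C' \<subseteq> {T - e..T + e} - interior A"
    unfolding C'_def
    by (rule closure_minimal) (auto simp: C_def intro!: closed_Diff)
  then have C'C: "C' \<subseteq> C" using e unfolding C_def by fastforce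
  \<comment> \<open>The level \<open>N + 1\<close> is one higher than needed because the corner
    estimates consume part of the starting height.\<close>
  define E where "E = (\<lambda>n. {t \<in> C. \<forall>x\<in>{b - \<delta> / real (Suc n)<..<b}. N + 1 \<le> w (x, t)})"
  have cover: "C' \<subseteq> (\<Union>n. E n)"
  proof
    fix t assume t: "t \<in> C'"
    then have "t > 0" using C'C T1 by (auto simp: C_def)
    from at_left_large_nat[OF lim[OF this] \<delta>(1), of "N + 1"] t C'C show "t \<in> (\<Union>n. E n)" by (auto simp: E_def)
  qed
  have "T \<in> C \<inter> {T - e<..<T + e}" using \<open>T \<in> C\<close> e by simp
  then have ne: "C' \<noteq> {}" unfolding C'_def using closure_subset by fastforce
  have cl: "closed C'" by (simp add: C'_def)
  obtain n x0 e' where x0: "x0 \<in> C'" and e': "e' > 0" and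
    dense0: "\<And>y. y \<in> C' \<Longrightarrow> dist y x0 < e' \<Longrightarrow> y \<in> closure (E n)"
    using baire_closed_union[OF cl ne cover] by blast
  \<comment> \<open>The centre \<open>x0\<close> may sit at the edge of the closure. Around the
    nearby \<open>T0\<close> all points of \<open>C\<close>, not only those of a one-sided part,
    belong to the portion where \<open>E n\<close> is dense.\<close>
  obtain T0 where T0: "T0 \<in> C \<inter> {T - e<..<T + e}" "dist T0 x0 < e'"
    using x0 e' unfolding C'_def closure_approachable by blast
  have "open (ball x0 e' \<inter> {T - e<..<T + e})" "T0 \<in> ball x0 e' \<inter> {T - e<..<T + e}"
    using T0 by (auto simp: dist_commute)
  then obtain r where r: "r > 0" "ball T0 r \<subseteq> ball x0 e' \<inter> {T - e<..<T + e}"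
    using open_contains_ball by blast
  have dense: "t \<in> closure (E n)" if "t \<in> C" "t \<in> ball T0 r" for t
  proof (rule dense0)
    show "t \<in> C'" unfolding C'_def using that r closure_subset by blast
    show "dist t x0 < e'" using that r by (auto simp: dist_commute)
  qed
  have ballT: "T1 < t \<and> t < T2" if "t \<in> ball T0 r" for t
  proof -
    have "t \<in> {T - e<..<T + e}" using that r by blast
    then show ?thesis using e by auto
  qed
  have C_or: "t \<in> interior A \<or> t \<in> C" if "t \<in> ball T0 r" for t
    using ballT[OF that] by (auto simp: C_def)
  \<comment> \<open>An auxiliary starting time for good intervals that reach back beyond the
    neighbourhood: there the boundary condition at the single time \<open>t'\<close> gives a strip
    of some width \<open>\<delta>'\<close>.\<close>
  define t' where "t' = T0 - r / 2"
  have t': "t' \<in> ball T0 r" "t' < T0" using r by (auto simp: t'_def dist_real_def)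
  have "t' > 0" using ballT[OF t'(1)] T1 by simp
  from at_left_large[OF lim[OF this]] obtain \<delta>' where \<delta>': "\<delta>' > 0" "\<And>x. x \<in> {b - \<delta>'<..<b} \<Longrightarrow> N + 1 \<le> w (x, t')" by blast
  define d where "d = min \<delta>' (\<delta> / real (Suc n))"
  have "\<delta> / real (Suc n) \<le> \<delta>" using \<delta> by (simp add: pos_divide_le_eq mult_le_cancel_left1)
  then have d: "0 < d" "d \<le> \<delta>'" "d \<le> \<delta> / real (Suc n)" "d \<le> \<delta>" "d \<le> b" using \<delta> \<delta>' by (auto simp: d_def)
  have En: "N + 1 \<le> w (x, t)" if "t \<in> E n" "x \<in> {b - d<..<b}" for x t
    using that d by (auto simp: E_def)
  have nonneg': "0 \<le> w (x, t)" if "x \<in> {b - d<..<b}" "t \<in> ball T0 r" for x t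
    using that d ballT[OF that(2)] by (intro nonneg) auto
  have between: "t \<in> ball T0 r" if "t' \<le> t" "t < T0 + r" for t
    using that r by (auto simp: t'_def dist_real_def)
  define B where "B = (\<lambda>x. N - 2 * N / d * (b - x))"
  have B_le: "B x \<le> N" if "x < b" for x
  proof -
    have "2 * N / d * (b - x) \<ge> 0" using N d that by (intro mult_nonneg_nonneg) auto
    then show ?thesis by (simp add: B_def)
  qed
  have gap: "B x \<le> w (x, t)" if t: "t \<in> {t'<..<T0 + r}" "t \<in> interior A" and x: "x \<in> {b - d<..<b}" for t x
  proof -
    \<comment> \<open>The largest element of \<open>Z\<close> is the left end of the good interval
      containing \<open>t\<close>, truncated at \<open>t'\<close>. It exists because the interior is
      open and \<open>Z\<close> is compact.\<close>
    define Z where "Z = insert t' ({t'..t} - interior A)"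
    have "compact ({t'..t} - interior A)" by (intro compact_diff) auto
    then have "compact Z" by (simp add: Z_def)
    moreover have "Z \<noteq> {}" by (simp add: Z_def)
    ultimately obtain s where s: "s \<in> Z" "\<And>z. z \<in> Z \<Longrightarrow> z \<le> s" using compact_attains_sup by metis
    have ts: "t' \<le> s" "s < t"
    proof -
      show "t' \<le> s" using s(2) by (simp add: Z_def)
      have "s \<noteq> t" using s(1) t by (auto simp: Z_def)
      then show "s < t" using s(1) t by (auto simp: Z_def)
    qed
    have free: "\<tau> \<in> interior A" if "s < \<tau>" "\<tau> \<le> t" for \<tau>
      using s(2)[of \<tau>] that ts by (auto simp: Z_def)
    obtain h where h: "h > 0" "ball t h \<subseteq> interior A" using t(2) open_interior open_contains_ball by blast
    \<comment> \<open>The bound along a good interval is stated before its end, so the interval is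
      prolonged slightly beyond \<open>t\<close>.\<close>
    define t1 where "t1 = min (t + h) (T0 + r)"
    have t1: "t < t1" "t1 \<le> T0 + r" "t1 \<le> t + h" using h t by (auto simp: t1_def)
    have start: "N + 1 \<le> w (y, s)" if y: "y \<in> {b - d<..<b}" for y
    proof (cases "s = t' \<or> s \<in> E n")
      case True
      then show ?thesis using \<delta>'(2)[of y] En[of s y] y d by auto
    next
      case False
      \<comment> \<open>Times of \<open>E n\<close> near \<open>s\<close> are bad, whereas those
        from just after \<open>s\<close> up to \<open>t\<close> are good; so they approach
        \<open>s\<close> from the past, which is the direction in which lower bounds
        survive.\<close>
      then have sC: "s \<in> C" "t' < s" using s(1) ts t C_or[OF between[of s]] by (auto simp: Z_def)
      show ?thesis
      proof (rule super_solution_left_limit[OF super])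
        show "y \<in> {-b<..<b}" "s > 0" "min (y - (b - d)) (b - y) > 0" using y d sC T1 by (auto simp: C_def)
        fix s0 assume s0: "s0 < s"
        define h where "h = min (s - max s0 t') (t - s)"
        have h: "h > 0" using s0 sC ts by (simp add: h_def)
        have "s \<in> closure (E n)" using sC ts t by (intro dense between) auto
        then obtain \<tau> where \<tau>: "\<tau> \<in> E n" "dist \<tau> s < h" using h closure_approachable by blast
        have "\<tau> \<notin> interior A" using \<tau>(1) by (simp add: E_def C_def)
        moreover have "\<tau> < t" "s0 < \<tau>" using \<tau>(2) by (auto simp: h_def dist_real_def)
        ultimately have "\<tau> \<le> s" using free[of \<tau>] by fastforce
        moreover have "\<tau> \<noteq> s" using \<tau>(1) False by blast
        ultimately have "\<tau> < s" by simp
        then show "\<exists>\<tau>>s0. \<tau> < s \<and> (\<forall>z\<in>{-b<..<b}. \<bar>z - y\<bar> < min (y - (b - d)) (b - y) \<longrightarrow> N + 1 \<le> w (z, \<tau>))"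
          using \<open>s0 < \<tau>\<close> by (intro exI[of _ \<tau>]) (auto intro!: En[OF \<tau>(1)])
      qed
    qed
    have "blows_up b w N \<tau>" if "\<tau> \<in> {s<..<t1}" for \<tau>
    proof -
      have "\<tau> \<in> interior A"
      proof (cases "\<tau> \<le> t")
        case False
        then have "\<tau> \<in> ball t h" using that t1 by (auto simp: dist_real_def)
        then show ?thesis using h by blast
      qed (use free that in auto)
      then show ?thesis using interior_subset by (auto simp: A_def)
    qed
    moreover have "0 \<le> w (y, \<tau>)" if "y \<in> {b - d<..<b}" "\<tau> \<in> {s..<t1}" for y \<tau>
      using that ts t1 by (intro nonneg' between) auto
    moreover have "0 < s" using ballT[OF between[of s]] ts t T1 by auto
    ultimately show ?thesis
      unfolding B_def using start N d ts t1 x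
      by (intro gap_lower_bound[OF super d(1,5), of s t1]) auto
  qed
  \<comment> \<open>Every time, good or bad, has times just before it at which the affine bound
    holds: either a good time, by \<open>gap\<close>, or a time of \<open>E n\<close>, where
    \<open>w\<close> is above \<open>N + 1\<close>. The limit from the past costs only the
    oscillation of \<open>B\<close> over a small distance.\<close>
  have all: "B x \<le> w (x, t)" if t: "t \<in> {t'<..<T0 + r}" and x: "x \<in> {b - d<..<b}" for t x
  proof (rule field_le_epsilon)
    fix e0 :: real assume e0: "e0 > 0"
    define \<rho> where "\<rho> = min (min (x - (b - d)) (b - x)) (e0 * d / (2 * N))"
    have \<rho>: "\<rho> > 0" using x e0 d N by (simp add: \<rho>_def)
    have B_near: "B x - e0 \<le> B y" if "\<bar>y - x\<bar> < \<rho>" for y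
    proof -
      have "2 * N / d * \<bar>y - x\<bar> \<le> 2 * N / d * (e0 * d / (2 * N))"
        using that N d by (intro mult_left_mono) (auto simp: \<rho>_def)
      also have "\<dots> = e0" using N d by simp
      finally have "2 * N / d * \<bar>y - x\<bar> \<le> e0" .
      moreover have "2 * N / d * (x - y) \<le> 2 * N / d * \<bar>y - x\<bar>" using N d by (intro mult_left_mono) auto
      ultimately show ?thesis unfolding B_def right_diff_distrib by linarith
    qed
    have "B x - e0 \<le> w (x, t)"
    proof (rule super_solution_left_limit[OF super _ _ \<rho>])
      show "x \<in> {-b<..<b}" "t > 0" using x d t ballT[OF between[of t]] T1 by auto
      fix s0 assume s0: "s0 < t"
      define l where "l = max s0 t'"
      define c where "c = (l + t) / 2"
      have c: "l < c" "c < t" using s0 t by (auto simp: c_def l_def)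
      have cb: "c \<in> ball T0 r" using c t by (intro between) (auto simp: l_def)
      have "\<exists>s. l < s \<and> s < t \<and> (\<forall>y\<in>{b - d<..<b}. B y \<le> w (y, s))"
      proof (cases "c \<in> interior A")
        case True
        have "c \<in> {t'<..<T0 + r}" using c t by (auto simp: l_def)
        with gap[OF this True] c show ?thesis by blast
      next
        case False
        then have "c \<in> closure (E n)" using C_or[OF cb] dense cb by blast
        moreover have "0 < (t - l) / 2" using c by simp
        ultimately obtain s where s: "s \<in> E n" "dist s c < (t - l) / 2"
          using closure_approachable by blast
        have "l < s" "s < t" using s(2) by (auto simp: c_def dist_real_def abs_less_iff field_simps)
        moreover have "B y \<le> w (y, s)" if "y \<in> {b - d<..<b}" for y
          using B_le[of y] En[OF s(1) that] that by auto
        ultimately show ?thesis by blast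
      qed
      then obtain s where s: "l < s" "s < t" "\<And>y. y \<in> {b - d<..<b} \<Longrightarrow> B y \<le> w (y, s)" by blast
      have "B x - e0 \<le> w (y, s)" if "\<bar>y - x\<bar> < \<rho>" for y
      proof -
        have "y \<in> {b - d<..<b}" using that unfolding \<rho>_def min_less_iff_conj abs_less_iff by auto
        then show ?thesis using B_near[OF that] s(3)[of y] by linarith
      qed
      then show "\<exists>s>s0. s < t \<and> (\<forall>y\<in>{-b<..<b}. \<bar>y - x\<bar> < \<rho> \<longrightarrow> B x - e0 \<le> w (y, s))"
        using s(1,2) by (intro exI[of _ s]) (auto simp: l_def)
    qed
    then show "B x \<le> w (x, t) + e0" by simp
  qed
  have "blows_up b w N t" if t: "t \<in> {t'<..<T0 + r}" for t
    unfolding blows_up_def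
  proof (intro allI impI)
    fix \<gamma> :: real assume \<gamma>: "\<gamma> > 0"
    define \<epsilon> where "\<epsilon> = min (min d (\<gamma> * d / (2 * N))) (min (t - t') (T0 + r - t))"
    have \<epsilon>: "\<epsilon> > 0" using d \<gamma> N t by (simp add: \<epsilon>_def)
    have "N - \<gamma> \<le> w (x, s)" if x: "x \<in> {b - \<epsilon><..<b}" and s: "s \<in> {t - \<epsilon><..<t + \<epsilon>}" for x s
    proof -
      have "2 * N / d * (b - x) \<le> 2 * N / d * (\<gamma> * d / (2 * N))" using x N d by (intro mult_left_mono) (auto simp: \<epsilon>_def)
      also have "\<dots> = \<gamma>" using N d by simp
      finally have "N - \<gamma> \<le> B x" by (simp add: B_def)
      also have "\<dots> \<le> w (x, s)" using x s by (intro all) (auto simp: \<epsilon>_def)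
      finally show ?thesis .
    qed
    then show "\<exists>\<epsilon>>0. \<forall>x\<in>{b - \<epsilon><..<b}. \<forall>s\<in>{t - \<epsilon><..<t + \<epsilon>}. N - \<gamma> \<le> w (x, s)" using \<epsilon> by blast
  qed
  \<comment> \<open>The affine bound tends to \<open>N\<close> at the boundary, uniformly in time,
    so a whole neighbourhood of the bad time \<open>T0\<close> is good.\<close>
  then have "{t'<..<T0 + r} \<subseteq> A" by (auto simp: A_def)
  moreover have "T0 \<in> {t'<..<T0 + r}" using t' r by simp
  ultimately have "T0 \<in> interior A" by (meson interiorI open_greaterThanLessThan)
  then show False using T0(1) by (simp add: C_def)
qed

text \<open>A travelling wave that starts below zero enters from the right end and reaches a fixed
  interior point in a time that does not depend on its amplitude. Once the slope is at least 1, its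
  power \<open>\<beta> * (1 - \<alpha>)\<close> is at least the slope itself, so neither speed nor
  steepness changes when the amplitude tends to infinity.\<close>

theorem no_super_solution:
  fixes b :: real
  assumes b: "b > 0" and \<theta>: "1 \<le> \<beta> * (1 - \<alpha>)"
  shows "\<not> super_solution b f g w"
proof
  assume super: "super_solution b f g w"
  obtain \<delta> T1 T2 where \<delta>: "0 < \<delta>" "\<delta> \<le> b" and T: "0 < T1" "T1 < T2" and
    nonneg: "\<And>x t. x \<in> {b - \<delta><..<b} \<Longrightarrow> t \<in> {T1<..<T2} \<Longrightarrow> 0 \<le> w (x, t)"
    using super_solution_nonneg_strip[OF b super] by blast
  have blow: "blows_up b w N t" if "N > 0" "t \<in> {T1<..<T2}" for N t
    by (rule super_solution_blows_up[OF b super \<delta> T(1) nonneg that])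
  define \<eta> where "\<eta> = \<delta> / 2"
  have \<eta>: "0 < \<eta>" "\<eta> < \<delta>" "\<eta> < b" using \<delta> by (auto simp: \<eta>_def)
  \<comment> \<open>Half of the constant of the diffusion term; the other half makes the residual
    strictly negative.\<close>
  define L where "L = a0 * c0 powr \<beta> / 2"
  have L: "L > 0" using pos by (simp add: L_def)
  define t1 where "t1 = (T1 + T2) / 2"
  have t1: "T1 < t1" "t1 < T2" "0 < t1" using T by (auto simp: t1_def)
  \<comment> \<open>The wave moves with speed \<open>L * \<mu> powr \<beta>\<close>. The lower bound
    \<open>Z\<close> for \<open>\<mu> powr \<beta>\<close> lets it cross the width \<eta> in a time
    \<tau> of at most half of \<open>T2 - t1\<close>.\<close>
  define Z where "Z = 2 * \<eta> / (L * (T2 - t1))"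
  have Z: "Z > 0" using \<eta> L t1 by (simp add: Z_def)
  define \<mu> where "\<mu> = max (1 / c0) (Z powr (1 / \<beta>))"
  have \<mu>: "\<mu> > 0" "1 \<le> c0 * \<mu>" using pos by (auto simp: \<mu>_def less_max_iff_disj field_simps max_def)
  have "Z \<le> \<mu> powr \<beta>"
  proof -
    have "Z = (Z powr (1 / \<beta>)) powr \<beta>" using Z \<beta>_pos by (simp add: powr_powr)
    also have "\<dots> \<le> \<mu> powr \<beta>" using \<beta>_pos by (intro powr_mono2) (auto simp: \<mu>_def)
    finally show ?thesis .
  qed
  define \<omega> where "\<omega> = L * \<mu> powr \<beta> * \<mu>"
  have \<omega>: "\<omega> > 0" using L \<mu> by (simp add: \<omega>_def)
  define \<tau> where "\<tau> = \<mu> * \<eta> / \<omega>"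
  have \<tau>: "\<tau> > 0" "\<omega> * \<tau> = \<mu> * \<eta>" "t1 + \<tau> < T2"
  proof -
    show "\<tau> > 0" "\<omega> * \<tau> = \<mu> * \<eta>" using \<omega> \<mu> \<eta> by (auto simp: \<tau>_def)
    have "2 * \<eta> \<le> L * (T2 - t1) * \<mu> powr \<beta>" using \<open>Z \<le> \<mu> powr \<beta>\<close> L t1 by (simp add: Z_def pos_divide_le_eq mult.commute)
    moreover have "\<tau> * (L * \<mu> powr \<beta>) = \<eta>" using \<mu> L by (simp add: \<tau>_def \<omega>_def)
    ultimately have "2 * \<tau> * (L * \<mu> powr \<beta>) \<le> (T2 - t1) * (L * \<mu> powr \<beta>)" by (simp add: mult_ac)
    then have "2 * \<tau> \<le> T2 - t1" using L \<mu> by (simp add: mult_le_cancel_right)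
    then show "t1 + \<tau> < T2" using \<open>\<tau> > 0\<close> by linarith
  qed
  \<comment> \<open>Halfway across the strip, at three quarters of the crossing time, the exponent
    of the wave is \<open>\<mu> * \<eta> / 4\<close>, so the value there is a positive multiple of
    \<open>A\<close>.\<close>
  define x0 where "x0 = b - \<eta> / 2"
  define t0 where "t0 = t1 + 3 / 4 * \<tau>"
  \<comment> \<open>The condition \<open>exp (\<mu> * \<eta>) \<le> \<mu> * A\<close> makes the
    slope at least 1 throughout the strip, already at the initial time.\<close>
  have lower: "A * (exp (\<mu> * \<eta> / 4) - 1) \<le> w (x0, t0)" if A: "A > 0" "exp (\<mu> * \<eta>) \<le> \<mu> * A" for A
  proof -
    define \<phi> where "\<phi> = (\<lambda>z. A * exp (\<mu> * (fst z - b)) * exp (\<omega> * (snd z - t1)) + - A + 0)"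
    have 0: "((\<lambda>_. c) has_field_derivative 0) (at x)" "continuous_on S (\<lambda>_. 0 :: real)" for x c :: real and S :: "real set"
      by (auto intro: continuous_intros)
    have d: "((\<lambda>x. A * exp (\<mu> * (x - b))) has_field_derivative A * \<mu> * exp (\<mu> * (x - b))) (at x)"
      "((\<lambda>x. A * \<mu> * exp (\<mu> * (x - b))) has_field_derivative A * \<mu>\<^sup>2 * exp (\<mu> * (x - b))) (at x)"
      "((\<lambda>t. exp (\<omega> * (t - t1))) has_field_derivative \<omega> * exp (\<omega> * (t - t1))) (at t)"
      "((\<lambda>t. \<omega> * exp (\<omega> * (t - t1))) has_field_derivative \<omega>\<^sup>2 * exp (\<omega> * (t - t1))) (at t)" for x t
      by (auto intro!: derivative_eq_intros simp: power2_eq_square)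
    have cont: "continuous_on {-b<..<b} (\<lambda>x. A * \<mu>\<^sup>2 * exp (\<mu> * (x - b)))" "continuous_on {0<..} (\<lambda>t. \<omega>\<^sup>2 * exp (\<omega> * (t - t1)))"
      by (intro continuous_intros)+
    note * = C2_on_separable[where d="\<lambda>_. - A" and e="\<lambda>_. 0" and b=b, OF d(1,2) cont(1) 0(1) 0(1) 0(2) d(3,4) cont(2) 0(1) 0(1) 0(2), folded \<phi>_def]
    have res: "residual f g \<phi> (x, t) < 0" if x: "b - \<eta> < x" "x < b" and t: "t1 < t" for x t
    proof -
      have Q: "(x, t) \<in> Q b" using x t \<eta> t1 by (auto simp: Q_def)
      define V where "V = A * exp (\<mu> * (x - b)) * exp (\<omega> * (t - t1))"
      define P where "P = \<mu> * V"
      have "\<mu> * A * exp (- (\<mu> * \<eta>)) \<le> P"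
      proof -
        have "\<mu> * (- \<eta>) \<le> \<mu> * (x - b)" using \<mu> x by (intro mult_left_mono) auto
        then have "exp (- (\<mu> * \<eta>)) * 1 \<le> exp (\<mu> * (x - b)) * exp (\<omega> * (t - t1))"
          using \<omega> t by (intro mult_mono) auto
        then have "\<mu> * A * (exp (- (\<mu> * \<eta>)) * 1) \<le> \<mu> * A * (exp (\<mu> * (x - b)) * exp (\<omega> * (t - t1)))"
          using \<mu> A by (intro mult_left_mono) auto
        then show ?thesis by (simp add: P_def V_def mult.assoc)
      qed
      moreover have "1 \<le> \<mu> * A * exp (- (\<mu> * \<eta>))" using A(2) by (simp add: exp_minus field_simps)
      ultimately have P: "1 \<le> P" by linarith
      have "c0 * \<mu> * P powr (1 - \<alpha>) = c0 * P powr - \<alpha> * (\<mu> * P)" using P by (simp add: powr_diff powr_minus field_simps)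
      also have "\<dots> \<le> g P * (\<mu> * P)" using g_lower[of P] P \<mu> by (intro mult_right_mono) auto
      finally have "f (c0 * \<mu> * P powr (1 - \<alpha>)) \<le> f (g P * (\<mu> * P))" by (rule f_le)
      moreover have "a0 * (c0 * \<mu> * P powr (1 - \<alpha>)) powr \<beta> \<le> f (c0 * \<mu> * P powr (1 - \<alpha>))"
      proof (rule f_lower)
        have "1 * 1 \<le> c0 * \<mu> * P powr (1 - \<alpha>)" using \<mu> P \<alpha>_le by (intro mult_mono ge_one_powr_ge_zero) auto
        then show "1 \<le> c0 * \<mu> * P powr (1 - \<alpha>)" by simp
      qed
      moreover have "a0 * (c0 * \<mu> * P powr (1 - \<alpha>)) powr \<beta> = 2 * L * \<mu> powr \<beta> * P powr (\<beta> * (1 - \<alpha>))"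
        using pos \<mu> P by (simp add: L_def powr_mult powr_powr mult.commute[of \<beta>])
      moreover have "2 * L * \<mu> powr \<beta> * P powr 1 \<le> 2 * L * \<mu> powr \<beta> * P powr (\<beta> * (1 - \<alpha>))"
        using L P \<theta> by (intro mult_left_mono powr_mono) auto
      moreover have "2 * L * \<mu> powr \<beta> * P powr 1 = 2 * (\<omega> * V)" using P by (simp add: P_def \<omega>_def)
      moreover have "\<omega> * V > 0" using \<omega> A by (simp add: V_def)
      moreover have "residual f g \<phi> (x, t) = \<omega> * V - f (g P * (\<mu> * P))"
        unfolding residual_def F_def using *(2-4)[OF Q] by (simp add: P_def V_def power2_eq_square mult_ac)
      ultimately show ?thesis by linarith
    qed
    \<comment> \<open>The wave stays below \<open>A * exp (\<mu> * \<eta>)\<close> until it has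
      crossed; the extra 1 pays for the slack in the blow-up at level \<open>N\<close>.\<close>
    define N where "N = A * exp (\<mu> * \<eta>) + 1"
    have N: "N > 0" using A by (simp add: N_def add_pos_pos)
    have "blows_up b w N s" if "s \<in> {t1..t1 + \<tau>}" for s using that t1 \<tau> by (intro blow N) auto
    from blows_up_uniform[OF this zero_less_one] obtain \<xi> where
      \<xi>: "\<xi> > 0" "\<And>x t. x \<in> {b - \<xi><..<b} \<Longrightarrow> t \<in> {t1..t1 + \<tau>} \<Longrightarrow> N - 1 \<le> w (x, t)" by blast
    define \<xi>' where "\<xi>' = min (\<xi> / 2) (\<eta> / 4)"
    have \<xi>': "0 < \<xi>'" "\<xi>' < \<xi>" "\<xi>' < \<eta> / 2" using \<xi>(1) \<eta> by (auto simp: \<xi>'_def min_def)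
    have "\<phi> (x0, t0) \<le> w (x0, t0)"
    proof (rule super_solution_ge_box[OF super, of \<phi> "b - \<eta>" "b - \<xi>'" t1 "t1 + \<tau>"])
      show "C2_on (Q b) \<phi>" by (rule *)
      show "continuous_on (Q0 b) \<phi>" unfolding \<phi>_def by (intro continuous_intros)
      show "residual f g \<phi> (x, t) < 0" if "b - \<eta> < x" "x < b - \<xi>'" "t1 < t" "t < t1 + \<tau>" for x t
        using that \<xi>' by (intro res) auto
      have \<phi>_le0: "\<phi> (x, t) \<le> 0" if "\<mu> * (x - b) + \<omega> * (t - t1) \<le> 0" for x t
      proof -
        have "exp (\<mu> * (x - b)) * exp (\<omega> * (t - t1)) \<le> 1" using that by (simp add: exp_add[symmetric])
        then have "A * (exp (\<mu> * (x - b)) * exp (\<omega> * (t - t1))) \<le> A * 1" using A by (intro mult_left_mono) auto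
        then show ?thesis by (simp add: \<phi>_def mult.assoc)
      qed
      show "\<phi> (x, t1) \<le> w (x, t1)" if "b - \<eta> \<le> x" "x \<le> b - \<xi>'" for x
      proof -
        have "\<phi> (x, t1) \<le> 0" using \<mu> that \<xi>' by (intro \<phi>_le0) (simp add: mult_nonneg_nonpos)
        also have "0 \<le> w (x, t1)" using that \<eta> \<xi>' t1 by (intro nonneg) auto
        finally show ?thesis .
      qed
      show "\<phi> (b - \<eta>, t) \<le> w (b - \<eta>, t)" if "t1 \<le> t" "t < t1 + \<tau>" for t
      proof -
        have "\<omega> * (t - t1) \<le> \<omega> * \<tau>" using \<omega> that by (intro mult_left_mono) auto
        then have "\<phi> (b - \<eta>, t) \<le> 0" unfolding \<tau>(2) by (intro \<phi>_le0) simp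
        also have "0 \<le> w (b - \<eta>, t)" using that \<eta> t1 \<tau> by (intro nonneg) auto
        finally show ?thesis .
      qed
      show "\<phi> (b - \<xi>', t) \<le> w (b - \<xi>', t)" if "t1 \<le> t" "t < t1 + \<tau>" for t
      proof -
        have "\<omega> * (t - t1) \<le> \<omega> * \<tau>" using \<omega> that by (intro mult_left_mono) auto
        then have "exp (\<mu> * (b - \<xi>' - b)) * exp (\<omega> * (t - t1)) \<le> 1 * exp (\<mu> * \<eta>)"
          unfolding \<tau>(2) using \<mu> \<xi>' by (intro mult_mono) auto
        then have "A * (exp (\<mu> * (b - \<xi>' - b)) * exp (\<omega> * (t - t1))) \<le> A * (1 * exp (\<mu> * \<eta>))"
          using A by (intro mult_left_mono) auto
        then have "\<phi> (b - \<xi>', t) \<le> N - 1"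
          using A(1) unfolding \<phi>_def N_def fst_conv snd_conv mult.assoc mult_1_left by linarith
        also have "\<dots> \<le> w (b - \<xi>', t)" using that \<xi>' by (intro \<xi>(2)) auto
        finally show ?thesis .
      qed
    qed (use \<eta> \<xi>' t1 \<tau> in \<open>auto simp: x0_def t0_def\<close>)
    moreover have "\<phi> (x0, t0) = A * (exp (\<mu> * \<eta> / 4) - 1)"
    proof -
      have "\<mu> * (x0 - b) + \<omega> * (t0 - t1) = \<mu> * \<eta> / 4" using \<tau>(2) by (simp add: x0_def t0_def field_simps)
      then have "exp (\<mu> * (x0 - b)) * exp (\<omega> * (t0 - t1)) = exp (\<mu> * \<eta> / 4)" by (metis exp_add)
      then show ?thesis by (simp add: \<phi>_def mult.assoc right_diff_distrib)
    qed
    ultimately show ?thesis by simp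
  qed
  define q where "q = exp (\<mu> * \<eta> / 4) - 1"
  have q: "q > 0" using \<mu> \<eta> by (simp add: q_def)
  \<comment> \<open>The last summand pushes the lower bound \<open>A * q\<close> beyond the finite
    value of \<open>w\<close> at \<open>(x0, t0)\<close>.\<close>
  define A where "A = exp (\<mu> * \<eta>) / \<mu> + (\<bar>w (x0, t0)\<bar> + 1) / q"
  have "(\<bar>w (x0, t0)\<bar> + 1) / q > 0" "exp (\<mu> * \<eta>) / \<mu> > 0" using q \<mu> by auto
  then have "A > 0" "exp (\<mu> * \<eta>) / \<mu> \<le> A" "(\<bar>w (x0, t0)\<bar> + 1) / q \<le> A" by (auto simp: A_def)
  then have A: "A > 0" "exp (\<mu> * \<eta>) \<le> \<mu> * A" "\<bar>w (x0, t0)\<bar> + 1 \<le> A * q"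
    using \<mu> q by (simp_all add: pos_divide_le_eq mult.commute)
  have "A * q \<le> w (x0, t0)" unfolding q_def by (rule lower[OF A(1,2)])
  then show False using A(3) by linarith
qed

end

section \<open>Bounds for the initial data\<close>

lemma bounded_below_of_limits:
  fixes u :: "real \<Rightarrow> real"
  assumes b: "b > 0" and cont: "continuous_on {-b<..<b} u"
    and ends: "\<exists>\<delta>>0. \<forall>x\<in>{b - \<delta><..<b}. m \<le> u x" "\<exists>\<delta>>0. \<forall>x\<in>{-b<..<- b + \<delta>}. m \<le> u x"
  shows "\<exists>m. \<forall>x\<in>{-b<..<b}. m \<le> u x"
proof -
  obtain \<delta>1 where \<delta>1: "\<delta>1 > 0" "\<And>x. x \<in> {b - \<delta>1<..<b} \<Longrightarrow> m \<le> u x" using ends(1) by blast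
  obtain \<delta>2 where \<delta>2: "\<delta>2 > 0" "\<And>x. x \<in> {-b<..<- b + \<delta>2} \<Longrightarrow> m \<le> u x" using ends(2) by blast
  define d where "d = min b (min \<delta>1 \<delta>2) / 2"
  have d: "0 < d" "d < b" "d < \<delta>1" "d < \<delta>2" using b \<delta>1 \<delta>2 by (auto simp: d_def min_def)
  have "continuous_on {- b + d..b - d} u" using d by (intro continuous_on_subset[OF cont]) auto
  moreover have "{- b + d..b - d} \<noteq> {}" using d by simp
  ultimately obtain y where y: "\<forall>x\<in>{- b + d..b - d}. u y \<le> u x"
    using continuous_attains_inf[OF compact_Icc] by blast
  have "min m (u y) \<le> u x" if x: "x \<in> {-b<..<b}" for x
  proof -
    consider "x \<in> {b - \<delta>1<..<b}" | "x \<in> {-b<..<- b + \<delta>2}" | "x \<in> {- b + d..b - d}" using x d by fastforce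
    then show ?thesis using \<delta>1(2) \<delta>2(2) y by cases (auto simp: min_le_iff_disj)
  qed
  then show ?thesis by blast
qed

lemma Limsup_finite_bound:
  fixes h :: "real \<Rightarrow> real" and G :: "real filter"
  assumes "Limsup G (\<lambda>x. ereal (h x)) < \<infinity>"
  shows "\<exists>M. \<forall>\<^sub>F x in G. h x \<le> M"
proof -
  obtain M where "Limsup G (\<lambda>x. ereal (h x)) < ereal M" using ereal_dense2[OF assms] by blast
  then have "\<forall>\<^sub>F x in G. ereal (h x) < ereal M" by (rule Limsup_lessD)
  then show ?thesis by (intro exI[of _ M]) (auto elim: eventually_mono)
qed

lemma weight_lower_bounds:
  assumes "b > 0" "\<gamma> > 0" "x \<in> {-b<..<b}"
  shows "(2 * b) powr - \<gamma> * (b - x) powr - \<gamma> \<le> weight b \<gamma> x" "(2 * b) powr - \<gamma> * (b + x) powr - \<gamma> \<le> weight b \<gamma> x"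
proof -
  have eq: "b\<^sup>2 - x\<^sup>2 = (b + x) * (b - x)" by (simp add: power2_eq_square algebra_simps)
  have "(b + x) * (b - x) \<le> (2 * b) * (b - x)" "(b + x) * (b - x) \<le> (b + x) * (2 * b)"
    using assms by (auto intro!: mult_mono)
  then have "((2 * b) * (b - x)) powr - \<gamma> \<le> weight b \<gamma> x" "((b + x) * (2 * b)) powr - \<gamma> \<le> weight b \<gamma> x"
    unfolding weight_def eq using assms by (auto intro!: powr_mono2')
  then show "(2 * b) powr - \<gamma> * (b - x) powr - \<gamma> \<le> weight b \<gamma> x" "(2 * b) powr - \<gamma> * (b + x) powr - \<gamma> \<le> weight b \<gamma> x"
    by (simp_all add: powr_mult mult.commute)
qed

text \<open>Near each end one factor of \<open>b\<^sup>2 - x\<^sup>2\<close> is at most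
  \<open>2 * b\<close>, so the one-sided growth condition bounds \<open>u0\<close> by a multiple of
  the weight there. In between the quotient is continuous; its negative fits the lower bound just
  proved.\<close>

lemma weight_bound_of_Limsup:
  fixes u0 :: "real \<Rightarrow> real"
  assumes b: "b > 0" and \<gamma>: "\<gamma> > 0" and cont: "continuous_on {-b<..<b} u0"
    and sup: "Limsup (at_left b) (\<lambda>x. ereal (u0 x * (b - x) powr \<gamma>)) < \<infinity>"
      "Limsup (at_right (-b)) (\<lambda>x. ereal (u0 x * (b + x) powr \<gamma>)) < \<infinity>"
  shows "\<exists>M. \<forall>x\<in>{-b<..<b}. u0 x \<le> M * weight b \<gamma> x"
proof -
  define h where "h = (\<lambda>x. - (u0 x / weight b \<gamma> x))"
  have w: "weight b \<gamma> x > 0" if "x \<in> {-b<..<b}" for x using gap_pos[OF that] by (simp add: weight_def)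
  have near: "- (\<bar>M\<bar> * (2 * b) powr \<gamma>) \<le> h x"
    if x: "x \<in> {-b<..<b}" and r: "r > 0" "u0 x * r powr \<gamma> \<le> M" and ge: "(2 * b) powr - \<gamma> * r powr - \<gamma> \<le> weight b \<gamma> x" for x r M
  proof -
    have "u0 x = (u0 x * r powr \<gamma>) * r powr - \<gamma>" using r by (simp add: powr_minus)
    also have "\<dots> \<le> \<bar>M\<bar> * r powr - \<gamma>" using r by (intro mult_right_mono) auto
    also have "r powr - \<gamma> = (2 * b) powr \<gamma> * ((2 * b) powr - \<gamma> * r powr - \<gamma>)" using b by (simp add: powr_minus)
    also have "\<bar>M\<bar> * \<dots> \<le> \<bar>M\<bar> * ((2 * b) powr \<gamma> * weight b \<gamma> x)" using ge by (intro mult_left_mono) auto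
    finally show ?thesis using w[OF x] by (simp add: h_def pos_divide_le_eq mult.assoc)
  qed
  obtain M1 where "\<forall>\<^sub>F x in at_left b. u0 x * (b - x) powr \<gamma> \<le> M1" using Limsup_finite_bound[OF sup(1)] by blast
  then obtain a1 where a1: "a1 < b" "\<And>x. a1 < x \<Longrightarrow> x < b \<Longrightarrow> u0 x * (b - x) powr \<gamma> \<le> M1"
    unfolding eventually_at_left_field by auto
  obtain M2 where "\<forall>\<^sub>F x in at_right (- b). u0 x * (b + x) powr \<gamma> \<le> M2" using Limsup_finite_bound[OF sup(2)] by blast
  then obtain a2 where a2: "a2 > - b" "\<And>x. - b < x \<Longrightarrow> x < a2 \<Longrightarrow> u0 x * (b + x) powr \<gamma> \<le> M2"
    unfolding eventually_at_right_field by auto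
  define m where "m = min (- (\<bar>M1\<bar> * (2 * b) powr \<gamma>)) (- (\<bar>M2\<bar> * (2 * b) powr \<gamma>))"
  have "continuous_on {-b<..<b} h"
    unfolding h_def by (intro continuous_intros cont continuous_on_weight) (use w in fastforce)
  moreover have "\<exists>\<delta>>0. \<forall>x\<in>{b - \<delta><..<b}. m \<le> h x"
  proof (intro exI[of _ "min b (b - a1)"] conjI ballI)
    fix x assume x: "x \<in> {b - min b (b - a1)<..<b}"
    then have x': "x \<in> {-b<..<b}" "a1 < x" using b by auto
    have "- (\<bar>M1\<bar> * (2 * b) powr \<gamma>) \<le> h x"
      using x' weight_lower_bounds(1)[OF b \<gamma> x'(1)] by (intro near[of x "b - x"] a1) auto
    then show "m \<le> h x" by (simp add: m_def min_le_iff_disj)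
  qed (use b a1 in auto)
  moreover have "\<exists>\<delta>>0. \<forall>x\<in>{-b<..<- b + \<delta>}. m \<le> h x"
  proof (intro exI[of _ "min b (a2 + b)"] conjI ballI)
    fix x assume x: "x \<in> {-b<..<- b + min b (a2 + b)}"
    then have x': "x \<in> {-b<..<b}" "x < a2" using b by auto
    have "- (\<bar>M2\<bar> * (2 * b) powr \<gamma>) \<le> h x"
      using x' weight_lower_bounds(2)[OF b \<gamma> x'(1)] by (intro near[of x "b + x"] a2) auto
    then show "m \<le> h x" by (simp add: m_def min_le_iff_disj)
  qed (use b a2 in auto)
  ultimately obtain k where k: "\<And>x. x \<in> {-b<..<b} \<Longrightarrow> k \<le> h x" using bounded_below_of_limits[OF b] by blast
  have "u0 x \<le> - k * weight b \<gamma> x" if x: "x \<in> {-b<..<b}" for x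
  proof -
    have "u0 x / weight b \<gamma> x \<le> - k" using k[OF x] by (simp add: h_def)
    then show ?thesis using w[OF x] by (simp add: pos_divide_le_eq)
  qed
  then show ?thesis by blast
qed

theorem theorem1p3:
  fixes b \<alpha> \<beta> Cfp Cfm Cgp Cgm :: real
    and f g u0 :: "real \<Rightarrow> real"
  assumes "b > 0"
    and "continuous_on UNIV f" and "strict_mono f" and "f 0 = 0"
    and "filterlim f at_top at_top" and "filterlim f at_bot at_bot"
    and "\<beta> > 0" and "Cfp > 0" and "Cfm > 0"
    and "((\<lambda>s. \<bar>s\<bar> powr (-\<beta>) * f s) \<longlongrightarrow> Cfp) at_top"
    and "((\<lambda>s. \<bar>s\<bar> powr (-\<beta>) * f s) \<longlongrightarrow> - Cfm) at_bot"
    and "continuous_on UNIV g" and "\<And>p. g p > 0"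
    and "\<alpha> \<le> 1" and "Cgp > 0" and "Cgm > 0"
    and "((\<lambda>s. \<bar>s\<bar> powr \<alpha> * g s) \<longlongrightarrow> Cgp) at_top"
    and "((\<lambda>s. \<bar>s\<bar> powr \<alpha> * g s) \<longlongrightarrow> Cgm) at_bot"
  shows
    "(\<alpha> < 1 \<and> \<beta> \<ge> 1 / (1 - \<alpha>) \<and>
       continuous_on {-b<..<b} u0 \<and> (INF x\<in>{-b<..<b}. ereal (u0 x)) > -\<infinity>
      \<longrightarrow> \<not> (\<exists>u :: real \<times> real \<Rightarrow> real. viscosity_solution b f g u0 u))
     \<and>
     ((\<alpha> = 1 \<or> \<alpha> < 1 \<and> \<beta> < 1 / (1 - \<alpha>)) \<and>
       (continuous_on {-b..b} u0 \<or>
        continuous_on {-b<..<b} u0 \<and>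
        filterlim u0 at_top (at_left b) \<and> filterlim u0 at_top (at_right (-b)) \<and>
        (\<exists>\<gamma>>0. Limsup (at_left b) (\<lambda>x. ereal (u0 x * (b - x) powr \<gamma>)) < \<infinity> \<and>
               Limsup (at_right (-b)) (\<lambda>x. ereal (u0 x * (b + x) powr \<gamma>)) < \<infinity>))
      \<longrightarrow> (\<exists>u :: real \<times> real \<Rightarrow> real. viscosity_solution b f g u0 u))"
proof -
  obtain a0 a1 c0 c1 where "power_growth f g \<alpha> \<beta> a0 a1 c0 c1"
    using power_growth_of_limits[OF assms(2-4,7-18)] by blast
  then interpret power_growth f g \<alpha> \<beta> a0 a1 c0 c1 .
  have b: "b > 0" by fact
  show ?thesis
  proof (intro conjI impI)
    assume H: "\<alpha> < 1 \<and> \<beta> \<ge> 1 / (1 - \<alpha>) \<and>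
       continuous_on {-b<..<b} u0 \<and> (INF x\<in>{-b<..<b}. ereal (u0 x)) > -\<infinity>"
    then have "1 - \<alpha> > 0" "1 / (1 - \<alpha>) \<le> \<beta>" by simp_all
    then have "1 \<le> \<beta> * (1 - \<alpha>)" by (simp add: pos_divide_le_eq)
    from no_super_solution[OF b this]
    show "\<not> (\<exists>u :: real \<times> real \<Rightarrow> real. viscosity_solution b f g u0 u)"
      unfolding viscosity_solution_def by blast
  next
    assume H: "(\<alpha> = 1 \<or> \<alpha> < 1 \<and> \<beta> < 1 / (1 - \<alpha>)) \<and>
       (continuous_on {-b..b} u0 \<or>
        continuous_on {-b<..<b} u0 \<and>
        filterlim u0 at_top (at_left b) \<and> filterlim u0 at_top (at_right (-b)) \<and>
        (\<exists>\<gamma>>0. Limsup (at_left b) (\<lambda>x. ereal (u0 x * (b - x) powr \<gamma>)) < \<infinity> \<and>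
               Limsup (at_right (-b)) (\<lambda>x. ereal (u0 x * (b + x) powr \<gamma>)) < \<infinity>))"
    \<comment> \<open>This form also covers \<alpha> = 1, where the product is 0.\<close>
    have \<theta>: "\<beta> * (1 - \<alpha>) < 1" using H by (auto simp: pos_less_divide_eq)
    have cont: "continuous_on {-b<..<b} u0"
    proof -
      have "{-b<..<b} \<subseteq> {-b..b}" by auto
      then show ?thesis using H continuous_on_subset by blast
    qed
    have "\<exists>m0. \<forall>x\<in>{-b<..<b}. m0 \<le> u0 x"
    proof (cases "continuous_on {-b..b} u0")
      case True
      then have "bounded (u0 ` {-b..b})" using compact_continuous_image compact_imp_bounded by blast
      then obtain B where B: "\<forall>x\<in>{-b..b}. \<bar>u0 x\<bar> \<le> B" unfolding bounded_real by blast
      have "- B \<le> u0 x" if "x \<in> {-b<..<b}" for x using B[rule_format, of x] that by auto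
      then show ?thesis by blast
    next
      case False
      then have lims: "\<forall>\<^sub>F x in at_left b. 0 \<le> u0 x" "\<forall>\<^sub>F x in at_right (- b). 0 \<le> u0 x"
        using H unfolding filterlim_at_top by blast+
      obtain a1 where a1: "a1 < b" "\<And>x. a1 < x \<Longrightarrow> x < b \<Longrightarrow> 0 \<le> u0 x"
        using lims(1) unfolding eventually_at_left_field by auto
      obtain a2 where a2: "a2 > - b" "\<And>x. - b < x \<Longrightarrow> x < a2 \<Longrightarrow> 0 \<le> u0 x"
        using lims(2) unfolding eventually_at_right_field by auto
      show ?thesis
      proof (rule bounded_below_of_limits[OF b cont])
        show "\<exists>\<delta>>0. \<forall>x\<in>{b - \<delta><..<b}. 0 \<le> u0 x" using a1 by (intro exI[of _ "b - a1"]) auto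
        show "\<exists>\<delta>>0. \<forall>x\<in>{-b<..<- b + \<delta>}. 0 \<le> u0 x" using a2 by (intro exI[of _ "a2 + b"]) auto
      qed
    qed
    then obtain m0 where m0: "\<And>x. x \<in> {-b<..<b} \<Longrightarrow> m0 \<le> u0 x" by blast
    have "\<exists>\<gamma>>0. \<exists>M. \<forall>x\<in>{-b<..<b}. u0 x \<le> M * weight b \<gamma> x"
    proof (cases "continuous_on {-b..b} u0")
      case True
      then have "bounded (u0 ` {-b..b})" using compact_continuous_image compact_imp_bounded by blast
      then obtain B where B: "\<forall>x\<in>{-b..b}. \<bar>u0 x\<bar> \<le> B" unfolding bounded_real by blast
      \<comment> \<open>For bounded data any exponent would do; with exponent 1 the weight is at
        least \<open>1 / b\<^sup>2\<close>.\<close>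
      have "u0 x \<le> B * b\<^sup>2 * weight b 1 x" if x: "x \<in> {-b<..<b}" for x
      proof -
        have B': "u0 x \<le> B" "0 \<le> B" using B[rule_format, of x] x by auto
        have "1 \<le> b\<^sup>2 * weight b 1 x"
          using gap_pos[OF x] by (simp add: weight_def powr_minus_divide)
        from mult_left_mono[OF this B'(2)] B'(1) show ?thesis by (simp add: mult.assoc)
      qed
      then show ?thesis using zero_less_one by blast
    next
      case False
      then obtain \<gamma> where "\<gamma> > 0" "Limsup (at_left b) (\<lambda>x. ereal (u0 x * (b - x) powr \<gamma>)) < \<infinity>"
        "Limsup (at_right (-b)) (\<lambda>x. ereal (u0 x * (b + x) powr \<gamma>)) < \<infinity>" using H by blast
      then show ?thesis using weight_bound_of_Limsup[OF b _ cont] by blast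
    qed
    then obtain \<gamma> M where "\<gamma> > 0" "\<And>x. x \<in> {-b<..<b} \<Longrightarrow> u0 x \<le> M * weight b \<gamma> x" by blast
    from exists_viscosity_solution[OF b \<theta> cont m0 this]
    show "\<exists>u :: real \<times> real \<Rightarrow> real. viscosity_solution b f g u0 u" .
  qed
qed

end
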